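(* Let $v$ be a viscosity solution of $H(x,c+v_x(x))=h(c)$ on $\mathbb{T}^n$. Then: (i) $v$ is differentiable at every point of $\mathcal{M}_\alpha(v;c)$. (ii) If $\gamma^\ast$ is a minimizing curve of $v$ and $(x^\ast,\xi^\ast)$ is an $\alpha$-limit point of $s\mapsto(\gamma^\ast(s),\gamma^{\ast\prime}(s))$, i.e. there exist $\tau_j\to-\infty$ with $(\gamma^\ast(\tau_j),\gamma^{\ast\prime}(\tau_j))\to(x^\ast,\xi^\ast)$, then $\xi^\ast=H_p(x^\ast,c+v_x(x^\ast))$. (iii) If $x^\ast\in\mathcal{M}_\alpha(v;c)$ and $x(s)$ is the solution of the Euler–Lagrange equation $\frac{d}{ds}L_\xi(x,x')=L_x(x,x')$ with $x(0)=x^\ast$, $x'(0)=H_p(x^\ast,c+v_x(x^\ast))$, then for all $s\in\mathbb{R}$ we have $x(s)\in\mathcal{M}_\alpha(v;c)$, $v$ is differentiable at $x(s)$ and $v_x(x(s))=L_\xi(x(s),x'(s))-c$. (iv) If $v$ and $\tilde v$ are two viscosity solutions of $H(x,c+v_x)=h(c)$ with $v=\tilde v$ on $\mathcal{M}_\alpha(c)$, then $v=\tilde v$ on $\mathbb{T}^n$.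
   Context: $H:\mathbb{T}^n\times\mathbb{R}^n\to\mathbb{R}$ is $C^2$, $H_{pp}$ is positive definite, and $H(x,p)/|p|\to+\infty$ as $|p|\to\infty$ uniformly in $x$. $L(x,\xi)=\sup_{p}\{\xi\cdot p-H(x,p)\}$ is its Legendre transform. $c\in\mathbb{R}^n$ is fixed and $h(c)$ is the unique constant for which $H(x,c+v_x)=h(c)$ has a viscosity solution on $\mathbb{T}^n$. Every viscosity solution $v$ is Lipschitz and satisfies, for all $x\in\mathbb{T}^n$ and $T>0$, $v(x)=\inf\{\int_{-T}^0(L(\gamma,\gamma')-c\cdot\gamma'+h(c))\,ds+v(\gamma(-T))\}$, the infimum being over absolutely continuous $\gamma:[-T,0]\to\mathbb{T}^n$ with $\gamma(0)=x$. A minimizing curve for $v(x)$ (one-sided global minimizing curve) is a curve $\gamma^\ast:(-\infty,0]\to\mathbb{T}^n$ with $\gamma^\ast(0)=x$ whose restriction to $[-T,0]$ attains this infimum for every $T>0$; a minimizing curve of $v$ is a minimizing curve for $v(x)$ for some $x$. A point $x^\ast$ is an $\alpha$-limit point of $\gamma^\ast$ if $\gamma^\ast(\tau_j)\to x^\ast$ for some sequence $\tau_j\to-\infty$. $\mathcal{M}_\alpha(v;c)$ is the closure of the set of all $\alpha$-limit points of all minimizing curves for $v(x)$, $x\in\mathbb{T}^n$; $\mathcal{M}_\alpha(c)$ is the closure of the union of $\mathcal{M}_\alpha(v;c)$ over all viscosity solutions $v$ (with this fixed $c$). *)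

theory Defs
  imports "HOL-Analysis.Analysis"
begin

text \<open>The torus T^n is represented by R^n (type real^'n) modulo the integer lattice.
Functions on T^n are lattice-periodic functions on R^n, curves on T^n are represented
by their lifts to R^n, subsets of T^n by their lattice-invariant preimages in R^n.\<close>

definition lattice :: "(real^'n) set" where
  "lattice = {k. \<forall>i. k $ i \<in> \<int>}"

definition periodic :: "(real^'n \<Rightarrow> 'b) \<Rightarrow> bool" where
  "periodic f \<longleftrightarrow> (\<forall>x k. k \<in> lattice \<longrightarrow> f (x + k) = f x)"

text \<open>Gradient of a real-valued function at a point (meaningful where differentiable).\<close>
definition grad :: "('a::real_inner \<Rightarrow> real) \<Rightarrow> 'a \<Rightarrow> 'a" where
  "grad f x = (SOME p. (f has_derivative (\<lambda>u. p \<bullet> u)) (at x))"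

definition C1 :: "('a::euclidean_space \<Rightarrow> real) \<Rightarrow> bool" where
  "C1 f \<longleftrightarrow> (\<exists>D. (\<forall>z. (f has_derivative blinfun_apply (D z)) (at z)) \<and> continuous_on UNIV D)"

definition C2_with :: "('a::euclidean_space \<Rightarrow> real) \<Rightarrow> ('a \<Rightarrow> 'a \<Rightarrow>\<^sub>L real) \<Rightarrow> ('a \<Rightarrow> 'a \<Rightarrow>\<^sub>L 'a \<Rightarrow>\<^sub>L real) \<Rightarrow> bool" where
  "C2_with f D D2 \<longleftrightarrow> (\<forall>z. (f has_derivative blinfun_apply (D z)) (at z)) \<and>
      (\<forall>z. (D has_derivative blinfun_apply (D2 z)) (at z)) \<and> continuous_on UNIV D2"

definition tonelli_hamiltonian :: "(real^'n \<Rightarrow> real^'n \<Rightarrow> real) \<Rightarrow> bool" where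
  "tonelli_hamiltonian H \<longleftrightarrow>
     (\<forall>p. periodic (\<lambda>x. H x p)) \<and>
     (\<exists>D D2. C2_with (\<lambda>(x,p). H x p) D D2 \<and>
        (\<forall>x p u. u \<noteq> 0 \<longrightarrow> blinfun_apply (blinfun_apply (D2 (x,p)) (0,u)) (0,u) > 0)) \<and>
     (\<forall>M. \<exists>R. \<forall>x p. norm p \<ge> R \<longrightarrow> H x p \<ge> M * norm p)"

definition lagrangian :: "(real^'n \<Rightarrow> real^'n \<Rightarrow> real) \<Rightarrow> real^'n \<Rightarrow> real^'n \<Rightarrow> real" where
  "lagrangian H x \<xi> = (SUP p. \<xi> \<bullet> p - H x p)"

definition Hp :: "(real^'n \<Rightarrow> real^'n \<Rightarrow> real) \<Rightarrow> real^'n \<Rightarrow> real^'n \<Rightarrow> real^'n" where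
  "Hp H x p = grad (H x) p"

definition Lxi :: "(real^'n \<Rightarrow> real^'n \<Rightarrow> real) \<Rightarrow> real^'n \<Rightarrow> real^'n \<Rightarrow> real^'n" where
  "Lxi H x \<xi> = grad (lagrangian H x) \<xi>"

definition Lx :: "(real^'n \<Rightarrow> real^'n \<Rightarrow> real) \<Rightarrow> real^'n \<Rightarrow> real^'n \<Rightarrow> real^'n" where
  "Lx H x \<xi> = grad (\<lambda>y. lagrangian H y \<xi>) x"

definition viscosity_solution ::
  "(real^'n \<Rightarrow> real^'n \<Rightarrow> real) \<Rightarrow> real^'n \<Rightarrow> real \<Rightarrow> (real^'n \<Rightarrow> real) \<Rightarrow> bool" where
  "viscosity_solution H c h v \<longleftrightarrow> periodic v \<and> continuous_on UNIV v \<and>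
     (\<forall>\<phi> x p. C1 \<phi> \<and> (\<phi> has_derivative (\<lambda>u. p \<bullet> u)) (at x) \<longrightarrow>
        ((\<exists>e>0. \<forall>y. dist y x < e \<longrightarrow> v y - \<phi> y \<le> v x - \<phi> x) \<longrightarrow> H x (c + p) \<le> h) \<and>
        ((\<exists>e>0. \<forall>y. dist y x < e \<longrightarrow> v y - \<phi> y \<ge> v x - \<phi> x) \<longrightarrow> H x (c + p) \<ge> h))"

definition abs_cont_on :: "(real \<Rightarrow> 'a::real_normed_vector) \<Rightarrow> real \<Rightarrow> real \<Rightarrow> bool" where
  "abs_cont_on \<gamma> a b \<longleftrightarrow> (\<forall>\<epsilon>>0. \<exists>\<delta>>0. \<forall>(n::nat) u w.
      (\<forall>i<n. a \<le> u i \<and> u i \<le> w i \<and> w i \<le> b) \<and>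
      (\<forall>i<n. \<forall>j<n. i \<noteq> j \<longrightarrow> w i \<le> u j \<or> w j \<le> u i) \<and>
      (\<Sum>i<n. w i - u i) < \<delta> \<longrightarrow> (\<Sum>i<n. norm (\<gamma> (w i) - \<gamma> (u i))) < \<epsilon>)"

text \<open>Integrand of the action, using the (a.e. existing) derivative of the curve.\<close>
definition action_integrand ::
  "(real^'n \<Rightarrow> real^'n \<Rightarrow> real) \<Rightarrow> real^'n \<Rightarrow> real \<Rightarrow> (real \<Rightarrow> real^'n) \<Rightarrow> real \<Rightarrow> real" where
  "action_integrand H c h \<gamma> s =
     lagrangian H (\<gamma> s) (vector_derivative \<gamma> (at s)) - c \<bullet> vector_derivative \<gamma> (at s) + h"

text \<open>Admissible curves on [-T,0]: absolutely continuous with finite action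
(curves with non-integrable action have action +infinity, L being bounded below).\<close>
definition admissible ::
  "(real^'n \<Rightarrow> real^'n \<Rightarrow> real) \<Rightarrow> real^'n \<Rightarrow> real \<Rightarrow> real \<Rightarrow> (real \<Rightarrow> real^'n) \<Rightarrow> bool" where
  "admissible H c h T \<gamma> \<longleftrightarrow> abs_cont_on \<gamma> (-T) 0 \<and>
     action_integrand H c h \<gamma> absolutely_integrable_on {-T..0}"

definition action ::
  "(real^'n \<Rightarrow> real^'n \<Rightarrow> real) \<Rightarrow> real^'n \<Rightarrow> real \<Rightarrow> real \<Rightarrow> (real \<Rightarrow> real^'n) \<Rightarrow> real" where
  "action H c h T \<gamma> = integral {-T..0} (action_integrand H c h \<gamma>)"

definition representation_formula ::
  "(real^'n \<Rightarrow> real^'n \<Rightarrow> real) \<Rightarrow> real^'n \<Rightarrow> real \<Rightarrow> (real^'n \<Rightarrow> real) \<Rightarrow> bool" where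
  "representation_formula H c h v \<longleftrightarrow> (\<forall>x T. T > 0 \<longrightarrow>
     v x = (INF \<gamma> \<in> {\<gamma>. admissible H c h T \<gamma> \<and> \<gamma> 0 = x}. action H c h T \<gamma> + v (\<gamma> (-T))))"

definition minimizing_curve_for ::
  "(real^'n \<Rightarrow> real^'n \<Rightarrow> real) \<Rightarrow> real^'n \<Rightarrow> real \<Rightarrow> (real^'n \<Rightarrow> real) \<Rightarrow> real^'n \<Rightarrow> (real \<Rightarrow> real^'n) \<Rightarrow> bool" where
  "minimizing_curve_for H c h v x \<gamma> \<longleftrightarrow> \<gamma> 0 = x \<and>
     (\<forall>T>0. admissible H c h T \<gamma> \<and> action H c h T \<gamma> + v (\<gamma> (-T)) = v x)"

definition minimizing_curve ::
  "(real^'n \<Rightarrow> real^'n \<Rightarrow> real) \<Rightarrow> real^'n \<Rightarrow> real \<Rightarrow> (real^'n \<Rightarrow> real) \<Rightarrow> (real \<Rightarrow> real^'n) \<Rightarrow> bool" where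
  "minimizing_curve H c h v \<gamma> \<longleftrightarrow> (\<exists>x. minimizing_curve_for H c h v x \<gamma>)"

definition alpha_limit_point :: "(real \<Rightarrow> real^'n) \<Rightarrow> real^'n \<Rightarrow> bool" where
  "alpha_limit_point \<gamma> y \<longleftrightarrow> (\<exists>\<tau> k. filterlim \<tau> at_bot sequentially \<and> (\<forall>j. k j \<in> lattice) \<and>
      ((\<lambda>j. \<gamma> (\<tau> j) - k j) \<longlongrightarrow> y) sequentially)"

definition M_alpha_v ::
  "(real^'n \<Rightarrow> real^'n \<Rightarrow> real) \<Rightarrow> real^'n \<Rightarrow> real \<Rightarrow> (real^'n \<Rightarrow> real) \<Rightarrow> (real^'n) set" where
  "M_alpha_v H c h v = closure {y. \<exists>\<gamma>. minimizing_curve H c h v \<gamma> \<and> alpha_limit_point \<gamma> y}"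

definition M_alpha ::
  "(real^'n \<Rightarrow> real^'n \<Rightarrow> real) \<Rightarrow> real^'n \<Rightarrow> real \<Rightarrow> (real^'n) set" where
  "M_alpha H c h = closure (\<Union> {M_alpha_v H c h w | w. viscosity_solution H c h w})"

end

theory Submission
  imports Defs "HOL-Complex_Analysis.Great_Picard"
begin

text \<open>
  A minimizing curve \<open>\<gamma>\<close> of \<open>v\<close> is calibrated: the increment of \<open>v\<close> along each piece of \<open>\<gamma>\<close> equals the
  action of that piece. Since \<open>v\<close> is Lipschitz and \<open>L\<close> is superlinear, calibrated curves are uniformly
  Lipschitz, so limits of their time and lattice translates exist; calibration survives the limit because
  by Legendre duality it is equivalent to a family of inequalities involving only the values of the curve.
  Hence every point of \<open>M_alpha_v\<close> lies on a calibrated curve defined on all of \<open>\<real>\<close> and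
  contained in \<open>M_alpha_v\<close>. The same compactness, applied to almost minimizers of the representation
  formula, produces minimizing curves, which gives (iv) by comparing two solutions along them.

  Comparing \<open>v\<close> with the action of \<open>s \<mapsto> \<gamma> s + (\<alpha> + \<beta> s) u\<close> before and after time \<open>t\<close> squeezes \<open>v\<close>
  between two functions with second-order contact at \<open>\<gamma> t\<close>, uniformly in the curve: this is (i), and the
  uniformity lets gradients pass to the limit in (ii). Translating the curve by \<open>u\<close> instead shows that
  \<open>(\<gamma>, c + grad v \<circ> \<gamma>)\<close> solves Hamilton's equations, and uniqueness for these yields (iii).

  Minimizing curves are only absolutely continuous a priori, hence Lebesgue's theorem on the
  differentiability of monotone functions and the fundamental theorem of calculus for absolutely
  continuous curves are needed.
\<close>

section \<open>Absolutely continuous curves\<close>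

text \<open>The identity that defines calibration involves velocities, and for minimizers these are
  merely measurable, so its stability under limits of curves is not visible. \<open>acal\<close>
  needs neither weak convergence of velocities nor lower semicontinuity of the action: for a fixed
  momentum p, Fenchel's inequality is affine in the velocity and integrates to an expression in the
  end points. A momentum at distance C + 1 from c in the direction of the displacement beats the
  Lipschitz constant C of v and yields the speed bound; the dual momentum of the velocity recovers
  the Lagrangian at almost every time. The differentiability argument spends one unit of time on
  each side of a point: the past bounds v from above, the future from below. The end point of a
  minimizing curve has no future, whereas limits of its time translates have both; this singles out
  the limit set. Second-order control of L comes without second derivatives of L: positivity of
  H_pp, uniform for bounded p, makes the momentum a locally Lipschitz function of position and
  velocity, and Fenchel's inequality in both directions then gives a quadratic remainder.\<close>

lemma mono_sum_increments_le:
  fixes f :: "real \<Rightarrow> real"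
  assumes f: "mono f" and "finite C" "a \<le> b"
    and "\<And>i j. i \<in> C \<Longrightarrow> j \<in> C \<Longrightarrow> i \<noteq> j \<Longrightarrow> w i \<le> u j \<or> w j \<le> u i"
    and "\<And>i. i \<in> C \<Longrightarrow> a \<le> u i \<and> u i < w i \<and> w i \<le> b"
  shows "(\<Sum>i\<in>C. f (w i) - f (u i)) \<le> f b - f a"
  using assms(2-)
proof (induction "card C" arbitrary: C b)
  case 0
  then show ?case using monoD[OF f, of a b] by simp
next
  case (Suc n)
  then have "C \<noteq> {}" by auto
  \<comment> \<open>The interval with the greatest left end lies to the right of all others: since
    it has positive length, no other interval can begin at or after its right end. The induction
    continues on the part up to \<open>u i\<close>.\<close>
  obtain i where i: "i \<in> C" "\<And>j. j \<in> C \<Longrightarrow> u j \<le> u i"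
    using finite_imageI[OF Suc.prems(1), of u] \<open>C \<noteq> {}\<close> Max_in[of "u ` C"] Max_ge[of "u ` C"]
    by (metis (no_types, lifting) empty_is_image imageE image_eqI)
  have le: "w j \<le> u i" if "j \<in> C - {i}" for j
    using Suc.prems(3)[of i j] Suc.prems(4)[of i] i that by force
  have "(\<Sum>j\<in>C - {i}. f (w j) - f (u j)) \<le> f (u i) - f a"
  proof (rule Suc.hyps(1))
    show "n = card (C - {i})" using Suc.hyps(2) i(1) Suc.prems(1) by simp
    show "\<And>i' j. i' \<in> C - {i} \<Longrightarrow> j \<in> C - {i} \<Longrightarrow> i' \<noteq> j \<Longrightarrow> w i' \<le> u j \<or> w j \<le> u i'"
      using Suc.prems(3) by auto
  qed (use Suc.prems i le in auto)
  moreover have "f (w i) \<le> f b" using Suc.prems(4)[OF i(1)] monoD[OF f] by blast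
  ultimately show ?case
    using sum.remove[OF Suc.prems(1) i(1), of "\<lambda>i. f (w i) - f (u i)"] by linarith
qed

lemma cball_interval:
  fixes u w :: real
  shows "cball ((u + w) / 2) ((w - u) / 2) = {u..w}"
  by (auto simp: dist_real_def field_simps abs_le_iff)

text \<open>Midpoint and half length turn the intervals into the closed balls of the Vitali theorem.
  The point \<open>x\<close> may sit anywhere in its interval, which matters because an interval
  spanned by a difference quotient has \<open>x\<close> as an end point.\<close>

lemma Vitali_intervals:
  fixes S :: "real set" and K :: "(real \<times> real) set"
  assumes K: "\<And>u w. (u, w) \<in> K \<Longrightarrow> u < w"
    and S: "\<And>x d. x \<in> S \<Longrightarrow> 0 < d \<Longrightarrow> \<exists>u w. (u, w) \<in> K \<and> u \<le> x \<and> x \<le> w \<and> w - u < d"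
  obtains C where "countable C" "C \<subseteq> K"
    "pairwise (\<lambda>i j. disjnt {fst i..snd i} {fst j..snd j}) C"
    "negligible (S - (\<Union>i\<in>C. {fst i..snd i}))"
proof -
  let ?a = "\<lambda>i::real\<times>real. (fst i + snd i) / 2" and ?r = "\<lambda>i::real\<times>real. (snd i - fst i) / 2"
  have 1: "0 < ?r i" if "i \<in> K" for i
    using K[of "fst i" "snd i"] that by simp
  have 2: "\<exists>i. i \<in> K \<and> x \<in> cball (?a i) (?r i) \<and> ?r i < d" if xd: "x \<in> S" "0 < d" for x d
  proof -
    obtain u w where "(u, w) \<in> K \<and> u \<le> x \<and> x \<le> w \<and> w - u < d"
      using S[OF xd] by blast
    with K show ?thesis
      by (intro exI[of _ "(u, w)"]) (auto simp: cball_interval field_simps dest: K)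
  qed
  show thesis
    using Vitali_covering_theorem_cballs[of K ?r S ?a, OF 1 2] that
    unfolding cball_interval by blast
qed

lemma lmeasurable_Un_negligible:
  fixes A :: "'a::euclidean_space set"
  assumes "A \<in> lmeasurable" "negligible N"
  shows "A \<union> N \<in> lmeasurable" "measure lebesgue (A \<union> N) \<le> measure lebesgue A"
proof -
  have N: "N \<in> lmeasurable" "measure lebesgue N = 0"
    using assms(2) by (auto intro: negligible_imp_measurable negligible_imp_measure0)
  show "A \<union> N \<in> lmeasurable" using assms(1) N(1) by (rule fmeasurable.Un)
  have "measure lebesgue (A \<union> N) \<le> measure lebesgue A + measure lebesgue N"
    by (rule measure_Un_le) (use assms(1) N(1) in auto)
  with N(2) show "measure lebesgue (A \<union> N) \<le> measure lebesgue A" by simp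
qed

text \<open>Vitali selects disjoint intervals on each of which \<open>f\<close> grows by more than
  \<open>s\<close> times the length. Monotonicity bounds the total growth, hence the total length.
  The conclusion is about a measurable superset, that is about outer measure, since \<open>S\<close>
  is not assumed measurable.\<close>

lemma upper_derivate_cover:
  fixes f :: "real \<Rightarrow> real"
  assumes f: "mono f" and "s > 0" "a \<le> b" and S: "S \<subseteq> {a<..<b}"
    and der: "\<And>x d. x \<in> S \<Longrightarrow> 0 < d \<Longrightarrow> \<exists>y. y \<noteq> x \<and> \<bar>y - x\<bar> < d \<and> (f y - f x) / (y - x) > s"
  obtains U where "S \<subseteq> U" "U \<in> lmeasurable" "measure lebesgue U \<le> (f b - f a) / s"
proof -
  define K where "K = {(u, w). u < w \<and> a \<le> u \<and> w \<le> b \<and> f w - f u > s * (w - u)}"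
  have cov: "\<exists>u w. (u, w) \<in> K \<and> u \<le> x \<and> x \<le> w \<and> w - u < d" if xd: "x \<in> S" "0 < d" for x d
  proof -
    \<comment> \<open>Staying closer to \<open>x\<close> than \<open>a\<close> and \<open>b\<close>
      are keeps the selected interval inside \<open>{a..b}\<close>, where the growth of
      \<open>f\<close> is counted.\<close>
    have "0 < min d (min (x - a) (b - x))" using S xd by auto
    then obtain y where y: "y \<noteq> x" "\<bar>y - x\<bar> < min d (min (x - a) (b - x))" "(f y - f x) / (y - x) > s"
      using der[OF xd(1)] by blast
    show ?thesis
    proof (cases "x < y")
      case True
      then show ?thesis using y
        by (intro exI[of _ x] exI[of _ y]) (auto simp: K_def field_simps)
    next
      case False
      then show ?thesis using y
        by (intro exI[of _ y] exI[of _ x]) (auto simp: K_def field_simps)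
    qed
  qed
  obtain C where C: "countable C" "C \<subseteq> K"
    "pairwise (\<lambda>i j. disjnt {fst i..snd i} {fst j..snd j}) C"
    "negligible (S - (\<Union>i\<in>C. {fst i..snd i}))"
    by (rule Vitali_intervals[of K S, OF _ cov]) (auto simp: K_def)
  let ?V = "\<Union>i\<in>C. {fst i..snd i}"
  have fin: "measure lebesgue (\<Union>i\<in>I. {fst i..snd i}) \<le> (f b - f a) / s" if I: "I \<subseteq> C" "finite I" for I
  proof -
    have IK: "fst i < snd i \<and> a \<le> fst i \<and> snd i \<le> b \<and> s * (snd i - fst i) < f (snd i) - f (fst i)"
      if "i \<in> I" for i
      using that I C(2) unfolding K_def by auto
    have "measure lebesgue (\<Union>i\<in>I. {fst i..snd i}) \<le> (\<Sum>i\<in>I. measure lebesgue {fst i..snd i})"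
      using I by (intro measure_UNION_le) auto
    also have "\<dots> = (\<Sum>i\<in>I. snd i - fst i)"
      using IK by (intro sum.cong) (auto simp: less_imp_le)
    also have "\<dots> \<le> (\<Sum>i\<in>I. (f (snd i) - f (fst i)) / s)"
      using IK \<open>s > 0\<close> by (intro sum_mono) (auto simp: field_simps intro: less_imp_le)
    also have "\<dots> = (\<Sum>i\<in>I. f (snd i) - f (fst i)) / s"
      by (simp add: sum_divide_distrib)
    also have "\<dots> \<le> (f b - f a) / s"
    proof (rule divide_right_mono)
      show "(\<Sum>i\<in>I. f (snd i) - f (fst i)) \<le> f b - f a"
      proof (rule mono_sum_increments_le[OF f I(2) \<open>a \<le> b\<close>])
        show "snd i \<le> fst j \<or> snd j \<le> fst i" if ij: "i \<in> I" "j \<in> I" "i \<noteq> j" for i j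
        proof -
          have "disjnt {fst i..snd i} {fst j..snd j}"
            using C(3) I(1) ij unfolding pairwise_def by blast
          then show ?thesis using IK[OF ij(1)] IK[OF ij(2)]
            by (auto simp: disjnt_def)
        qed
        show "a \<le> fst i \<and> fst i < snd i \<and> snd i \<le> b" if "i \<in> I" for i
          using IK[OF that] by auto
      qed
    qed (use \<open>s > 0\<close> in auto)
    finally show ?thesis .
  qed
  have V: "?V \<in> lmeasurable" "measure lebesgue ?V \<le> (f b - f a) / s"
    using fmeasurable_UN_bound[OF C(1), of "\<lambda>i. {fst i..snd i}" lebesgue, OF _ fin]
      measure_UN_bound[OF C(1), of "\<lambda>i. {fst i..snd i}" lebesgue, OF _ fin] by auto
  show thesis
  proof (rule that[of "?V \<union> (S - ?V)"])
    show "?V \<union> (S - ?V) \<in> lmeasurable"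
      by (rule lmeasurable_Un_negligible(1)[OF V(1) C(4)])
    show "measure lebesgue (?V \<union> (S - ?V)) \<le> (f b - f a) / s"
      using lmeasurable_Un_negligible(2)[OF V(1) C(4)] V(2) by (rule order_trans)
  qed auto
qed

lemma lmeasurable_outer_open:
  fixes S :: "'a::euclidean_space set"
  assumes S: "S \<in> lmeasurable" and "e > 0"
  obtains T where "open T" "S \<subseteq> T" "T \<in> lmeasurable" "measure lebesgue T < measure lebesgue S + e"
proof -
  obtain T where T: "open T" "S \<subseteq> T" "T - S \<in> lmeasurable" "emeasure lebesgue (T - S) < ennreal e"
    using sets_lebesgue_outer_open[of S e] assms by auto
  have m: "measure lebesgue (T - S) < e"
    using T(3,4) \<open>e > 0\<close> by (simp add: emeasure_eq_measure2 ennreal_less_iff)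
  have eq: "T = S \<union> (T - S)" using T(2) by auto
  show thesis
  proof (rule that[OF T(1,2)])
    show "T \<in> lmeasurable" by (subst eq) (rule fmeasurable.Un[OF S T(3)])
    have "measure lebesgue (S \<union> (T - S)) \<le> measure lebesgue S + measure lebesgue (T - S)"
      by (rule measure_Un_le) (use S T(3) in auto)
    then show "measure lebesgue T < measure lebesgue S + e" using m eq by simp
  qed
qed

text \<open>If every small scale around each point of \<open>S\<close> shows an interval of which
  \<open>S\<close> occupies at most the fraction \<rho>, then the outer measure m of
  \<open>S\<close> satisfies m \<le> \<rho> (m + e) for every e > 0, which forces m = 0.\<close>

lemma negligible_of_small_relative_cover:
  fixes S :: "real set"
  assumes "bounded S" and \<rho>: "0 \<le> \<rho>" "\<rho> < 1"
    and cov: "\<And>x d. x \<in> S \<Longrightarrow> 0 < d \<Longrightarrow> \<exists>u w. u < w \<and> u \<le> x \<and> x \<le> w \<and> w - u < d \<and>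
        (\<exists>U. S \<inter> {u..w} \<subseteq> U \<and> U \<in> lmeasurable \<and> measure lebesgue U \<le> \<rho> * (w - u))"
  shows "negligible S"
proof -
  define Ms where "Ms = {measure lebesgue W | W. W \<in> lmeasurable \<and> S \<subseteq> W}"
  define m where "m = Inf Ms"
  have bdd: "bdd_below Ms" unfolding Ms_def by (rule bdd_belowI[of _ 0]) auto
  obtain x B where "S \<subseteq> cball x B" using \<open>bounded S\<close> unfolding bounded_subset_cball by auto
  then have "measure lebesgue (cball x B) \<in> Ms"
    unfolding Ms_def using lmeasurable_cball[of x B]
    by (intro CollectI exI[of _ "cball x B"]) auto
  then have ne: "Ms \<noteq> {}" by auto
  have step: "m \<le> \<rho> * (m + e)" if "e > 0" for e
  proof -
    have "Inf Ms < m + e / 2" using that by (simp add: m_def)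
    have e2: "e / 2 > 0" using that by simp
    from cInf_lessD[OF ne \<open>Inf Ms < m + e / 2\<close>]
    obtain W where W: "W \<in> lmeasurable" "S \<subseteq> W" "measure lebesgue W < m + e / 2"
      unfolding Ms_def by auto
    obtain W' where W': "open W'" "W \<subseteq> W'" "W' \<in> lmeasurable" "measure lebesgue W' < measure lebesgue W + e / 2"
      using lmeasurable_outer_open[OF W(1) e2] by metis
    \<comment> \<open>Requiring the intervals to lie in the open set \<open>W'\<close> bounds the
      total length of a disjoint selection by the measure of \<open>W'\<close>, which exceeds m by
      less than e.\<close>
    define K where "K = {(u, w). u < w \<and> {u..w} \<subseteq> W' \<and>
        (\<exists>U. S \<inter> {u..w} \<subseteq> U \<and> U \<in> lmeasurable \<and> measure lebesgue U \<le> \<rho> * (w - u))}"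
    have "\<exists>u w. (u, w) \<in> K \<and> u \<le> x \<and> x \<le> w \<and> w - u < d" if xd: "x \<in> S" "0 < d" for x d
    proof -
      obtain r where r: "r > 0" "ball x r \<subseteq> W'"
        using W' W(2) xd(1) open_contains_ball[of W'] by (meson subsetD)
      obtain u w where uw: "u < w" "u \<le> x" "x \<le> w" "w - u < min d r"
        "\<exists>U. S \<inter> {u..w} \<subseteq> U \<and> U \<in> lmeasurable \<and> measure lebesgue U \<le> \<rho> * (w - u)"
        using cov[OF xd(1), of "min d r"] xd r by auto
      have "{u..w} \<subseteq> ball x r" using uw by (auto simp: dist_real_def)
      then show ?thesis using uw r unfolding K_def by (intro exI[of _ u] exI[of _ w]) auto
    qed
    then obtain C where C: "countable C" "C \<subseteq> K"
      "pairwise (\<lambda>i j. disjnt {fst i..snd i} {fst j..snd j}) C"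
      "negligible (S - (\<Union>i\<in>C. {fst i..snd i}))"
      by (rule Vitali_intervals[of K S, rotated]) (auto simp: K_def)
    have "\<exists>U. S \<inter> {fst i..snd i} \<subseteq> U \<and> U \<in> lmeasurable \<and> measure lebesgue U \<le> \<rho> * (snd i - fst i)"
      if "i \<in> C" for i
    proof -
      have "(fst i, snd i) \<in> K" using C(2) that by auto
      then show ?thesis unfolding K_def by blast
    qed
    then obtain U where U: "\<And>i. i \<in> C \<Longrightarrow> S \<inter> {fst i..snd i} \<subseteq> U i"
      "\<And>i. i \<in> C \<Longrightarrow> U i \<in> lmeasurable"
      "\<And>i. i \<in> C \<Longrightarrow> measure lebesgue (U i) \<le> \<rho> * (snd i - fst i)"
      by metis
    have fin: "measure lebesgue (\<Union>i\<in>I. U i) \<le> \<rho> * measure lebesgue W'" if I: "I \<subseteq> C" "finite I" for I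
    proof -
      have "measure lebesgue (\<Union>i\<in>I. U i) \<le> (\<Sum>i\<in>I. measure lebesgue (U i))"
        using I U(2) by (intro measure_UNION_le) auto
      also have "\<dots> \<le> (\<Sum>i\<in>I. \<rho> * (snd i - fst i))"
        using I U(3) by (intro sum_mono) auto
      also have "\<dots> = \<rho> * (\<Sum>i\<in>I. snd i - fst i)" by (simp add: sum_distrib_left)
      also have "(\<Sum>i\<in>I. snd i - fst i) = (\<Sum>i\<in>I. measure lebesgue {fst i..snd i})"
        using I C(2) by (intro sum.cong) (auto simp: K_def intro: less_imp_le)
      also have "\<dots> = measure lebesgue (\<Union>i\<in>I. {fst i..snd i})"
        by (rule measure_UNION'[symmetric, OF I(2)]) (use pairwise_subset[OF C(3) I(1)] in auto)
      also have "\<dots> \<le> measure lebesgue W'"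
      proof (rule measure_mono_fmeasurable[OF _ _ W'(3)])
        have "{fst i..snd i} \<subseteq> W'" if "i \<in> I" for i
        proof -
          have "(fst i, snd i) \<in> K" using C(2) I(1) that by auto
          then show ?thesis unfolding K_def by blast
        qed
        then show "(\<Union>i\<in>I. {fst i..snd i}) \<subseteq> W'" by (rule UN_least)
      qed (use I in auto)
      finally show ?thesis using \<rho>(1) by (simp add: mult_left_mono)
    qed
    let ?V = "\<Union>i\<in>C. U i" and ?N = "S - (\<Union>i\<in>C. {fst i..snd i})"
    have V: "?V \<in> lmeasurable" "measure lebesgue ?V \<le> \<rho> * measure lebesgue W'"
      using fmeasurable_UN_bound[OF C(1), of U lebesgue, OF U(2) fin]
        measure_UN_bound[OF C(1), of U lebesgue, OF U(2) fin] by auto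
    have "measure lebesgue (?V \<union> ?N) \<le> \<rho> * measure lebesgue W'"
      using lmeasurable_Un_negligible(2)[OF V(1) C(4)] V(2) by (rule order_trans)
    moreover have "S \<subseteq> ?V \<union> ?N" using U(1) by blast
    moreover have "?V \<union> ?N \<in> lmeasurable"
      by (rule lmeasurable_Un_negligible(1)[OF V(1) C(4)])
    ultimately have "m \<le> \<rho> * measure lebesgue W'"
      unfolding m_def Ms_def using bdd[unfolded Ms_def]
      by (intro order_trans[OF cInf_lower[of "measure lebesgue (?V \<union> ?N)"]]) auto
    also have "\<dots> \<le> \<rho> * (m + e)"
      using W W' \<rho>(1) by (intro mult_left_mono) auto
    finally show ?thesis .
  qed
  have "m \<le> 0"
  proof (rule ccontr)
    assume "\<not> m \<le> 0"
    then have "m > 0" by simp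
    \<comment> \<open>The tolerance is a fraction of m itself, so one instance of the inequality
      already contradicts m > 0.\<close>
    have "m \<le> \<rho> * (m + m * (1 - \<rho>))" using step[of "m * (1 - \<rho>)"] \<open>m > 0\<close> \<rho> by simp
    also have "\<dots> = m * (1 - (1 - \<rho>)^2)" by (simp add: algebra_simps power2_eq_square)
    finally have "m * (1 - \<rho>)^2 \<le> 0" by (simp add: algebra_simps)
    moreover have "m * (1 - \<rho>)^2 > 0" using \<open>m > 0\<close> \<rho> by simp
    ultimately show False by linarith
  qed
  show ?thesis unfolding negligible_outer
  proof (intro allI impI)
    fix e :: real assume "e > 0"
    then have "Inf Ms < e" using \<open>m \<le> 0\<close> by (simp add: m_def)
    then show "\<exists>T. S \<subseteq> T \<and> T \<in> lmeasurable \<and> measure lebesgue T < e"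
      using cInf_lessD[OF ne] unfolding Ms_def by auto
  qed
qed


lemma frequently_at_real:
  fixes x :: real
  shows "(\<exists>\<^sub>F y in at x. P y) \<longleftrightarrow> (\<forall>d>0. \<exists>y. y \<noteq> x \<and> \<bar>y - x\<bar> < d \<and> P y)"
  unfolding frequently_at by (auto simp: dist_real_def)

text \<open>At an exceptional point either the upper derivate is infinite (\<open>I n\<close>) or
  two positive rationals r < s separate the lower from the upper derivate (\<open>E r s n\<close>).
  A cover of \<open>I n\<close> by arbitrarily steep intervals is arbitrarily small. An interval of
  mean slope below r can contain points with upper derivate above s only in a portion of at most r /
  s of its length, and such intervals exist at every scale around points of
  \<open>E r s n\<close>.\<close>

theorem mono_differentiable_ae:
  fixes f :: "real \<Rightarrow> real"
  assumes f: "mono f"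
  shows "negligible {x. \<not> f differentiable (at x)}"
proof -
  define Q where "Q x y = (f y - f x) / (y - x)" for x y
  define E where "E r s n = {x \<in> {- real n<..<real n}. (\<exists>\<^sub>F y in at x. Q x y < r) \<and> (\<exists>\<^sub>F y in at x. s < Q x y)}"
    for r s n
  define I where "I n = {x \<in> {- real n<..<real n}. \<forall>s. \<exists>\<^sub>F y in at x. s < Q x y}" for n
  have Q0: "0 \<le> Q x y" for x y
    unfolding Q_def using monoD[OF f, of x y] monoD[OF f, of y x]
    by (cases x y rule: linorder_cases) (auto simp: divide_nonpos_neg)
  have upper: "\<exists>y. y \<noteq> x \<and> \<bar>y - x\<bar> < d \<and> (f y - f x) / (y - x) > s"
    if "\<exists>\<^sub>F y in at x. s < Q x y" "0 < d" for x d s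
    using that unfolding frequently_at_real Q_def by blast
  have negE: "negligible (E r s n)" if rs: "0 < r" "r < s" for r s n
  proof (rule negligible_of_small_relative_cover[of _ "r / s"])
    show "bounded (E r s n)" by (rule bounded_subset[of "{- real n<..<real n}"]) (auto simp: E_def)
    fix x d :: real assume x: "x \<in> E r s n" and d: "0 < d"
    have xn: "- real n < x" "x < real n" using x by (auto simp: E_def)
    obtain y where y: "y \<noteq> x" "\<bar>y - x\<bar> < d" "Q x y < r"
      using x d unfolding E_def frequently_at_real by blast
    define u w where "u = min x y" and "w = max x y"
    have uw: "u < w" "u \<le> x" "x \<le> w" "w - u < d" "f w - f u < r * (w - u)"
      using y by (auto simp: u_def w_def min_def max_def Q_def field_simps split: if_splits)
    obtain U where U: "E r s n \<inter> {u<..<w} \<subseteq> U" "U \<in> lmeasurable" "measure lebesgue U \<le> (f w - f u) / s"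
    proof (rule upper_derivate_cover[OF f, of s u w "E r s n \<inter> {u<..<w}"])
      fix x' d' :: real assume "x' \<in> E r s n \<inter> {u<..<w}" "0 < d'"
      then show "\<exists>y. y \<noteq> x' \<and> \<bar>y - x'\<bar> < d' \<and> (f y - f x') / (y - x') > s"
        by (intro upper) (auto simp: E_def)
    qed (use rs uw in auto)
    \<comment> \<open>The cover was obtained for points of the open interval; adding the two end
      points does not change its measure.\<close>
    have neg: "negligible {u, w}" by simp
    have "E r s n \<inter> {u..w} \<subseteq> U \<union> {u, w}" using U(1) by force
    moreover have "measure lebesgue (U \<union> {u, w}) \<le> r / s * (w - u)"
    proof -
      have "measure lebesgue (U \<union> {u, w}) \<le> (f w - f u) / s"
        using lmeasurable_Un_negligible(2)[OF U(2) neg] U(3) by (rule order_trans)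
      also have "\<dots> \<le> (r * (w - u)) / s" using uw(5) rs by (intro divide_right_mono) auto
      finally show ?thesis by simp
    qed
    ultimately have "\<exists>U. E r s n \<inter> {u..w} \<subseteq> U \<and> U \<in> lmeasurable \<and> measure lebesgue U \<le> r / s * (w - u)"
      using lmeasurable_Un_negligible(1)[OF U(2) neg] by blast
    with uw show "\<exists>u w. u < w \<and> u \<le> x \<and> x \<le> w \<and> w - u < d \<and>
        (\<exists>U. E r s n \<inter> {u..w} \<subseteq> U \<and> U \<in> lmeasurable \<and> measure lebesgue U \<le> r / s * (w - u))"
      by blast
  qed (use rs in auto)
  have negI: "negligible (I n)" for n
    unfolding negligible_outer_le
  proof (intro allI impI)
    fix e :: real assume e: "e > 0"
    define A where "A = f (real n) - f (- real n)"
    have A0: "A \<ge> 0" using monoD[OF f, of "- real n" "real n"] by (simp add: A_def)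
    \<comment> \<open>The slope (A + 1) / e turns the bound on the cover into A e / (A + 1), which
      is at most e; the summand 1 keeps the slope positive when A = 0.\<close>
    obtain U where U: "I n \<subseteq> U" "U \<in> lmeasurable" "measure lebesgue U \<le> A / ((A + 1) / e)"
      unfolding A_def
    proof (rule upper_derivate_cover[OF f, of "(f (real n) - f (- real n) + 1) / e" "- real n" "real n" "I n"])
      fix x d :: real assume "x \<in> I n" "0 < d"
      then show "\<exists>y. y \<noteq> x \<and> \<bar>y - x\<bar> < d \<and> (f y - f x) / (y - x) > (f (real n) - f (- real n) + 1) / e"
        by (intro upper) (auto simp: I_def)
    qed (use A0 e in \<open>auto simp: A_def I_def\<close>)
    have "A / ((A + 1) / e) \<le> e" using A0 e by (simp add: field_simps)
    then show "\<exists>T. I n \<subseteq> T \<and> T \<in> lmeasurable \<and> measure lebesgue T \<le> e"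
      using U by (intro exI[of _ U]) auto
  qed
  have "{x. \<not> f differentiable (at x)} \<subseteq>
      (\<Union>n. I n) \<union> (\<Union>n. \<Union>(r, s) \<in> {(r, s). r \<in> \<rat> \<and> s \<in> \<rat> \<and> 0 < r \<and> r < s}. E r s n)"
  proof (intro subsetI, rule ccontr)
    fix x assume nd: "x \<in> {x. \<not> f differentiable (at x)}"
      and nin: "x \<notin> (\<Union>n. I n) \<union> (\<Union>n. \<Union>(r, s) \<in> {(r, s). r \<in> \<rat> \<and> s \<in> \<rat> \<and> 0 < r \<and> r < s}. E r s n)"
    obtain n where n: "\<bar>x\<bar> < real n" using reals_Archimedean2 by blast
    have notE: False if "\<exists>\<^sub>F y in at x. Q x y < r" "\<exists>\<^sub>F y in at x. s < Q x y" "0 < r" "r < s" "r \<in> \<rat>" "s \<in> \<rat>" for r s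
    proof -
      have "x \<in> E r s n" using that n by (auto simp: E_def)
      then show False using nin that by blast
    qed
    \<comment> \<open>\<open>A\<close> collects the eventual upper bounds of the difference
      quotient, so its infimum \<open>l\<close> is the upper derivate at \<open>x\<close>. Being
      outside \<open>I n\<close> makes \<open>A\<close> nonempty, hence \<open>l\<close>
      finite.\<close>
    define A where "A = {s. \<forall>\<^sub>F y in at x. Q x y \<le> s}"
    have "x \<notin> I n" using nin by blast
    then obtain s0 where "\<not> (\<exists>\<^sub>F y in at x. s0 < Q x y)" using n unfolding I_def by auto
    then have "s0 \<in> A" unfolding A_def frequently_def by (simp add: not_less)
    then have ne: "A \<noteq> {}" by auto
    have A0: "0 \<le> s" if s: "s \<in> A" for s
    proof -
      obtain y where "Q x y \<le> s"
        using eventually_happens[of "\<lambda>y. Q x y \<le> s" "at x"] s unfolding A_def by auto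
      then show ?thesis using Q0[of x y] by simp
    qed
    then have bdd: "bdd_below A" by (rule bdd_belowI)
    define l where "l = Inf A"
    have "l \<ge> 0" unfolding l_def by (rule cInf_greatest[OF ne A0])
    have "(Q x \<longlongrightarrow> l) (at x)"
    proof (rule order_tendstoI)
      fix a assume a: "l < a"
      then obtain s where "s \<in> A" "s < a" using cInf_lessD[OF ne] unfolding l_def by blast
      then show "\<forall>\<^sub>F y in at x. Q x y < a"
        unfolding A_def by (auto elim!: eventually_mono)
    next
      fix a assume a: "a < l"
      show "\<forall>\<^sub>F y in at x. a < Q x y"
      proof (cases "a < 0")
        case True
        then show ?thesis using Q0 by (intro always_eventually allI) (rule less_le_trans)
      next
        case False
        \<comment> \<open>A rational s below \<open>l\<close> is not an eventual upper bound, so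
          absence from \<open>E r s n\<close> forces the quotients to stay at or above r > a. Thus
          the lower derivate also reaches \<open>l\<close>.\<close>
        obtain r where r: "a < r" "r < l" "r \<in> \<rat>" using Rats_dense_in_real[OF a] by blast
        obtain s where s: "r < s" "s < l" "s \<in> \<rat>" using Rats_dense_in_real[OF r(2)] by blast
        have "s \<notin> A" using cInf_lower[OF _ bdd, of s] s(2) unfolding l_def by auto
        then have "\<exists>\<^sub>F y in at x. s < Q x y" unfolding A_def frequently_def by (simp add: not_less)
        then have "\<not> (\<exists>\<^sub>F y in at x. Q x y < r)" using notE[of r s] r s False by auto
        then show ?thesis unfolding frequently_def using r(1)
          by (auto simp: not_less elim!: eventually_mono)
      qed
    qed
    then have "(f has_real_derivative l) (at x)"
      unfolding has_field_derivative_iff Q_def .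
    then show False using nd unfolding differentiable_def has_field_derivative_def by blast
  qed
  moreover have "negligible ((\<Union>n. I n) \<union> (\<Union>n. \<Union>(r, s) \<in> {(r, s). r \<in> \<rat> \<and> s \<in> \<rat> \<and> 0 < r \<and> r < s}. E r s n))"
  proof (rule negligible_Un)
    have c: "countable {(r::real, s). r \<in> \<rat> \<and> s \<in> \<rat> \<and> 0 < r \<and> r < s}"
      by (rule countable_subset[of _ "\<rat> \<times> \<rat>"]) (auto simp: countable_rat)
    show "negligible (\<Union>n. I n)" using negI by (intro negligible_countable_Union) auto
    have "negligible (\<Union>(r, s) \<in> {(r, s). r \<in> \<rat> \<and> s \<in> \<rat> \<and> 0 < r \<and> r < s}. E r s n)" for n
      using c negE by (intro negligible_countable_Union) auto
    then show "negligible (\<Union>n. \<Union>(r, s) \<in> {(r, s). r \<in> \<rat> \<and> s \<in> \<rat> \<and> 0 < r \<and> r < s}. E r s n)"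
      by (intro negligible_countable_Union) auto
  qed
  ultimately show ?thesis by (rule negligible_subset[rotated])
qed


section \<open>Bounded variation and the fundamental theorem of calculus for absolutely continuous
  curves\<close>

text \<open>Degenerate intervals are allowed, so that monotone maps which collapse intervals, such
  as clamping at a point, send families to families of the same size.\<close>

definition interval_family :: "real \<Rightarrow> real \<Rightarrow> nat \<Rightarrow> (nat \<Rightarrow> real) \<Rightarrow> (nat \<Rightarrow> real) \<Rightarrow> bool" where
  "interval_family a b n u w \<longleftrightarrow> (\<forall>i<n. a \<le> u i \<and> u i \<le> w i \<and> w i \<le> b) \<and>
      (\<forall>i<n. \<forall>j<n. i \<noteq> j \<longrightarrow> w i \<le> u j \<or> w j \<le> u i)"

lemma abs_cont_on_alt:
  "abs_cont_on \<gamma> a b \<longleftrightarrow> (\<forall>\<epsilon>>0. \<exists>\<delta>>0. \<forall>n u w. interval_family a b n u w \<and> (\<Sum>i<n. w i - u i) < \<delta>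
      \<longrightarrow> (\<Sum>i<n. norm (\<gamma> (w i) - \<gamma> (u i))) < \<epsilon>)"
  unfolding abs_cont_on_def interval_family_def by (simp only: conj_assoc)

lemma interval_family_map:
  assumes "interval_family a b n u w" "mono g" "\<And>t. t \<in> {a..b} \<Longrightarrow> g t \<in> {a'..b'}"
  shows "interval_family a' b' n (\<lambda>i. g (u i)) (\<lambda>i. g (w i))"
proof -
  have *: "u i \<le> w i" "u i \<in> {a..b}" "w i \<in> {a..b}" if "i < n" for i
    using assms(1) that by (auto simp: interval_family_def intro: order_trans)
  have "g (u i) \<le> g (w i)" "g (u i) \<in> {a'..b'}" "g (w i) \<in> {a'..b'}" if "i < n" for i
    using *[OF that] assms(3) monoD[OF assms(2)] by auto
  moreover have "g (w i) \<le> g (u j) \<or> g (w j) \<le> g (u i)" if "i < n" "j < n" "i \<noteq> j" for i j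
    using assms(1) that monoD[OF assms(2)] unfolding interval_family_def by meson
  ultimately show ?thesis unfolding interval_family_def by auto
qed

lemma interval_family_length_le:
  assumes "interval_family a b n u w" "a \<le> b"
  shows "(\<Sum>i<n. w i - u i) \<le> b - a"
proof -
  have "(\<Sum>i<n. w i - u i) = (\<Sum>i\<in>{i. i < n \<and> u i < w i}. w i - u i)"
    using assms(1) by (intro sum.mono_neutral_right) (auto simp: interval_family_def antisym_conv2)
  also have "\<dots> \<le> b - a"
    using assms by (intro mono_sum_increments_le[of "\<lambda>x. x", simplified]) (auto simp: interval_family_def monoI)
  finally show ?thesis .
qed

lemma abs_cont_on_subset:
  assumes "abs_cont_on \<gamma> a b" "a \<le> a'" "b' \<le> b"
  shows "abs_cont_on \<gamma> a' b'"
proof -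
  have "interval_family a b n u w" if "interval_family a' b' n u w" for n u w
    using that assms(2,3) unfolding interval_family_def by (meson order_trans)
  then show ?thesis using assms(1) unfolding abs_cont_on_alt by meson
qed

lemma lipschitz_imp_abs_cont_on:
  assumes "C-lipschitz_on {a..b} \<gamma>"
  shows "abs_cont_on \<gamma> a b"
  unfolding abs_cont_on_alt
proof (intro allI impI)
  fix \<epsilon> :: real assume \<epsilon>: "\<epsilon> > 0"
  have C: "C \<ge> 0" by (rule lipschitz_on_nonneg[OF assms])
  show "\<exists>\<delta>>0. \<forall>n u w. interval_family a b n u w \<and> (\<Sum>i<n. w i - u i) < \<delta>
      \<longrightarrow> (\<Sum>i<n. norm (\<gamma> (w i) - \<gamma> (u i))) < \<epsilon>"
  proof (intro exI[of _ "\<epsilon> / (C + 1)"] conjI allI impI; (elim conjE)?)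
    show "\<epsilon> / (C + 1) > 0" using \<epsilon> C by simp
    fix n :: nat and u w :: "nat \<Rightarrow> real"
    assume f: "interval_family a b n u w" and s: "(\<Sum>i<n. w i - u i) < \<epsilon> / (C + 1)"
    have nn: "0 \<le> (\<Sum>i<n. w i - u i)" using f by (intro sum_nonneg) (auto simp: interval_family_def)
    have "(\<Sum>i<n. norm (\<gamma> (w i) - \<gamma> (u i))) \<le> (\<Sum>i<n. C * (w i - u i))"
    proof (rule sum_mono)
      fix i assume "i \<in> {..<n}"
      then have "u i \<in> {a..b}" "w i \<in> {a..b}" "u i \<le> w i"
        using f by (auto simp: interval_family_def intro: order_trans)
      then show "norm (\<gamma> (w i) - \<gamma> (u i)) \<le> C * (w i - u i)"
        using lipschitz_onD[OF assms, of "w i" "u i"] by (simp add: dist_norm)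
    qed
    also have "\<dots> \<le> (C + 1) * (\<Sum>i<n. w i - u i)" using nn by (simp add: sum_distrib_left[symmetric] distrib_right)
    also have "\<dots> < \<epsilon>" using s C by (simp add: field_simps)
    finally show "(\<Sum>i<n. norm (\<gamma> (w i) - \<gamma> (u i))) < \<epsilon>" .
  qed
qed

text \<open>With \<delta> the modulus for tolerance 1, each stretch of length at most \<delta> / 2
  contributes at most 1 to the variation, and \<open>k\<close> stretches cover the interval. A
  family is cut at \<open>y\<close> by clamping its end points from above and from below.\<close>

lemma abs_cont_on_bounded_variation:
  assumes ac: "abs_cont_on f a b"
  obtains B where "\<And>n u w. interval_family a b n u w \<Longrightarrow> (\<Sum>i<n. norm (f (w i) - f (u i))) \<le> B"
proof -
  obtain \<delta> where \<delta>: "\<delta> > 0" "\<And>n u w. interval_family a b n u w \<Longrightarrow> (\<Sum>i<n. w i - u i) < \<delta>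
      \<Longrightarrow> (\<Sum>i<n. norm (f (w i) - f (u i))) < 1"
    using ac unfolding abs_cont_on_alt by (meson zero_less_one)
  have *: "(\<Sum>i<n. norm (f (w i) - f (u i))) \<le> real k"
    if "a \<le> x" "x \<le> b" "x - a \<le> real k * (\<delta> / 2)" "interval_family a x n u w" for k x n u w
    using that
  proof (induction k arbitrary: x n u w)
    case 0
    then have "u i = w i" if "i < n" for i using that by (force simp: interval_family_def)
    then show ?case by simp
  next
    case (Suc k)
    define y where "y = max a (x - \<delta> / 2)"
    have y: "a \<le> y" "y \<le> x" "x - y < \<delta>"
      using Suc.prems \<delta>(1) by (auto simp: y_def)
    have "0 \<le> real k * (\<delta> / 2)" using \<delta>(1) by simp
    moreover have "x - \<delta> / 2 - a \<le> real k * (\<delta> / 2)" using Suc.prems(3) by (simp add: algebra_simps)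
    ultimately have y': "y - a \<le> real k * (\<delta> / 2)"
      by (auto simp: y_def max_def)
    have f1: "interval_family a y n (\<lambda>i. min (u i) y) (\<lambda>i. min (w i) y)"
      by (rule interval_family_map[OF Suc.prems(4), of "\<lambda>t. min t y" a y]) (use y in \<open>auto simp: mono_def\<close>)
    have f2: "interval_family y x n (\<lambda>i. max (u i) y) (\<lambda>i. max (w i) y)"
      by (rule interval_family_map[OF Suc.prems(4), of "\<lambda>t. max t y" y x]) (use y in \<open>auto simp: mono_def\<close>)
    have f2': "interval_family a b n (\<lambda>i. max (u i) y) (\<lambda>i. max (w i) y)"
      by (rule interval_family_map[OF f2, of "\<lambda>t. t" a b]) (use y(1) Suc.prems(2) in \<open>auto simp: mono_def\<close>)
    have "(\<Sum>i<n. norm (f (w i) - f (u i))) \<le>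
        (\<Sum>i<n. norm (f (min (w i) y) - f (min (u i) y)) + norm (f (max (w i) y) - f (max (u i) y)))"
    proof (rule sum_mono)
      fix i assume "i \<in> {..<n}"
      then have le: "u i \<le> w i" using Suc.prems(4) by (auto simp: interval_family_def)
      have "norm (f (w i) - f (u i)) \<le> norm (f (w i) - f y) + norm (f y - f (u i))"
        using norm_triangle_ineq[of "f (w i) - f y" "f y - f (u i)"] by simp
      with le show "norm (f (w i) - f (u i)) \<le>
        norm (f (min (w i) y) - f (min (u i) y)) + norm (f (max (w i) y) - f (max (u i) y))"
        by (auto simp: min_def max_def)
    qed
    also have "\<dots> = (\<Sum>i<n. norm (f (min (w i) y) - f (min (u i) y))) + (\<Sum>i<n. norm (f (max (w i) y) - f (max (u i) y)))"
      by (rule sum.distrib)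
    also have "\<dots> \<le> real k + 1"
    proof (rule add_mono)
      show "(\<Sum>i<n. norm (f (min (w i) y) - f (min (u i) y))) \<le> real k"
        by (rule Suc.IH[OF y(1) _ y' f1]) (use y Suc.prems in auto)
      show "(\<Sum>i<n. norm (f (max (w i) y) - f (max (u i) y))) \<le> 1"
        using \<delta>(2)[OF f2'] interval_family_length_le[OF f2 y(2)] y(3) by simp
    qed
    finally show ?case by simp
  qed
  obtain k where k: "(b - a) / (\<delta> / 2) < real k" using reals_Archimedean2 by blast
  show thesis
  proof (rule that[of "real k"])
    fix n and u w :: "nat \<Rightarrow> real" assume f: "interval_family a b n u w"
    show "(\<Sum>i<n. norm (f (w i) - f (u i))) \<le> real k"
    proof (cases "a \<le> b")
      case True
      then show ?thesis using k \<delta>(1) by (intro *[OF _ _ _ f]) (auto simp: field_simps)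
    next
      case False
      then have "n = 0" using f unfolding interval_family_def by (metis gr0I order_trans)
      then show ?thesis by simp
    qed
  qed
qed

text \<open>Jordan decomposition: with V the variation up to a point, f is the difference of the
  nondecreasing functions V and V - f.\<close>

lemma abs_cont_on_differentiable_ae_real:
  fixes f :: "real \<Rightarrow> real"
  assumes ac: "abs_cont_on f a b"
  shows "negligible {x \<in> {a..b}. \<not> f differentiable (at x)}"
proof (cases "a < b")
  case False
  have "{x \<in> {a..b}. \<not> f differentiable (at x)} \<subseteq> {a}" using False by auto
  then show ?thesis by (rule negligible_subset[rotated]) simp
next
  case ab: True
  obtain B where B: "\<And>n u w. interval_family a b n u w \<Longrightarrow> (\<Sum>i<n. norm (f (w i) - f (u i))) \<le> B"
    using abs_cont_on_bounded_variation[OF ac] by blast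
  define Vs where "Vs x = {(\<Sum>i<n. norm (f (w i) - f (u i))) | n u w. interval_family a x n u w}" for x
  define V where "V x = Sup (Vs x)" for x
  have bdd: "bdd_above (Vs x)" if "x \<le> b" for x
  proof (rule bdd_aboveI[of _ B])
    fix t assume "t \<in> Vs x"
    then obtain n u w where "interval_family a x n u w" "t = (\<Sum>i<n. norm (f (w i) - f (u i)))"
      unfolding Vs_def by blast
    then show "t \<le> B" using that by (intro ord_eq_le_trans[OF _ B]) (auto simp: interval_family_def intro: order_trans)
  qed
  have ne: "Vs x \<noteq> {}" for x
    unfolding Vs_def by (auto simp: interval_family_def intro!: exI[of _ "0::nat"])
  \<comment> \<open>Appending the interval from \<open>x\<close> to \<open>y\<close> to a family
    that ends by \<open>x\<close> adds the size of the increment to its variation. This single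
    inequality yields monotonicity of both V and V - f.\<close>
  have key: "V x + \<bar>f y - f x\<bar> \<le> V y" if xy: "a \<le> x" "x \<le> y" "y \<le> b" for x y
  proof -
    have "V x \<le> V y - \<bar>f y - f x\<bar>"
      unfolding V_def[of x]
    proof (rule cSup_least[OF ne])
      fix t assume "t \<in> Vs x"
      then obtain n u w where f: "interval_family a x n u w" "t = (\<Sum>i<n. norm (f (w i) - f (u i)))"
        unfolding Vs_def by blast
      have fam: "interval_family a y (Suc n) (u(n := x)) (w(n := y))"
        using f(1) xy unfolding interval_family_def by (auto simp: less_Suc_eq intro: order_trans)
      have eq: "(\<Sum>i<Suc n. norm (f ((w(n := y)) i) - f ((u(n := x)) i))) = t + \<bar>f y - f x\<bar>"
        by (simp add: f(2))
      have "t + \<bar>f y - f x\<bar> \<in> Vs y"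
        unfolding Vs_def using fam eq[symmetric] by blast
      then have "t + \<bar>f y - f x\<bar> \<le> V y" unfolding V_def by (rule cSup_upper[OF _ bdd[OF xy(3)]])
      then show "t \<le> V y - \<bar>f y - f x\<bar>" by simp
    qed
    then show ?thesis by simp
  qed
  \<comment> \<open>Lebesgue's theorem was proved for functions monotone on the whole line; clamping
    the argument extends V and V - f to such functions without changing them on the
    interval.\<close>
  define cl where "cl x = max a (min b x)" for x
  have cl: "a \<le> cl x" "cl x \<le> b" "x \<le> y \<Longrightarrow> cl x \<le> cl y" for x y
    using ab by (auto simp: cl_def)
  have keycl: "V (cl x) + \<bar>f (cl y) - f (cl x)\<bar> \<le> V (cl y)" if "x \<le> y" for x y
    using key cl that by blast
  have "mono (\<lambda>x. V (cl x))" by (intro monoI) (use keycl in fastforce)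
  moreover have "mono (\<lambda>x. V (cl x) - f (cl x))"
    by (intro monoI) (use keycl in \<open>fastforce simp: abs_le_iff\<close>)
  ultimately have neg: "negligible ({x. \<not> (\<lambda>x. V (cl x)) differentiable (at x)} \<union>
      {x. \<not> (\<lambda>x. V (cl x) - f (cl x)) differentiable (at x)} \<union> {a, b})"
    by (intro negligible_Un mono_differentiable_ae) auto
  show ?thesis
  proof (rule negligible_subset[OF neg], rule subsetI, rule ccontr)
    fix x assume x: "x \<in> {x \<in> {a..b}. \<not> f differentiable (at x)}" and
      "x \<notin> {x. \<not> (\<lambda>x. V (cl x)) differentiable (at x)} \<union>
        {x. \<not> (\<lambda>x. V (cl x) - f (cl x)) differentiable (at x)} \<union> {a, b}"
    then have d: "(\<lambda>x. V (cl x)) differentiable (at x)" "(\<lambda>x. V (cl x) - f (cl x)) differentiable (at x)"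
      and ne: "x \<in> {a<..<b}" by auto
    have "(\<lambda>x. V (cl x) - (V (cl x) - f (cl x))) differentiable (at x)"
      by (rule differentiable_diff[OF d])
    then obtain D where D: "((\<lambda>x. f (cl x)) has_derivative D) (at x)"
      unfolding differentiable_def by auto
    have "(f has_derivative D) (at x)"
      by (rule has_derivative_transform_within_open[OF D open_greaterThanLessThan ne]) (auto simp: cl_def)
    then show False using x unfolding differentiable_def by blast
  qed
qed

lemma abs_cont_on_differentiable_ae:
  fixes f :: "real \<Rightarrow> 'a::euclidean_space"
  assumes ac: "abs_cont_on f a b"
  shows "negligible {x \<in> {a..b}. \<not> f differentiable (at x)}"
proof -
  have "abs_cont_on (\<lambda>x. f x \<bullet> i) a b" if "i \<in> Basis" for i
    unfolding abs_cont_on_alt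
  proof (intro allI impI)
    fix \<epsilon> :: real assume "\<epsilon> > 0"
    then obtain \<delta> where \<delta>: "\<delta> > 0" "\<And>n u w. interval_family a b n u w \<Longrightarrow> (\<Sum>i<n. w i - u i) < \<delta>
      \<Longrightarrow> (\<Sum>i<n. norm (f (w i) - f (u i))) < \<epsilon>"
      using ac unfolding abs_cont_on_alt by meson
    have "(\<Sum>j<n. norm (f (w j) \<bullet> i - f (u j) \<bullet> i)) \<le> (\<Sum>j<n. norm (f (w j) - f (u j)))" for n u w
      using that by (intro sum_mono) (auto simp: inner_diff_left[symmetric] Basis_le_norm)
    then show "\<exists>\<delta>>0. \<forall>n u w. interval_family a b n u w \<and> (\<Sum>i<n. w i - u i) < \<delta>
      \<longrightarrow> (\<Sum>j<n. norm (f (w j) \<bullet> i - f (u j) \<bullet> i)) < \<epsilon>"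
      using \<delta> by (intro exI[of _ \<delta>] conjI allI impI) (blast intro: order_le_less_trans)+
  qed
  then have "negligible (\<Union>i\<in>Basis. {x \<in> {a..b}. \<not> (\<lambda>x. f x \<bullet> i) differentiable (at x)})"
    using abs_cont_on_differentiable_ae_real by (intro negligible_Union finite_imageI) (auto simp del: atLeastAtMost_iff)
  moreover have "{x \<in> {a..b}. \<not> f differentiable (at x)} \<subseteq>
      (\<Union>i\<in>Basis. {x \<in> {a..b}. \<not> (\<lambda>x. f x \<bullet> i) differentiable (at x)})"
    by (subst differentiable_componentwise_within) auto
  ultimately show ?thesis by (rule negligible_subset)
qed


text \<open>The gauge integral allows a direct proof in which integrability of the derivative is
  part of the conclusion. At points of differentiability the gauge makes increments nearly linear.
  At points of the null set \<open>N\<close> it forces intervals into an open set \<open>U\<close>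
  of measure below the modulus \<delta>, so the increments of \<open>f\<close> over them sum to
  little.\<close>

theorem abs_cont_on_has_integral_derivative:
  fixes f :: "real \<Rightarrow> 'a::euclidean_space"
  assumes ac: "abs_cont_on f a b" and ab: "a \<le> b"
  shows "((\<lambda>x. vector_derivative f (at x)) has_integral f b - f a) {a..b}"
proof -
  define N where "N = {x \<in> {a..b}. \<not> f differentiable (at x)}"
  have N: "negligible N" unfolding N_def by (rule abs_cont_on_differentiable_ae[OF ac])
  define g where "g x = (if x \<in> N then 0 else vector_derivative f (at x))" for x
  have "(g has_integral f b - f a) {a..b}"
    unfolding has_integral_factor_content_real
  proof (intro allI impI)
    fix e :: real assume e: "e > 0"
    show "\<exists>d. gauge d \<and> (\<forall>p. p tagged_division_of {a..b} \<and> d fine p \<longrightarrow>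
        norm ((\<Sum>(x, k)\<in>p. measure lborel k *\<^sub>R g x) - (f b - f a)) \<le> e * measure lborel {a..b})"
    proof (cases "a = b")
      case True
      show ?thesis
      proof (intro exI[of _ "\<lambda>x. ball x 1"] conjI allI impI)
        show "gauge (\<lambda>x::real. ball x 1)" by (rule gauge_ball) simp
        fix p assume p: "p tagged_division_of {a..b} \<and> (\<lambda>x. ball x 1) fine p"
        have "measure lborel k = 0" if "(x, k) \<in> p" for x k
        proof -
          have k: "k \<subseteq> {a}" "x \<in> k" using p that True by auto
          then have "k = cbox a a" by auto
          then show ?thesis by simp
        qed
        then have "(\<Sum>(x, k)\<in>p. measure lborel k *\<^sub>R g x) = 0" by (intro sum.neutral) auto
        then show "norm ((\<Sum>(x, k)\<in>p. measure lborel k *\<^sub>R g x) - (f b - f a)) \<le> e * measure lborel {a..b}"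
          using True by simp
      qed
    next
      case False
      then have ab': "a < b" using ab by simp
      obtain \<delta> where \<delta>: "\<delta> > 0" "\<And>n u w. interval_family a b n u w \<Longrightarrow> (\<Sum>i<n. w i - u i) < \<delta>
          \<Longrightarrow> (\<Sum>i<n. norm (f (w i) - f (u i))) < e / 2 * (b - a)"
      proof -
        have "e / 2 * (b - a) > 0" using ab' e by simp
        then show thesis using ac that unfolding abs_cont_on_alt by meson
      qed
      obtain U where U: "open U" "N \<subseteq> U" "U \<in> lmeasurable" "measure lebesgue U < \<delta>"
        using lmeasurable_outer_open[OF negligible_imp_measurable[OF N] \<delta>(1)] negligible_imp_measure0[OF N]
        by (metis add_0)
      have "\<exists>r>0. \<forall>y. \<bar>y - x\<bar> < r \<longrightarrow> norm (f y - f x - (y - x) *\<^sub>R g x) \<le> e / 2 * \<bar>y - x\<bar>"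
        if "x \<in> {a..b} - N" for x
      proof -
        have "f differentiable (at x)" using that by (auto simp: N_def)
        then have "(f has_vector_derivative g x) (at x)"
          using that by (simp add: g_def vector_derivative_works)
        then have "(f has_derivative (\<lambda>h. h *\<^sub>R g x)) (at x)" by (simp add: has_vector_derivative_def)
        then show ?thesis using e unfolding has_derivative_at_alt
          by (metis half_gt_zero real_norm_def)
      qed
      then obtain r where r: "\<And>x. x \<in> {a..b} - N \<Longrightarrow> r x > 0"
        "\<And>x y. x \<in> {a..b} - N \<Longrightarrow> \<bar>y - x\<bar> < r x \<Longrightarrow> norm (f y - f x - (y - x) *\<^sub>R g x) \<le> e / 2 * \<bar>y - x\<bar>"
        by metis
      define d where "d x = (if x \<in> N then U else if x \<in> {a..b} then ball x (r x) else ball x 1)" for x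
      have "gauge d"
        unfolding gauge_def d_def using U r(1) by auto
      moreover have "norm ((\<Sum>(x, k)\<in>p. measure lborel k *\<^sub>R g x) - (f b - f a)) \<le> e * measure lborel {a..b}"
        if p: "p tagged_division_of {a..b}" and fine: "d fine p" for p
      proof -
        have finp: "finite p" using p by auto
        have iv: "\<exists>u w. u \<le> x \<and> x \<le> w \<and> k = {u..w} \<and> a \<le> u \<and> w \<le> b" if "(x, k) \<in> p" for x k
        proof -
          obtain u w where k: "k = {u..w}" using p \<open>(x, k) \<in> p\<close> by (metis box_real(2) tagged_division_ofD(4))
          have "x \<in> k" "k \<subseteq> {a..b}" using p \<open>(x, k) \<in> p\<close> by auto
          then show ?thesis using k by auto
        qed
        define \<Delta> where "\<Delta> k = f (Sup k) - f (Inf k)" for k :: "real set"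
        \<comment> \<open>Degenerate intervals are left out: they have empty interior, so a tagged
          division may place them inside another interval, and then the family would not be
          non-overlapping. They contribute no increment.\<close>
        define bad where "bad = {t \<in> p. fst t \<in> N \<and> measure lborel (snd t) > 0}"
        have finb: "finite bad" unfolding bad_def using finp by auto
        have bnd: "norm (measure lborel k *\<^sub>R g x - \<Delta> k) \<le> e / 2 * measure lborel k + (if (x, k) \<in> bad then norm (\<Delta> k) else 0)"
          if xk: "(x, k) \<in> p" for x k
        proof -
          obtain u w where uw: "u \<le> x" "x \<le> w" "k = {u..w}" "a \<le> u" "w \<le> b" using iv[OF xk] by blast
          have SI: "Sup k = w" "Inf k = u" "measure lborel k = w - u" using uw by auto
          show ?thesis
          proof (cases "x \<in> N")
            case True
            then have g0: "g x = 0" by (simp add: g_def)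
            show ?thesis
            proof (cases "u = w")
              case True
              then show ?thesis using SI g0 by (simp add: \<Delta>_def)
            next
              case False
              then have "(x, k) \<in> bad" using xk \<open>x \<in> N\<close> SI uw by (simp add: bad_def)
              then show ?thesis using g0 SI uw e by simp
            qed
          next
            case False
            then have x: "x \<in> {a..b} - N" using uw by auto
            have "k \<subseteq> d x" using fine xk by (auto simp: fine_def)
            then have "{u..w} \<subseteq> ball x (r x)" using x uw by (auto simp: d_def)
            then have "u \<in> ball x (r x)" "w \<in> ball x (r x)" using uw(1,2) by (simp_all add: subset_iff)
            then have "\<bar>u - x\<bar> < r x" "\<bar>w - x\<bar> < r x" by (auto simp: dist_real_def)
            \<comment> \<open>The tag lies between \<open>u\<close> and \<open>w\<close>, so the two
              linearization errors, proportional to the distances of the ends from the tag, add up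
              to \<open>e / 2\<close> times the length.\<close>
            note 1 = r(2)[OF x this(1)] and 2 = r(2)[OF x this(2)]
            have "measure lborel k *\<^sub>R g x - \<Delta> k = (f u - f x - (u - x) *\<^sub>R g x) - (f w - f x - (w - x) *\<^sub>R g x)"
              unfolding \<Delta>_def SI by (simp add: algebra_simps)
            then have "norm (measure lborel k *\<^sub>R g x - \<Delta> k) \<le> e / 2 * \<bar>u - x\<bar> + e / 2 * \<bar>w - x\<bar>"
              using order_trans[OF norm_triangle_ineq4 add_mono[OF 1 2]] by metis
            also have "\<dots> = e / 2 * measure lborel k" using uw SI by (simp add: field_simps)
            finally show ?thesis by (smt (verit) norm_ge_zero)
          qed
        qed
        have badsum: "(\<Sum>t\<in>bad. norm (\<Delta> (snd t))) \<le> e / 2 * (b - a)"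
        proof -
          define n where "n = card bad"
          obtain \<phi> where \<phi>: "bij_betw \<phi> {0..<n} bad" using ex_bij_betw_nat_finite[OF finb] n_def by blast
          define u w where "u i = Inf (snd (\<phi> i))" and "w i = Sup (snd (\<phi> i))" for i
          have \<phi>b: "\<phi> i \<in> bad" if "i < n" for i using \<phi> that by (auto simp: bij_betw_def)
          have uw: "snd (\<phi> i) = {u i..w i}" "u i < w i" "a \<le> u i" "w i \<le> b" "{u i..w i} \<subseteq> U" if "i < n" for i
          proof -
            have b: "(fst (\<phi> i), snd (\<phi> i)) \<in> p" "measure lborel (snd (\<phi> i)) > 0" "fst (\<phi> i) \<in> N"
              using \<phi>b[OF that] by (auto simp: bad_def)
            obtain u' w' where k: "u' \<le> fst (\<phi> i)" "fst (\<phi> i) \<le> w'" "snd (\<phi> i) = {u'..w'}" "a \<le> u'" "w' \<le> b"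
              using iv[OF b(1)] by blast
            have "u' < w'" using b(2) k by auto
            moreover have "u i = u'" "w i = w'" using k by (auto simp: u_def w_def)
            moreover have "snd (\<phi> i) \<subseteq> d (fst (\<phi> i))" using fine b(1) unfolding fine_def by blast
            ultimately show "snd (\<phi> i) = {u i..w i}" "u i < w i" "a \<le> u i" "w i \<le> b" "{u i..w i} \<subseteq> U"
              using k b(3) by (auto simp: d_def)
          qed
          have disj: "{u i<..<w i} \<inter> {u j<..<w j} = {}" if ij: "i < n" "j < n" "i \<noteq> j" for i j
          proof -
            have "\<phi> i \<noteq> \<phi> j" using \<phi> ij by (auto simp: bij_betw_def inj_on_def)
            moreover have "\<phi> i \<in> p" "\<phi> j \<in> p" using \<phi>b ij by (auto simp: bad_def)
            ultimately have "interior (snd (\<phi> i)) \<inter> interior (snd (\<phi> j)) = {}"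
              using tagged_division_ofD(5)[OF p, of "fst (\<phi> i)" "snd (\<phi> i)" "fst (\<phi> j)" "snd (\<phi> j)"] by simp
            then show ?thesis using uw(1) ij by (simp add: interior_atLeastAtMost_real)
          qed
          have fam: "interval_family a b n u w"
            unfolding interval_family_def
          proof (intro conjI allI impI)
            fix i j assume ij: "i < n" "j < n" "i \<noteq> j"
            show "w i \<le> u j \<or> w j \<le> u i"
            proof (rule ccontr)
              assume "\<not> (w i \<le> u j \<or> w j \<le> u i)"
              then have "max (u i) (u j) < min (w i) (w j)" using uw(2) ij by auto
              then obtain z where "max (u i) (u j) < z" "z < min (w i) (w j)" using dense by blast
              then have "z \<in> {u i<..<w i} \<inter> {u j<..<w j}" by auto
              then show False using disj[OF ij] by blast
            qed
          qed (use uw in \<open>auto simp: less_imp_le\<close>)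
          have "(\<Sum>i<n. w i - u i) = (\<Sum>i<n. measure lebesgue {u i<..<w i})"
            using uw(2) by (intro sum.cong) (auto simp: less_imp_le)
          also have "\<dots> = measure lebesgue (\<Union>i<n. {u i<..<w i})"
            by (rule measure_UNION'[symmetric]) (use disj in \<open>auto simp: pairwise_def disjnt_def\<close>)
          also have "\<dots> \<le> measure lebesgue U"
          proof (rule measure_mono_fmeasurable[OF _ _ U(3)])
            have "{u i<..<w i} \<subseteq> U" if "i < n" for i
              using uw(5)[OF that] greaterThanLessThan_subseteq_atLeastAtMost_iff[of "u i" "w i" "u i" "w i"] by auto
            then show "(\<Union>i<n. {u i<..<w i}) \<subseteq> U" by (intro UN_least) auto
          qed auto
          finally have "(\<Sum>i<n. w i - u i) < \<delta>" using U(4) by simp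
          from \<delta>(2)[OF fam this] have "(\<Sum>i<n. norm (f (w i) - f (u i))) \<le> e / 2 * (b - a)" by simp
          moreover have "(\<Sum>t\<in>bad. norm (\<Delta> (snd t))) = (\<Sum>i<n. norm (f (w i) - f (u i)))"
            using sum.reindex_bij_betw[OF \<phi>, of "\<lambda>t. norm (\<Delta> (snd t))"]
            by (simp add: \<Delta>_def u_def w_def atLeast0LessThan)
          ultimately show ?thesis by simp
        qed
        have "norm ((\<Sum>(x, k)\<in>p. measure lborel k *\<^sub>R g x) - (f b - f a)) = norm (\<Sum>(x, k)\<in>p. measure lborel k *\<^sub>R g x - \<Delta> k)"
          using additive_tagged_division_1[OF ab p, of f]
          by (simp add: \<Delta>_def sum_subtractf case_prod_unfold)
        also have "\<dots> \<le> (\<Sum>(x, k)\<in>p. e / 2 * measure lborel k + (if (x, k) \<in> bad then norm (\<Delta> k) else 0))"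
          using bnd by (intro order_trans[OF norm_sum sum_mono]) auto
        also have "\<dots> = e / 2 * (\<Sum>(x, k)\<in>p. measure lborel k) + (\<Sum>t\<in>p. if t \<in> bad then norm (\<Delta> (snd t)) else 0)"
          by (simp add: sum.distrib sum_distrib_left case_prod_unfold)
        also have "(\<Sum>(x, k)\<in>p. measure lborel k) = b - a"
          using additive_content_tagged_division[of p a b] p ab by (simp add: box_real)
        also have "(\<Sum>t\<in>p. if t \<in> bad then norm (\<Delta> (snd t)) else 0) = (\<Sum>t\<in>bad. norm (\<Delta> (snd t)))"
        proof -
          have "p \<inter> bad = bad" by (auto simp: bad_def)
          then show ?thesis using sum.inter_restrict[OF finp, of "\<lambda>t. norm (\<Delta> (snd t))" bad] by simp
        qed
        finally show ?thesis using badsum ab by simp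
      qed
      ultimately show ?thesis by (intro exI[of _ d]) simp
    qed
  qed
  then show ?thesis
    by (rule has_integral_spike[OF N, rotated]) (auto simp: g_def)
qed

section \<open>Legendre duality for Tonelli Hamiltonians\<close>

lemma grad_eqI:
  assumes "(f has_derivative (\<lambda>u. q \<bullet> u)) (at x)"
  shows "grad f x = q"
  unfolding grad_def
proof (rule some_equality[where P = "\<lambda>p. (f has_derivative (\<lambda>u. p \<bullet> u)) (at x)"])
  fix p assume "(f has_derivative (\<lambda>u. p \<bullet> u)) (at x)"
  then have "(\<lambda>u. p \<bullet> u) = (\<lambda>u. q \<bullet> u)" using assms by (rule has_derivative_unique)
  then show "p = q" by (metis vector_eq_rdot inner_commute)
qed (rule assms)

text \<open>This is the form in which differentiability of L and of v is obtained: both come with a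
  two-sided quadratic estimate and an explicit gradient.\<close>

lemma has_derivative_of_quadratic_bound:
  fixes f :: "'a::euclidean_space \<Rightarrow> real"
  assumes b: "\<And>u. norm u \<le> 1 \<Longrightarrow> \<bar>f (x + u) - f x - q \<bullet> u\<bar> \<le> K * (norm u)\<^sup>2"
  shows "(f has_derivative (\<lambda>u. q \<bullet> u)) (at x)"
  unfolding has_derivative_at_alt
proof (intro conjI allI impI)
  show "bounded_linear (\<lambda>u. q \<bullet> u)" by (rule bounded_linear_inner_right)
  fix e :: real assume e: "e > 0"
  have K: "K \<le> \<bar>K\<bar> + 1" "\<bar>K\<bar> + 1 > 0" by auto
  show "\<exists>d>0. \<forall>y. norm (y - x) < d \<longrightarrow> norm (f y - f x - q \<bullet> (y - x)) \<le> e * norm (y - x)"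
  proof (intro exI[of _ "min 1 (e / (\<bar>K\<bar> + 1))"] conjI allI impI)
    fix y assume y: "norm (y - x) < min 1 (e / (\<bar>K\<bar> + 1))"
    have "\<bar>f y - f x - q \<bullet> (y - x)\<bar> \<le> K * (norm (y - x))\<^sup>2" using b[of "y - x"] y by simp
    also have "\<dots> \<le> (\<bar>K\<bar> + 1) * (norm (y - x))\<^sup>2" using K by (intro mult_right_mono) auto
    also have "\<dots> = ((\<bar>K\<bar> + 1) * norm (y - x)) * norm (y - x)" by (simp add: power2_eq_square)
    also have "\<dots> \<le> e * norm (y - x)"
      using y K by (intro mult_right_mono) (auto simp: field_simps)
    finally show "norm (f y - f x - q \<bullet> (y - x)) \<le> e * norm (y - x)" by simp
  qed (use e K in auto)
qed

lemma lattice_translate_to_cube: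
  fixes x :: "real^'n"
  obtains k where "k \<in> lattice" "x + k \<in> cbox 0 (\<chi> i. 1)"
proof (rule that[of "\<chi> i. - of_int \<lfloor>x $ i\<rfloor>"])
  show "(\<chi> i. - of_int \<lfloor>x $ i\<rfloor>) \<in> (lattice :: (real^'n) set)" by (simp add: lattice_def)
  have "0 \<le> x $ i - of_int \<lfloor>x $ i\<rfloor>" "x $ i - of_int \<lfloor>x $ i\<rfloor> \<le> 1" for i by linarith+
  then show "x + (\<chi> i. - of_int \<lfloor>x $ i\<rfloor>) \<in> cbox 0 (\<chi> i. 1)"
    by (auto simp: mem_box_cart)
qed

lemma lattice_minus: "k \<in> lattice \<Longrightarrow> - k \<in> lattice"
  by (simp add: lattice_def)

text \<open>Periodicity moves \<open>x\<close> into the unit cube, so a bound on \<open>p\<close>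
  alone puts the argument into a compact set.\<close>

lemma periodic_bounded:
  fixes F :: "(real^'n) \<times> (real^'n) \<Rightarrow> 'b::real_normed_vector"
  assumes cont: "continuous_on UNIV F" and per: "\<And>k x p. k \<in> lattice \<Longrightarrow> F (x + k, p) = F (x, p)"
  obtains B where "B \<ge> 0" "\<And>x p. norm p \<le> R \<Longrightarrow> norm (F (x, p)) \<le> B"
proof -
  have "compact (F ` (cbox 0 (\<chi> i. 1) \<times> cball 0 R))"
    by (intro compact_continuous_image compact_Times continuous_on_subset[OF cont]) auto
  then obtain B where B: "\<And>z. z \<in> F ` (cbox 0 (\<chi> i. 1) \<times> cball 0 R) \<Longrightarrow> norm z \<le> B"
    using compact_imp_bounded bounded_iff by metis
  show thesis
  proof (rule that[of "max B 0"])
    fix x p :: "real^'n" assume p: "norm p \<le> R"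
    obtain k where k: "k \<in> lattice" "x + k \<in> cbox 0 (\<chi> i. 1)" by (rule lattice_translate_to_cube)
    have "norm (F (x + k, p)) \<le> B" using k p by (intro B imageI) auto
    then show "norm (F (x, p)) \<le> max B 0" using per[OF k(1)] by simp
  qed simp
qed

section \<open>Derivatives of the Hamiltonian and estimates uniform in the position\<close>

locale tonelli =
  fixes H :: "real^'n \<Rightarrow> real^'n \<Rightarrow> real"
    and D :: "(real^'n) \<times> (real^'n) \<Rightarrow> ((real^'n) \<times> (real^'n)) \<Rightarrow>\<^sub>L real"
    and D2 :: "(real^'n) \<times> (real^'n) \<Rightarrow> ((real^'n) \<times> (real^'n)) \<Rightarrow>\<^sub>L ((real^'n) \<times> (real^'n)) \<Rightarrow>\<^sub>L real"
  assumes per: "k \<in> lattice \<Longrightarrow> H (x + k) p = H x p"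
    and dH: "((\<lambda>z. H (fst z) (snd z)) has_derivative blinfun_apply (D z)) (at z)"
    and dD: "(D has_derivative blinfun_apply (D2 z)) (at z)"
    and contD2: "continuous_on UNIV D2"
    and pos: "u \<noteq> 0 \<Longrightarrow> blinfun_apply (blinfun_apply (D2 (x, p)) (0, u)) (0, u) > 0"
    and superlinear: "\<exists>R. \<forall>x p. norm p \<ge> R \<longrightarrow> H x p \<ge> M * norm p"
begin

lemma D_per: "k \<in> lattice \<Longrightarrow> D (x + k, p) = D (x, p)"
proof -
  assume k: "k \<in> lattice"
  have "((\<lambda>z. H (fst (z + (k, 0))) (snd (z + (k, 0)))) has_derivative blinfun_apply (D ((x, p) + (k, 0)))) (at (x, p))"
    by (rule has_derivative_compose[of "\<lambda>z. z + (k, 0)" "\<lambda>h. h" "(x, p)" UNIV, OF _ dH]) (auto intro!: derivative_eq_intros)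
  then have "((\<lambda>z. H (fst z) (snd z)) has_derivative blinfun_apply (D (x + k, p))) (at (x, p))"
    using per[OF k] by simp
  then have "blinfun_apply (D (x + k, p)) = blinfun_apply (D (x, p))"
    using dH by (rule has_derivative_unique)
  then show ?thesis by (simp add: blinfun_apply_inject)
qed

lemma D2_per: "k \<in> lattice \<Longrightarrow> D2 (x + k, p) = D2 (x, p)"
proof -
  assume k: "k \<in> lattice"
  have "((\<lambda>z. D (z + (k, 0))) has_derivative blinfun_apply (D2 ((x, p) + (k, 0)))) (at (x, p))"
    by (rule has_derivative_compose[of "\<lambda>z. z + (k, 0)" "\<lambda>h. h" "(x, p)" UNIV, OF _ dD]) (auto intro!: derivative_eq_intros)
  moreover have "(\<lambda>z. D (z + (k, 0))) = D" using D_per[OF k] by (auto simp: fun_eq_iff)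
  ultimately have "(D has_derivative blinfun_apply (D2 (x + k, p))) (at (x, p))" by simp
  then have "blinfun_apply (D2 (x + k, p)) = blinfun_apply (D2 (x, p))"
    using dD by (rule has_derivative_unique)
  then show ?thesis by (simp add: blinfun_apply_inject)
qed

text \<open>The adjoint of a linear functional, applied to 1, is its Riesz vector. Defining the
  partial gradients through \<open>D\<close> lets continuity and Lipschitz bounds of
  \<open>D\<close> pass to them.\<close>

definition gHx :: "real^'n \<Rightarrow> real^'n \<Rightarrow> real^'n" where
  "gHx x p = adjoint (\<lambda>u. D (x, p) (u, 0)) 1"

definition gHp :: "real^'n \<Rightarrow> real^'n \<Rightarrow> real^'n" where
  "gHp x p = adjoint (\<lambda>u. D (x, p) (0, u)) 1"

lemma D_fst: "D (x, p) (u, 0) = gHx x p \<bullet> u"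
proof -
  have "linear (\<lambda>u. D (x, p) (u, 0))"
    by (intro bounded_linear.linear bounded_linear_intros)
  from adjoint_works[OF this, of u 1] show ?thesis by (simp add: gHx_def inner_commute)
qed

lemma D_snd: "D (x, p) (0, u) = gHp x p \<bullet> u"
proof -
  have "linear (\<lambda>u. D (x, p) (0, u))"
    by (intro bounded_linear.linear bounded_linear_intros)
  from adjoint_works[OF this, of u 1] show ?thesis by (simp add: gHp_def inner_commute)
qed

lemma H_has_derivative_p: "(H x has_derivative (\<lambda>u. gHp x p \<bullet> u)) (at p)"
proof -
  have "((\<lambda>p. H (fst (x, p)) (snd (x, p))) has_derivative (\<lambda>u. D (x, p) (0, u))) (at p)"
    by (rule has_derivative_compose[of "\<lambda>p. (x, p)" "\<lambda>u. (0, u)" p UNIV, OF _ dH]) (auto intro!: derivative_eq_intros)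
  then show ?thesis by (simp add: D_snd)
qed

lemma H_has_derivative_x: "((\<lambda>x. H x p) has_derivative (\<lambda>u. gHx x p \<bullet> u)) (at x)"
proof -
  have "((\<lambda>x. H (fst (x, p)) (snd (x, p))) has_derivative (\<lambda>u. D (x, p) (u, 0))) (at x)"
    by (rule has_derivative_compose[of "\<lambda>x. (x, p)" "\<lambda>u. (u, 0)" x UNIV, OF _ dH]) (auto intro!: derivative_eq_intros)
  then show ?thesis by (simp add: D_fst)
qed

lemma Hp_eq: "Hp H x p = gHp x p"
  unfolding Hp_def by (rule grad_eqI[OF H_has_derivative_p])

lemma H_continuous: "continuous_on UNIV (\<lambda>z. H (fst z) (snd z))"
  using dH by (intro has_derivative_continuous_on) (auto intro: has_derivative_at_withinI)

lemma D_continuous: "continuous_on UNIV D"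
  using dD by (intro has_derivative_continuous_on) (auto intro: has_derivative_at_withinI)

text \<open>The functional \<open>D (x, p) - D (x', p')\<close> is evaluated at the gradient
  difference itself, which yields the square of its norm.\<close>

lemma norm_gH_diff:
  "norm (gHx x p - gHx x' p') \<le> norm (D (x, p) - D (x', p'))"
  "norm (gHp x p - gHp x' p') \<le> norm (D (x, p) - D (x', p'))"
proof -
  have *: "norm g \<le> N" if "g \<bullet> g \<le> N * norm g" "N \<ge> 0" for g :: "real^'n" and N
    using that by (cases "g = 0") (auto simp: dot_square_norm power2_eq_square)
  have "(gHx x p - gHx x' p') \<bullet> u = (D (x, p) - D (x', p')) (u, 0)" for u
    by (simp add: D_fst inner_diff_left blinfun.diff_left)
  then show "norm (gHx x p - gHx x' p') \<le> norm (D (x, p) - D (x', p'))"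
    using norm_blinfun[of "D (x, p) - D (x', p')" "(gHx x p - gHx x' p', 0)"]
    by (intro *) (auto intro: abs_le_D1)
  have "(gHp x p - gHp x' p') \<bullet> u = (D (x, p) - D (x', p')) (0, u)" for u
    by (simp add: D_snd inner_diff_left blinfun.diff_left)
  then show "norm (gHp x p - gHp x' p') \<le> norm (D (x, p) - D (x', p'))"
    using norm_blinfun[of "D (x, p) - D (x', p')" "(0, gHp x p - gHp x' p')"]
    by (intro *) (auto intro: abs_le_D1)
qed

lemma gHx_continuous: "continuous_on UNIV (\<lambda>z. gHx (fst z) (snd z))"
  and gHp_continuous: "continuous_on UNIV (\<lambda>z. gHp (fst z) (snd z))"
proof -
  have *: "\<exists>d>0. \<forall>y. dist y z < d \<longrightarrow> dist (D y) (D z) < e" if "e > 0" for z e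
    using D_continuous that unfolding continuous_on_iff by (metis UNIV_I)
  show "continuous_on UNIV (\<lambda>z. gHx (fst z) (snd z))"
    unfolding continuous_on_iff
    using * norm_gH_diff(1) by (metis (no_types, lifting) dist_norm order_le_less_trans prod.collapse)
  show "continuous_on UNIV (\<lambda>z. gHp (fst z) (snd z))"
    unfolding continuous_on_iff
    using * norm_gH_diff(2) by (metis (no_types, lifting) dist_norm order_le_less_trans prod.collapse)
qed

lemma H_segment_mvt_x: "\<exists>z. norm (z - x) \<le> norm (y - x) \<and> H y p - H x p = gHx z p \<bullet> (y - x)"
proof -
  have "\<exists>t>0. t < 1 \<and> H (x + 1 *\<^sub>R (y - x)) p - H (x + 0 *\<^sub>R (y - x)) p = (1 - 0) * (gHx (x + t *\<^sub>R (y - x)) p \<bullet> (y - x))"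
  proof (rule MVT2)
    fix t :: real
    have "((\<lambda>t. H (x + t *\<^sub>R (y - x)) p) has_derivative (\<lambda>s. gHx (x + t *\<^sub>R (y - x)) p \<bullet> (s *\<^sub>R (y - x)))) (at t)"
      by (rule has_derivative_compose[of "\<lambda>t. x + t *\<^sub>R (y - x)" "\<lambda>s. s *\<^sub>R (y - x)" t UNIV, OF _ H_has_derivative_x]) (auto intro!: derivative_eq_intros)
    then show "((\<lambda>t. H (x + t *\<^sub>R (y - x)) p) has_real_derivative gHx (x + t *\<^sub>R (y - x)) p \<bullet> (y - x)) (at t)"
      by (simp add: has_field_derivative_def mult.commute[of _ "gHx _ _ \<bullet> _"] mult_commute_abs)
  qed simp
  then obtain t where t: "0 < t" "t < 1" "H y p - H x p = gHx (x + t *\<^sub>R (y - x)) p \<bullet> (y - x)" by auto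
  have "norm (x + t *\<^sub>R (y - x) - x) \<le> norm (y - x)" using t by (simp add: mult_left_le_one_le)
  then show ?thesis using t(3) by blast
qed

lemma H_segment_mvt_p: "\<exists>t>0. t < 1 \<and> H x q - H x p = gHp x (p + t *\<^sub>R (q - p)) \<bullet> (q - p)"
proof -
  have "\<exists>t>0. t < 1 \<and> H x (p + 1 *\<^sub>R (q - p)) - H x (p + 0 *\<^sub>R (q - p)) = (1 - 0) * (gHp x (p + t *\<^sub>R (q - p)) \<bullet> (q - p))"
  proof (rule MVT2)
    fix t :: real
    have "((\<lambda>t. H x (p + t *\<^sub>R (q - p))) has_derivative (\<lambda>s. gHp x (p + t *\<^sub>R (q - p)) \<bullet> (s *\<^sub>R (q - p)))) (at t)"
      by (rule has_derivative_compose[of "\<lambda>t. p + t *\<^sub>R (q - p)" "\<lambda>s. s *\<^sub>R (q - p)" t UNIV, OF _ H_has_derivative_p]) (auto intro!: derivative_eq_intros)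
    then show "((\<lambda>t. H x (p + t *\<^sub>R (q - p))) has_real_derivative gHp x (p + t *\<^sub>R (q - p)) \<bullet> (q - p)) (at t)"
      by (simp add: has_field_derivative_def mult.commute[of _ "gHp _ _ \<bullet> _"] mult_commute_abs)
  qed simp
  then show ?thesis by auto
qed

lemma gHp_segment_mvt:
  "\<exists>t>0. t < 1 \<and> (gHp x q - gHp x p) \<bullet> (q - p) = D2 (x, p + t *\<^sub>R (q - p)) (0, q - p) (0, q - p)"
proof -
  have "\<exists>t>0. t < 1 \<and> D (x, p + 1 *\<^sub>R (q - p)) (0, q - p) - D (x, p + 0 *\<^sub>R (q - p)) (0, q - p)
      = (1 - 0) * (D2 (x, p + t *\<^sub>R (q - p)) (0, q - p) (0, q - p))"
  proof (rule MVT2)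
    fix t :: real
    have "((\<lambda>t. D (x, p + t *\<^sub>R (q - p))) has_derivative (\<lambda>s. D2 (x, p + t *\<^sub>R (q - p)) (0, s *\<^sub>R (q - p)))) (at t)"
      by (rule has_derivative_compose[of "\<lambda>t. (x, p + t *\<^sub>R (q - p))" "\<lambda>s. (0, s *\<^sub>R (q - p))" t UNIV, OF _ dD]) (auto intro!: derivative_eq_intros)
    then have "((\<lambda>t. D (x, p + t *\<^sub>R (q - p)) (0, q - p)) has_derivative
        (\<lambda>s. D2 (x, p + t *\<^sub>R (q - p)) (0, s *\<^sub>R (q - p)) (0, q - p))) (at t)"
      by (auto intro!: derivative_eq_intros)
    moreover have "D2 (x, p + t *\<^sub>R (q - p)) (0, s *\<^sub>R (q - p)) (0, q - p) =
        D2 (x, p + t *\<^sub>R (q - p)) (0, q - p) (0, q - p) * s" for s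
      using blinfun.scaleR_right[of "D2 (x, p + t *\<^sub>R (q - p))" s "(0, q - p)"]
      by (simp add: blinfun.scaleR_left)
    ultimately show "((\<lambda>t. D (x, p + t *\<^sub>R (q - p)) (0, q - p)) has_real_derivative
        D2 (x, p + t *\<^sub>R (q - p)) (0, q - p) (0, q - p)) (at t)"
      by (simp add: has_field_derivative_def mult_commute_abs)
  qed simp
  then show ?thesis by (simp add: D_snd inner_diff_left)
qed

text \<open>One constant serves all estimates on the region where \<open>p\<close> is bounded by
  \<open>R\<close> and \<open>x\<close> is arbitrary. That region is convex, so a bound on
  \<open>D2\<close> there makes \<open>D\<close> Lipschitz.\<close>

lemma H_bounds:
  obtains B where "B \<ge> 0" "\<And>x p. norm p \<le> R \<Longrightarrow> \<bar>H x p\<bar> \<le> B"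
    "\<And>x p. norm p \<le> R \<Longrightarrow> norm (gHx x p) \<le> B"
    "\<And>x y p. norm p \<le> R \<Longrightarrow> \<bar>H x p - H y p\<bar> \<le> B * norm (x - y)"
    "\<And>x y p q. norm p \<le> R \<Longrightarrow> norm q \<le> R \<Longrightarrow> norm (gHx x p - gHx y q) \<le> B * (norm (x - y) + norm (p - q))"
    "\<And>x y p q. norm p \<le> R \<Longrightarrow> norm q \<le> R \<Longrightarrow> norm (gHp x p - gHp y q) \<le> B * (norm (x - y) + norm (p - q))"
proof -
  obtain B0 where B0: "B0 \<ge> 0" "\<And>x p. norm p \<le> R \<Longrightarrow> norm (H x p) \<le> B0"
    by (rule periodic_bounded[OF H_continuous, of R]) (auto simp: per)
  obtain B1 where B1: "B1 \<ge> 0" "\<And>x p. norm p \<le> R \<Longrightarrow> norm (D (x, p)) \<le> B1"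
    by (rule periodic_bounded[OF D_continuous, of R]) (auto simp: D_per)
  obtain B2 where B2: "B2 \<ge> 0" "\<And>x p. norm p \<le> R \<Longrightarrow> norm (D2 (x, p)) \<le> B2"
    by (rule periodic_bounded[OF contD2, of R]) (auto simp: D2_per)
  define B where "B = B0 + B1 + B2"
  have gx: "norm (gHx x p) \<le> B1" if "norm p \<le> R" for x p
  proof -
    have "gHx x p \<bullet> gHx x p \<le> norm (D (x, p)) * norm (gHx x p)"
      using norm_blinfun[of "D (x, p)" "(gHx x p, 0)"] by (simp add: D_fst)
    then have "norm (gHx x p) \<le> norm (D (x, p))"
      by (cases "gHx x p = 0") (auto simp: dot_square_norm power2_eq_square)
    then show ?thesis using B1(2)[OF that] by (rule order_trans)
  qed
  have Dl: "norm (D (x, p) - D (y, q)) \<le> B * (norm (x - y) + norm (p - q))"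
    if "norm p \<le> R" "norm q \<le> R" for x y p q
  proof -
    have "norm (D (x, p) - D (y, q)) \<le> B2 * norm ((x, p) - (y, q))"
    proof (rule differentiable_bound[of "UNIV \<times> cball 0 R" D "\<lambda>z. blinfun_apply (D2 z)"])
      show "convex (UNIV \<times> cball 0 R :: ((real^'n) \<times> (real^'n)) set)" by (intro convex_Times convex_UNIV convex_cball)
      fix z :: "(real^'n) \<times> (real^'n)" assume z: "z \<in> UNIV \<times> cball 0 R"
      show "(D has_derivative blinfun_apply (D2 z)) (at z within UNIV \<times> cball 0 R)"
        by (rule has_derivative_at_withinI[OF dD])
      show "onorm (blinfun_apply (D2 z)) \<le> B2"
        using B2(2)[of "snd z" "fst z"] z by (auto simp: norm_blinfun.rep_eq mem_Times_iff)
    qed (use that in auto)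
    also have "\<dots> \<le> B2 * (norm (x - y) + norm (p - q))"
      using B2(1) norm_Pair_le[of "x - y" "p - q"] by (intro mult_left_mono) auto
    also have "\<dots> \<le> B * (norm (x - y) + norm (p - q))"
      using B0 B1 by (intro mult_right_mono) (auto simp: B_def)
    finally show ?thesis .
  qed
  show thesis
  proof (rule that[of B])
    show "B \<ge> 0" using B0 B1 B2 by (simp add: B_def)
    show "\<bar>H x p\<bar> \<le> B" if "norm p \<le> R" for x p using B0(2)[OF that, of x] B1 B2 by (simp add: B_def)
    show "norm (gHx x p) \<le> B" if "norm p \<le> R" for x p using gx[OF that, of x] B0 B2 by (simp add: B_def)
    show "\<bar>H x p - H y p\<bar> \<le> B * norm (x - y)" if p: "norm p \<le> R" for x y p
    proof -
      obtain z where z: "H x p - H y p = gHx z p \<bullet> (x - y)" using H_segment_mvt_x[of y x p] by blast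
      have "\<bar>H x p - H y p\<bar> \<le> norm (gHx z p) * norm (x - y)" unfolding z by (rule Cauchy_Schwarz_ineq2)
      also have "\<dots> \<le> B * norm (x - y)"
        using gx[OF p, of z] B0 B2 by (intro mult_right_mono) (auto simp: B_def)
      finally show ?thesis .
    qed
    show "norm (gHx x p - gHx y q) \<le> B * (norm (x - y) + norm (p - q))"
      "norm (gHp x p - gHp y q) \<le> B * (norm (x - y) + norm (p - q))"
      if "norm p \<le> R" "norm q \<le> R" for x y p q
      using norm_gH_diff[of x p y q] Dl[OF that, of x y] by auto
  qed
qed

text \<open>Positive definiteness becomes uniform by minimizing the quadratic form over the compact
  set of positions in the cube, bounded momenta and unit directions; homogeneity and the mean value
  theorem do the rest.\<close>

lemma gHp_strong_mono:
  obtains m where "m > 0"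
    "\<And>x p q. norm p \<le> R \<Longrightarrow> norm q \<le> R \<Longrightarrow> m * (norm (q - p))\<^sup>2 \<le> (gHp x q - gHp x p) \<bullet> (q - p)"
proof -
  define S :: "(((real^'n) \<times> (real^'n)) \<times> (real^'n)) set" where "S = (cbox 0 (\<chi> i. 1) \<times> cball 0 R) \<times> sphere 0 1"
  define G where "G = (\<lambda>(z, u). D2 z (0, u) (0, u))"
  have cont: "continuous_on S G"
    unfolding G_def case_prod_unfold
    by (intro continuous_intros continuous_on_compose2[OF contD2]) auto
  have comp: "compact S" unfolding S_def by (intro compact_Times compact_sphere compact_cball compact_cbox)
  have "\<exists>m>0. \<forall>s\<in>S. m \<le> G s"
  proof (cases "S = {}")
    case True
    then show ?thesis by (intro exI[of _ 1]) auto
  next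
    case False
    obtain s where s: "s \<in> S" "\<And>t. t \<in> S \<Longrightarrow> G s \<le> G t"
      using continuous_attains_inf[OF comp False cont] by blast
    have "snd s \<noteq> 0" using s(1) unfolding S_def by auto
    then have "G s > 0" unfolding G_def using pos[of "snd s" "fst (fst s)" "snd (fst s)"] by (simp add: case_prod_unfold)
    then show ?thesis using s by blast
  qed
  then obtain m where m: "m > 0" "\<And>s. s \<in> S \<Longrightarrow> m \<le> G s" by blast
  have low: "m * (norm u)\<^sup>2 \<le> D2 (x, p) (0, u) (0, u)" if p: "norm p \<le> R" for x p u
  proof (cases "u = 0")
    case True
    then show ?thesis by (simp add: zero_prod_def[symmetric] blinfun.zero_right)
  next
    case False
    obtain k where k: "k \<in> lattice" "x + k \<in> cbox 0 (\<chi> i. 1)" by (rule lattice_translate_to_cube)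
    define e where "e = u /\<^sub>R norm u"
    have "norm e = 1" "u = norm u *\<^sub>R e" using False by (auto simp: e_def)
    have "((x + k, p), e) \<in> S" using k p \<open>norm e = 1\<close> by (auto simp: S_def)
    from m(2)[OF this] have me: "m \<le> D2 (x, p) (0, e) (0, e)" by (simp add: G_def D2_per[OF k(1)])
    have "(0 :: real^'n, u) = norm u *\<^sub>R (0, e)" using \<open>u = norm u *\<^sub>R e\<close> by simp
    then have "D2 (x, p) (0, u) (0, u) = (norm u)\<^sup>2 * D2 (x, p) (0, e) (0, e)"
      by (simp only: blinfun.scaleR_right blinfun.scaleR_left real_scaleR_def power2_eq_square mult.assoc)
    then show ?thesis using me by (simp add: mult.commute[of m] mult_left_mono)
  qed
  show thesis
  proof (rule that[OF m(1)])
    fix x p q :: "real^'n" assume pq: "norm p \<le> R" "norm q \<le> R"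
    obtain t where t: "0 < t" "t < 1" "(gHp x q - gHp x p) \<bullet> (q - p) = D2 (x, p + t *\<^sub>R (q - p)) (0, q - p) (0, q - p)"
      using gHp_segment_mvt by blast
    have "p + t *\<^sub>R (q - p) = (1 - t) *\<^sub>R p + t *\<^sub>R q" by (simp add: algebra_simps)
    then have "p + t *\<^sub>R (q - p) \<in> cball 0 R"
      using convexD[OF convex_cball, of p 0 R q "1 - t" t] pq t by auto
    then show "m * (norm (q - p))\<^sup>2 \<le> (gHp x q - gHp x p) \<bullet> (q - p)" using low t(3) by simp
  qed
qed

lemma gHp_mono: "0 \<le> (gHp x q - gHp x p) \<bullet> (q - p)"
  and gHp_inj: "gHp x q = gHp x p \<Longrightarrow> q = p"
proof -
  obtain m where m: "m > 0" "\<And>x a b. norm a \<le> max (norm p) (norm q) \<Longrightarrow> norm b \<le> max (norm p) (norm q) \<Longrightarrow>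
      m * (norm (b - a))\<^sup>2 \<le> (gHp x b - gHp x a) \<bullet> (b - a)"
    using gHp_strong_mono[of "max (norm p) (norm q)"] by blast
  have *: "m * (norm (q - p))\<^sup>2 \<le> (gHp x q - gHp x p) \<bullet> (q - p)" by (rule m(2)) auto
  have "0 \<le> m * (norm (q - p))\<^sup>2" using m(1) by simp
  then show "0 \<le> (gHp x q - gHp x p) \<bullet> (q - p)" using * by linarith
  assume "gHp x q = gHp x p"
  then have "m * (norm (q - p))\<^sup>2 \<le> 0" using * by simp
  then show "q = p" using m(1) by (simp add: mult_le_0_iff)
qed

section \<open>Convexity in the momentum and the Legendre transform\<close>

lemma H_convex: "H x p + gHp x p \<bullet> (q - p) \<le> H x q"
proof -
  obtain t where t: "0 < t" "t < 1" "H x q - H x p = gHp x (p + t *\<^sub>R (q - p)) \<bullet> (q - p)"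
    using H_segment_mvt_p by blast
  have "0 \<le> t * ((gHp x (p + t *\<^sub>R (q - p)) - gHp x p) \<bullet> (q - p))"
    using gHp_mono[of x "p + t *\<^sub>R (q - p)" p] by simp
  then have "0 \<le> (gHp x (p + t *\<^sub>R (q - p)) - gHp x p) \<bullet> (q - p)" using t(1) by (simp add: zero_le_mult_iff)
  then show ?thesis using t(3) by (simp add: inner_diff_left)
qed

text \<open>Superlinearity confines the maximum of \<open>\<xi> \<bullet> p - H x p\<close> to the
  interior of a ball whose radius depends only on the bound for \<xi>; there the gradient
  vanishes.\<close>

lemma gHp_surj_bound:
  obtains \<rho> where "\<And>x \<xi>. norm \<xi> \<le> R \<Longrightarrow> \<exists>p. norm p \<le> \<rho> \<and> gHp x p = \<xi>"
proof -
  obtain R1 where R1: "\<And>x p. norm p \<ge> R1 \<Longrightarrow> H x p \<ge> (R + 1) * norm p" using superlinear[of "R + 1"] by blast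
  obtain B where B: "B \<ge> 0" "\<And>x p. norm p \<le> 0 \<Longrightarrow> \<bar>H x p\<bar> \<le> B" using H_bounds[of 0] by metis
  \<comment> \<open>Beyond \<open>R1\<close> the function \<open>f\<close> is at most minus the norm
    of its argument, and beyond \<open>B + 1\<close> this is less than \<open>- B\<close>, a lower
    bound of \<open>f 0\<close>.\<close>
  define \<rho> where "\<rho> = max R1 (B + 1)"
  show thesis
  proof (rule that[of \<rho>])
    fix x \<xi> :: "real^'n" assume \<xi>: "norm \<xi> \<le> R"
    define f where "f p = \<xi> \<bullet> p - H x p" for p
    have df: "(f has_derivative (\<lambda>u. (\<xi> - gHp x p) \<bullet> u)) (at p)" for p
      unfolding f_def by (auto intro!: derivative_eq_intros H_has_derivative_p simp: inner_diff_left)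
    have "continuous_on (cball 0 \<rho>) f"
      by (intro has_derivative_continuous_on) (rule has_derivative_at_withinI[OF df])
    moreover have "\<rho> > 0" using B(1) by (simp add: \<rho>_def)
    ultimately obtain p where p: "p \<in> cball 0 \<rho>" "\<And>q. q \<in> cball 0 \<rho> \<Longrightarrow> f q \<le> f p"
      using continuous_attains_sup[of "cball 0 \<rho>" f] by auto
    have out: "f q < f 0" if q: "norm q \<ge> \<rho>" for q
    proof -
      have "\<xi> \<bullet> q \<le> R * norm q"
        using norm_cauchy_schwarz[of \<xi> q] mult_right_mono[OF \<xi> norm_ge_zero[of q]] by linarith
      moreover have "H x q \<ge> (R + 1) * norm q" using q by (intro R1) (simp add: \<rho>_def)
      ultimately have "f q \<le> - norm q" by (simp add: f_def algebra_simps)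
      also have "\<dots> < - B" using q by (simp add: \<rho>_def)
      also have "\<dots> \<le> f 0" using B(2)[of 0 x] by (simp add: f_def)
      finally show ?thesis .
    qed
    have "f 0 \<le> f p" using \<open>\<rho> > 0\<close> by (intro p(2)) auto
    then have "norm p < \<rho>" using out[of p] by (meson leI not_less)
    then have "(\<lambda>u. (\<xi> - gHp x p) \<bullet> u) = (\<lambda>v. 0)"
      using p(2) by (intro differential_zero_maxmin[of p "ball 0 \<rho>" f]) (auto intro: df)
    then have "(\<xi> - gHp x p) \<bullet> (\<xi> - gHp x p) = 0" by meson
    then have "gHp x p = \<xi>" by simp
    then show "\<exists>p. norm p \<le> \<rho> \<and> gHp x p = \<xi>" using p(1) by auto
  qed
qed

text \<open>By convexity the solution of \<open>gHp x p = \<xi>\<close> is the maximizer in the Legendre transform.\<close>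
definition pm :: "real^'n \<Rightarrow> real^'n \<Rightarrow> real^'n" where
  "pm x \<xi> = (SOME p. gHp x p = \<xi>)"

lemma gHp_pm [simp]: "gHp x (pm x \<xi>) = \<xi>"
  unfolding pm_def by (rule someI_ex) (metis gHp_surj_bound order_refl)

lemma pm_gHp [simp]: "pm x (gHp x p) = p"
  by (rule gHp_inj[of x]) simp

lemma lagrangian_eq: "lagrangian H x \<xi> = \<xi> \<bullet> pm x \<xi> - H x (pm x \<xi>)"
  unfolding lagrangian_def
proof (rule cSup_eq_maximum)
  fix t assume "t \<in> range (\<lambda>p. \<xi> \<bullet> p - H x p)"
  then obtain p where "t = \<xi> \<bullet> p - H x p" by blast
  then show "t \<le> \<xi> \<bullet> pm x \<xi> - H x (pm x \<xi>)" using H_convex[of x "pm x \<xi>" p] by (simp add: inner_diff_right)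
qed auto

lemma Fenchel: "\<xi> \<bullet> p - H x p \<le> lagrangian H x \<xi>"
  using H_convex[of x "pm x \<xi>" p] by (simp add: lagrangian_eq inner_diff_right)

text \<open>Equality in Fenchel's inequality makes \<open>p\<close> a maximizer, so the gradient
  vanishes there. Velocities of calibrated curves are identified in this way.\<close>

lemma Fenchel_eq_imp:
  assumes "lagrangian H x \<xi> \<le> \<xi> \<bullet> p - H x p"
  shows "gHp x p = \<xi>"
proof -
  have "(\<lambda>u. (\<xi> - gHp x p) \<bullet> u) = (\<lambda>v. 0)"
  proof (rule differential_zero_maxmin[of p UNIV "\<lambda>p. \<xi> \<bullet> p - H x p"])
    show "((\<lambda>p. \<xi> \<bullet> p - H x p) has_derivative (\<lambda>u. (\<xi> - gHp x p) \<bullet> u)) (at p)"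
      by (auto intro!: derivative_eq_intros H_has_derivative_p simp: inner_diff_left)
    show "(\<forall>q\<in>UNIV. \<xi> \<bullet> q - H x q \<le> \<xi> \<bullet> p - H x p) \<or> (\<forall>q\<in>UNIV. \<xi> \<bullet> p - H x p \<le> \<xi> \<bullet> q - H x q)"
      using assms Fenchel[of \<xi> _ x] by (meson order_trans)
  qed auto
  then have "(\<xi> - gHp x p) \<bullet> (\<xi> - gHp x p) = 0" by meson
  then show ?thesis by simp
qed

lemma pm_bound:
  obtains \<rho> where "\<rho> \<ge> 0" "\<And>x \<xi>. norm \<xi> \<le> R \<Longrightarrow> norm (pm x \<xi>) \<le> \<rho>"
proof -
  obtain \<rho> where \<rho>: "\<And>x \<xi>. norm \<xi> \<le> R \<Longrightarrow> \<exists>p. norm p \<le> \<rho> \<and> gHp x p = \<xi>"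
    using gHp_surj_bound[of R] by blast
  show thesis
  proof (rule that[of "max \<rho> 0"])
    fix x \<xi> :: "real^'n" assume "norm \<xi> \<le> R"
    then obtain p where "norm p \<le> \<rho>" "gHp x p = \<xi>" using \<rho> by blast
    then show "norm (pm x \<xi>) \<le> max \<rho> 0" using pm_gHp[of x p] by simp
  qed simp
qed

text \<open>Strong monotonicity replaces an inverse function argument: moving from
  \<open>(x, \<xi>)\<close> to \<open>(y, \<eta>)\<close> changes the value to be matched by
  \<open>gHp\<close> by at most a multiple of the distance, and dividing by the monotonicity
  constant \<open>m\<close> bounds the change of momentum.\<close>

lemma pm_lipschitz:
  obtains K where "K \<ge> 0" "\<And>x y \<xi> \<eta>. norm \<xi> \<le> R \<Longrightarrow> norm \<eta> \<le> R \<Longrightarrow>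
    norm (pm y \<eta> - pm x \<xi>) \<le> K * (norm (y - x) + norm (\<eta> - \<xi>))"
proof -
  obtain \<rho> where \<rho>: "\<rho> \<ge> 0" "\<And>x \<xi>. norm \<xi> \<le> R \<Longrightarrow> norm (pm x \<xi>) \<le> \<rho>" using pm_bound[of R] by blast
  obtain m where m: "m > 0" "\<And>x p q. norm p \<le> \<rho> \<Longrightarrow> norm q \<le> \<rho> \<Longrightarrow>
      m * (norm (q - p))\<^sup>2 \<le> (gHp x q - gHp x p) \<bullet> (q - p)" using gHp_strong_mono[of \<rho>] by blast
  obtain B where B: "B \<ge> 0" "\<And>x y p q. norm p \<le> \<rho> \<Longrightarrow> norm q \<le> \<rho> \<Longrightarrow>
      norm (gHp x p - gHp y q) \<le> B * (norm (x - y) + norm (p - q))" using H_bounds[of \<rho>] by metis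
  show thesis
  proof (rule that[of "(1 + B) / m"])
    show "(1 + B) / m \<ge> 0" using B m by simp
    fix x y \<xi> \<eta> :: "real^'n" assume n: "norm \<xi> \<le> R" "norm \<eta> \<le> R"
    define p q where "p = pm x \<xi>" and "q = pm y \<eta>"
    have pq: "norm p \<le> \<rho>" "norm q \<le> \<rho>" "gHp x p = \<xi>" "gHp y q = \<eta>" using \<rho>(2) n by (auto simp: p_def q_def)
    define \<delta> where "\<delta> = norm (y - x) + norm (\<eta> - \<xi>)"
    have "m * (norm (q - p))\<^sup>2 \<le> (gHp x q - gHp x p) \<bullet> (q - p)" by (rule m(2)[OF pq(1,2)])
    also have "\<dots> \<le> norm (gHp x q - gHp x p) * norm (q - p)" by (rule norm_cauchy_schwarz)
    also have "\<dots> \<le> ((1 + B) * \<delta>) * norm (q - p)"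
    proof (rule mult_right_mono)
      have eq: "gHp x q - gHp x p = (gHp x q - gHp y q) + (\<eta> - \<xi>)" using pq by simp
      have "norm (gHp x q - gHp y q) \<le> B * norm (y - x)"
        using B(2)[OF pq(2) pq(2), of x y] by (simp add: norm_minus_commute)
      then have "norm (gHp x q - gHp x p) \<le> B * norm (y - x) + norm (\<eta> - \<xi>)"
        unfolding eq using norm_triangle_ineq[of "gHp x q - gHp y q" "\<eta> - \<xi>"] by linarith
      also have "\<dots> \<le> (1 + B) * \<delta>" using B(1) by (simp add: \<delta>_def algebra_simps)
      finally show "norm (gHp x q - gHp x p) \<le> (1 + B) * \<delta>" .
    qed simp
    finally have "m * norm (q - p) * norm (q - p) \<le> ((1 + B) * \<delta>) * norm (q - p)"
      by (simp add: power2_eq_square mult.assoc)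
    moreover have "0 \<le> (1 + B) * \<delta>" using B by (simp add: \<delta>_def)
    ultimately have "m * norm (q - p) \<le> (1 + B) * \<delta>"
      using mult_right_le_imp_le[of "m * norm (q - p)" "norm (q - p)" "(1 + B) * \<delta>"]
      by (cases "q = p") auto
    then show "norm (pm y \<eta> - pm x \<xi>) \<le> (1 + B) / m * (norm (y - x) + norm (\<eta> - \<xi>))"
      using m(1) unfolding p_def[symmetric] q_def[symmetric] \<delta>_def[symmetric]
      by (simp add: field_simps)
  qed
qed

text \<open>A first-order expansion of L with quadratic remainder. It identifies the gradients of L
  as \<open>pm\<close> in the velocity and minus \<open>gHx\<close> in the position, with a constant
  uniform in the position.\<close>

lemma lagrangian_quadratic:
  obtains K where "K \<ge> 0" "\<And>x y \<xi> \<eta>. norm \<xi> \<le> R \<Longrightarrow> norm \<eta> \<le> R \<Longrightarrow>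
    \<bar>lagrangian H y \<eta> - lagrangian H x \<xi> - (pm x \<xi> \<bullet> (\<eta> - \<xi>) - gHx x (pm x \<xi>) \<bullet> (y - x))\<bar>
      \<le> K * (norm (y - x) + norm (\<eta> - \<xi>))\<^sup>2"
proof -
  obtain \<rho> where \<rho>: "\<rho> \<ge> 0" "\<And>x \<xi>. norm \<xi> \<le> R \<Longrightarrow> norm (pm x \<xi>) \<le> \<rho>" using pm_bound[of R] by blast
  obtain B where B: "B \<ge> 0" "\<And>x y p q. norm p \<le> \<rho> \<Longrightarrow> norm q \<le> \<rho> \<Longrightarrow>
      norm (gHx x p - gHx y q) \<le> B * (norm (x - y) + norm (p - q))" using H_bounds[of \<rho>] by metis
  obtain K where K: "K \<ge> 0" "\<And>x y \<xi> \<eta>. norm \<xi> \<le> R \<Longrightarrow> norm \<eta> \<le> R \<Longrightarrow>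
    norm (pm y \<eta> - pm x \<xi>) \<le> K * (norm (y - x) + norm (\<eta> - \<xi>))" using pm_lipschitz[of R] by blast
  have incr: "\<bar>H y p' - H x p' - gHx x p \<bullet> (y - x)\<bar> \<le> B * (norm (y - x) + norm (p' - p)) * norm (y - x)"
    if "norm p \<le> \<rho>" "norm p' \<le> \<rho>" for x y p p'
  proof -
    obtain z where z: "norm (z - x) \<le> norm (y - x)" "H y p' - H x p' = gHx z p' \<bullet> (y - x)"
      using H_segment_mvt_x by blast
    have "H y p' - H x p' - gHx x p \<bullet> (y - x) = (gHx z p' - gHx x p) \<bullet> (y - x)"
      by (simp add: z inner_diff_left)
    then have "\<bar>H y p' - H x p' - gHx x p \<bullet> (y - x)\<bar> \<le> norm (gHx z p' - gHx x p) * norm (y - x)"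
      by (simp add: Cauchy_Schwarz_ineq2)
    also have "\<dots> \<le> B * (norm (z - x) + norm (p' - p)) * norm (y - x)"
      using B(2)[OF that(2,1)] by (intro mult_right_mono) auto
    also have "\<dots> \<le> B * (norm (y - x) + norm (p' - p)) * norm (y - x)"
      using B(1) z(1) by (intro mult_right_mono mult_left_mono) auto
    finally show ?thesis .
  qed
  show thesis
  proof (rule that[of "K + B + B * K"])
    show "K + B + B * K \<ge> 0" using K B by simp
    fix x y \<xi> \<eta> :: "real^'n" assume n: "norm \<xi> \<le> R" "norm \<eta> \<le> R"
    define p q where "p = pm x \<xi>" and "q = pm y \<eta>"
    have pq: "norm p \<le> \<rho>" "norm q \<le> \<rho>" using \<rho>(2) n by (auto simp: p_def q_def)
    define \<delta> where "\<delta> = norm (y - x) + norm (\<eta> - \<xi>)"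
    have \<delta>: "0 \<le> \<delta>" "norm (y - x) \<le> \<delta>" "norm (\<eta> - \<xi>) \<le> \<delta>" by (auto simp: \<delta>_def)
    have qp: "norm (q - p) \<le> K * \<delta>" using K(2)[OF n, of y x] by (simp add: p_def q_def \<delta>_def)
    have "0 \<le> B * K * \<delta>\<^sup>2" "0 \<le> K * \<delta>\<^sup>2" using B K by auto
    have L1: "lagrangian H x \<xi> = \<xi> \<bullet> p - H x p" by (simp add: lagrangian_eq p_def)
    have L2: "lagrangian H y \<eta> = \<eta> \<bullet> q - H y q" by (simp add: lagrangian_eq q_def)
    \<comment> \<open>The momentum \<open>q\<close> of the second point serves as test momentum at
      the first point; replacing it by \<open>p\<close> in the linear terms costs the Lipschitz
      constant of \<open>pm\<close>.\<close>
    have up: "lagrangian H y \<eta> - lagrangian H x \<xi> - (p \<bullet> (\<eta> - \<xi>) - gHx x p \<bullet> (y - x)) \<le> (K + B + B * K) * \<delta>\<^sup>2"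
    proof -
      have 1: "(q - p) \<bullet> (\<eta> - \<xi>) \<le> K * \<delta> * \<delta>"
        using norm_cauchy_schwarz[of "q - p" "\<eta> - \<xi>"] mult_mono[OF qp \<delta>(3)] K(1) \<delta>(1)
        by (smt (verit) mult_nonneg_nonneg norm_ge_zero)
      have "B * (norm (y - x) + norm (q - p)) * norm (y - x) \<le> B * (\<delta> + K * \<delta>) * \<delta>"
        using B(1) \<delta> qp K(1) by (intro mult_mono mult_left_mono add_mono) auto
      then have 2: "- (H y q - H x q - gHx x p \<bullet> (y - x)) \<le> B * (\<delta> + K * \<delta>) * \<delta>"
        using incr[OF pq, of y x] by linarith
      have "lagrangian H y \<eta> - lagrangian H x \<xi> - (p \<bullet> (\<eta> - \<xi>) - gHx x p \<bullet> (y - x))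
          \<le> (q - p) \<bullet> (\<eta> - \<xi>) - (H y q - H x q - gHx x p \<bullet> (y - x))"
        using Fenchel[of \<xi> q x] unfolding L2 by (simp add: inner_diff_left inner_diff_right inner_commute)
      also have "\<dots> \<le> K * \<delta> * \<delta> + B * (\<delta> + K * \<delta>) * \<delta>" using 1 2 by linarith
      also have "\<dots> = (K + B + B * K) * \<delta>\<^sup>2" by (simp add: algebra_simps power2_eq_square)
      finally show ?thesis .
    qed
    \<comment> \<open>Here \<open>p\<close> is the test momentum at the second point, so both
      Hamiltonians carry the same momentum and only their variation in the position remains.\<close>
    have low: "- ((K + B + B * K) * \<delta>\<^sup>2) \<le> lagrangian H y \<eta> - lagrangian H x \<xi> - (p \<bullet> (\<eta> - \<xi>) - gHx x p \<bullet> (y - x))"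
    proof -
      have "B * (norm (y - x) + norm (p - p)) * norm (y - x) \<le> B * \<delta> * \<delta>"
        using B(1) \<delta> by (intro mult_mono mult_left_mono) auto
      then have "H y p - H x p - gHx x p \<bullet> (y - x) \<le> B * \<delta>\<^sup>2"
        using incr[OF pq(1,1), of y x] by (simp add: power2_eq_square)
      moreover have "\<eta> \<bullet> p - H y p \<le> lagrangian H y \<eta>" by (rule Fenchel)
      ultimately have "- (B * \<delta>\<^sup>2) \<le> lagrangian H y \<eta> - lagrangian H x \<xi> - (p \<bullet> (\<eta> - \<xi>) - gHx x p \<bullet> (y - x))"
        unfolding L1 by (simp add: inner_diff_left inner_diff_right inner_commute)
      moreover have "B * \<delta>\<^sup>2 \<le> (K + B + B * K) * \<delta>\<^sup>2"
        using \<open>0 \<le> B * K * \<delta>\<^sup>2\<close> \<open>0 \<le> K * \<delta>\<^sup>2\<close> by (simp add: algebra_simps)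
      ultimately show ?thesis by linarith
    qed
    show "\<bar>lagrangian H y \<eta> - lagrangian H x \<xi> - (pm x \<xi> \<bullet> (\<eta> - \<xi>) - gHx x (pm x \<xi>) \<bullet> (y - x))\<bar>
      \<le> (K + B + B * K) * (norm (y - x) + norm (\<eta> - \<xi>))\<^sup>2"
      using up low unfolding p_def \<delta>_def by linarith
  qed
qed

lemma Lxi_eq: "Lxi H x \<xi> = pm x \<xi>"
proof -
  obtain K where K: "K \<ge> 0" "\<And>x y \<xi>' \<eta>. norm \<xi>' \<le> norm \<xi> + 1 \<Longrightarrow> norm \<eta> \<le> norm \<xi> + 1 \<Longrightarrow>
    \<bar>lagrangian H y \<eta> - lagrangian H x \<xi>' - (pm x \<xi>' \<bullet> (\<eta> - \<xi>') - gHx x (pm x \<xi>') \<bullet> (y - x))\<bar>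
      \<le> K * (norm (y - x) + norm (\<eta> - \<xi>'))\<^sup>2" using lagrangian_quadratic[of "norm \<xi> + 1"] by blast
  have "\<bar>lagrangian H x (\<xi> + u) - lagrangian H x \<xi> - pm x \<xi> \<bullet> u\<bar> \<le> K * (norm u)\<^sup>2" if "norm u \<le> 1" for u
    using K(2)[of \<xi> "\<xi> + u" x x] norm_triangle_ineq[of \<xi> u] that by simp
  then show ?thesis unfolding Lxi_def by (intro grad_eqI has_derivative_of_quadratic_bound)
qed

lemma Lx_eq: "Lx H x \<xi> = - gHx x (pm x \<xi>)"
proof -
  obtain K where K: "K \<ge> 0" "\<And>x y \<xi>' \<eta>. norm \<xi>' \<le> norm \<xi> \<Longrightarrow> norm \<eta> \<le> norm \<xi> \<Longrightarrow>
    \<bar>lagrangian H y \<eta> - lagrangian H x \<xi>' - (pm x \<xi>' \<bullet> (\<eta> - \<xi>') - gHx x (pm x \<xi>') \<bullet> (y - x))\<bar>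
      \<le> K * (norm (y - x) + norm (\<eta> - \<xi>'))\<^sup>2" using lagrangian_quadratic[of "norm \<xi>"] by blast
  have "\<bar>lagrangian H (x + u) \<xi> - lagrangian H x \<xi> - (- gHx x (pm x \<xi>)) \<bullet> u\<bar> \<le> K * (norm u)\<^sup>2" for u
    using K(2)[of \<xi> \<xi> "x + u" x] by simp
  then show ?thesis unfolding Lx_def by (intro grad_eqI has_derivative_of_quadratic_bound)
qed

lemma pm_continuous: "continuous_on UNIV (\<lambda>z. pm (fst z) (snd z))"
  unfolding continuous_on_iff
proof (intro ballI allI impI)
  fix z :: "(real^'n) \<times> (real^'n)" and e :: real assume e: "e > 0"
  obtain K where K: "K \<ge> 0" "\<And>x y \<xi> \<eta>. norm \<xi> \<le> norm (snd z) + 1 \<Longrightarrow> norm \<eta> \<le> norm (snd z) + 1 \<Longrightarrow>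
    norm (pm y \<eta> - pm x \<xi>) \<le> K * (norm (y - x) + norm (\<eta> - \<xi>))" using pm_lipschitz[of "norm (snd z) + 1"] by blast
  define d where "d = min 1 (e / (2 * K + 1))"
  have "d > 0" "2 * K * d < e"
  proof -
    show "d > 0" using e K(1) by (simp add: d_def)
    have "2 * K * d \<le> 2 * K * (e / (2 * K + 1))" using K(1) by (intro mult_left_mono) (auto simp: d_def)
    also have "\<dots> < e" using e K(1) by (simp add: field_simps)
    finally show "2 * K * d < e" .
  qed
  show "\<exists>d>0. \<forall>y\<in>UNIV. dist y z < d \<longrightarrow> dist (pm (fst y) (snd y)) (pm (fst z) (snd z)) < e"
  proof (intro exI[of _ d] conjI ballI impI \<open>d > 0\<close>)
    fix y assume "dist y z < d"
    then have 1: "norm (fst y - fst z) < d" "norm (snd y - snd z) < d"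
      using dist_fst_le[of y z] dist_snd_le[of y z] by (auto simp: dist_norm)
    then have "norm (snd y) \<le> norm (snd z) + 1"
      using norm_triangle_ineq2[of "snd y" "snd z"] by (simp add: d_def)
    then have "norm (pm (fst y) (snd y) - pm (fst z) (snd z)) \<le> K * (norm (fst y - fst z) + norm (snd y - snd z))"
      by (intro K(2)) auto
    also have "\<dots> \<le> K * (d + d)" using 1 K(1) by (intro mult_left_mono add_mono) auto
    also have "\<dots> < e" using \<open>2 * K * d < e\<close> by simp
    finally show "dist (pm (fst y) (snd y)) (pm (fst z) (snd z)) < e" by (simp add: dist_norm)
  qed
qed

lemma lagrangian_continuous: "continuous_on UNIV (\<lambda>z. lagrangian H (fst z) (snd z))"
proof -
  have "continuous_on UNIV (\<lambda>z. H (fst (fst z, pm (fst z) (snd z))) (snd (fst z, pm (fst z) (snd z))))"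
    by (intro continuous_on_compose2[OF H_continuous] continuous_intros pm_continuous) auto
  then show ?thesis
    unfolding lagrangian_eq by (auto intro!: continuous_intros pm_continuous)
qed

end

section \<open>Calibrated curves\<close>

lemma has_vector_derivative_translate:
  fixes f :: "real \<Rightarrow> 'a::real_normed_vector"
  shows "((\<lambda>s. f (s + b)) has_vector_derivative y) (at s) \<longleftrightarrow> (f has_vector_derivative y) (at (s + b))"
proof -
  have *: "((\<lambda>s. g (s + d)) has_vector_derivative y) (at s)" if "(g has_vector_derivative y) (at (s + d))"
    for g :: "real \<Rightarrow> 'a" and d s
  proof -
    have "((\<lambda>s. s + d) has_vector_derivative 1) (at s)" by (auto intro!: derivative_eq_intros)
    from vector_diff_chain_at[OF this that] show ?thesis by (simp add: o_def)
  qed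
  show ?thesis using *[of f s b] *[of "\<lambda>s. f (s + b)" "s + b" "- b"] by auto
qed

lemma vector_derivative_translate:
  fixes f :: "real \<Rightarrow> 'a::real_normed_vector"
  shows "vector_derivative (\<lambda>s. f (s + b)) (at s) = vector_derivative f (at (s + b))"
  unfolding vector_derivative_def has_vector_derivative_translate ..

lemma has_integral_translate:
  fixes f :: "real \<Rightarrow> 'a::banach"
  assumes "(f has_integral i) {a..b}"
  shows "((\<lambda>s. f (s + d)) has_integral i) {a - d..b - d}"
proof -
  have "(\<lambda>x. x + - d) ` {a..b} = {a - d..b - d}"
    using image_add_atLeastAtMost'[of "- d" a b] by simp
  then show ?thesis
    using has_integral_affinity[of f i a b 1 d] assms by simp
qed

lemma absolutely_integrable_translate:
  fixes f :: "real \<Rightarrow> real"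
  assumes "f absolutely_integrable_on {a..b}"
  shows "(\<lambda>s. f (s + d)) absolutely_integrable_on {a - d..b - d}"
  using assms has_integral_translate[of f _ a b d] has_integral_translate[of "\<lambda>x. norm (f x)" _ a b d]
  unfolding absolutely_integrable_on_def integrable_on_def by blast

lemma abs_cont_on_translate:
  assumes "abs_cont_on \<gamma> a b"
  shows "abs_cont_on (\<lambda>s. \<gamma> (s + d)) (a - d) (b - d)"
  unfolding abs_cont_on_alt
proof (intro allI impI)
  fix \<epsilon> :: real assume "\<epsilon> > 0"
  then obtain \<delta> where \<delta>: "\<delta> > 0" "\<And>n u w. interval_family a b n u w \<Longrightarrow> (\<Sum>i<n. w i - u i) < \<delta>
      \<Longrightarrow> (\<Sum>i<n. norm (\<gamma> (w i) - \<gamma> (u i))) < \<epsilon>"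
    using assms unfolding abs_cont_on_alt by meson
  have "(\<Sum>i<n. norm (\<gamma> (w i + d) - \<gamma> (u i + d))) < \<epsilon>"
    if "interval_family (a - d) (b - d) n u w" "(\<Sum>i<n. w i - u i) < \<delta>" for n u w
    using \<delta>(2)[of n "\<lambda>i. u i + d" "\<lambda>i. w i + d"] that
      interval_family_map[OF that(1), of "\<lambda>t. t + d" a b] by (auto simp: mono_def)
  with \<delta>(1) show "\<exists>\<delta>>0. \<forall>n u w. interval_family (a - d) (b - d) n u w \<and> (\<Sum>i<n. w i - u i) < \<delta> \<longrightarrow>
      (\<Sum>i<n. norm (\<gamma> (w i + d) - \<gamma> (u i + d))) < \<epsilon>" by blast
qed

lemma lipschitz_vector_derivative_bound:
  fixes \<gamma> :: "real \<Rightarrow> 'a::real_normed_vector"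
  assumes lip: "M-lipschitz_on {a..b} \<gamma>" and t: "a < t" "t < b" and d: "(\<gamma> has_vector_derivative \<xi>) (at t)"
  shows "norm \<xi> \<le> M"
proof (rule field_le_epsilon)
  fix e :: real assume e: "e > 0"
  have "(\<gamma> has_derivative (\<lambda>h. h *\<^sub>R \<xi>)) (at t)" using d by (simp add: has_vector_derivative_def)
  then obtain r where r: "r > 0" "\<And>y. \<bar>y - t\<bar> < r \<Longrightarrow> norm (\<gamma> y - \<gamma> t - (y - t) *\<^sub>R \<xi>) \<le> e * \<bar>y - t\<bar>"
    using e unfolding has_derivative_at_alt by (metis real_norm_def)
  define y where "y = t + min (r / 2) (b - t)"
  have y: "t < y" "y \<le> b" "\<bar>y - t\<bar> < r" using r t by (auto simp: y_def)
  have "(y - t) * norm \<xi> = norm ((\<gamma> y - \<gamma> t) - (\<gamma> y - \<gamma> t - (y - t) *\<^sub>R \<xi>))" using y by simp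
  also have "\<dots> \<le> norm (\<gamma> y - \<gamma> t) + norm (\<gamma> y - \<gamma> t - (y - t) *\<^sub>R \<xi>)" by (rule norm_triangle_ineq4)
  also have "\<dots> \<le> M * (y - t) + e * (y - t)"
    using lipschitz_onD[OF lip, of y t] r(2)[OF y(3)] y t by (auto simp: dist_norm)
  also have "\<dots> = (y - t) * (M + e)" by (simp add: algebra_simps)
  finally show "norm \<xi> \<le> M + e" using y by simp
qed

text \<open>Position and velocity of a Lipschitz curve stay in a compact set, so a continuous
  \<open>G\<close> is bounded along it. The time argument of \<open>G\<close> is there for the first
  variation, whose coefficients depend on time.\<close>

lemma lipschitz_curve_absolutely_integrable:
  fixes \<gamma> :: "real \<Rightarrow> 'a::euclidean_space" and G :: "real \<times> 'a \<times> 'a \<Rightarrow> 'b::euclidean_space"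
  assumes lip: "M-lipschitz_on {a..b} \<gamma>" and G: "continuous_on UNIV G"
  shows "(\<lambda>s. G (s, \<gamma> s, vector_derivative \<gamma> (at s))) absolutely_integrable_on {a..b}"
proof (cases "a \<le> b")
  case False
  then show ?thesis by simp
next
  case ab: True
  define N where "N = {x \<in> {a..b}. \<not> \<gamma> differentiable (at x)} \<union> {a, b}"
  have ac: "abs_cont_on \<gamma> a b" by (rule lipschitz_imp_abs_cont_on[OF lip])
  have N: "negligible N" unfolding N_def by (intro negligible_Un abs_cont_on_differentiable_ae[OF ac]) simp
  \<comment> \<open>\<open>vector_derivative\<close> is unspecified where the derivative does not
    exist; the value 0 keeps \<open>w\<close> bounded by \<open>M\<close>. The end points belong to
    \<open>N\<close> because the speed bound is proved at interior times.\<close>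
  define w where "w s = (if s \<in> N then 0 else vector_derivative \<gamma> (at s))" for s
  have "(w has_integral \<gamma> b - \<gamma> a) {a..b}"
    by (rule has_integral_spike[OF N _ abs_cont_on_has_integral_derivative[OF ac ab]]) (auto simp: w_def)
  \<comment> \<open>Measurability of the derivative is read off from its integrability, which the
    fundamental theorem supplied.\<close>
  then have mw: "w \<in> borel_measurable (lebesgue_on {a..b})"
    by (intro integrable_imp_measurable) auto
  have wb: "norm (w s) \<le> M" if "s \<in> {a..b}" for s
  proof (cases "s \<in> N")
    case True
    then show ?thesis using lipschitz_on_nonneg[OF lip] by (simp add: w_def)
  next
    case False
    then have "a < s" "s < b" "\<gamma> differentiable (at s)" using that by (auto simp: N_def)
    then show ?thesis using lipschitz_vector_derivative_bound[OF lip] False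
      by (simp add: w_def vector_derivative_works)
  qed
  have mg: "\<gamma> \<in> borel_measurable (lebesgue_on {a..b})"
    using lipschitz_on_continuous_on[OF lip] by (intro continuous_imp_measurable_on_sets_lebesgue) auto
  have mid: "(\<lambda>s::real. s) \<in> borel_measurable (lebesgue_on {a..b})"
    by (intro continuous_imp_measurable_on_sets_lebesgue) auto
  have "(\<lambda>s. G (s, \<gamma> s, w s)) \<in> borel_measurable (lebesgue_on {a..b})"
    by (rule borel_measurable_continuous_on[OF G]) (intro borel_measurable_Pair mid mg mw)
  moreover have "\<exists>B. \<forall>s\<in>{a..b}. norm (G (s, \<gamma> s, w s)) \<le> B"
  proof -
    have "compact (\<gamma> ` {a..b})"
      using lipschitz_on_continuous_on[OF lip] by (rule compact_continuous_image) simp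
    then have "compact (G ` ({a..b} \<times> \<gamma> ` {a..b} \<times> cball 0 M))"
      by (intro compact_continuous_image[OF continuous_on_subset[OF G]] compact_Times) auto
    then obtain B where B: "\<And>z. z \<in> G ` ({a..b} \<times> \<gamma> ` {a..b} \<times> cball 0 M) \<Longrightarrow> norm z \<le> B"
      using compact_imp_bounded bounded_iff by metis
    have "norm (G (s, \<gamma> s, w s)) \<le> B" if "s \<in> {a..b}" for s
      using that wb[OF that] by (intro B imageI) auto
    then show ?thesis by blast
  qed
  then obtain B where "\<And>s. s \<in> {a..b} \<Longrightarrow> norm (G (s, \<gamma> s, w s)) \<le> B" by blast
  ultimately have "(\<lambda>s. G (s, \<gamma> s, w s)) absolutely_integrable_on {a..b}"
    by (intro measurable_bounded_by_integrable_imp_absolutely_integrable[where g = "\<lambda>_. B"]) auto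
  then show ?thesis
    by (rule absolutely_integrable_spike[OF _ N]) (auto simp: w_def)
qed

section \<open>Solutions dominated by the action, and almost calibrated curves\<close>

locale weak_kam = tonelli H D D2
  for H :: "real^'n \<Rightarrow> real^'n \<Rightarrow> real" and D D2 +
  fixes c :: "real^'n" and h :: real and v :: "real^'n \<Rightarrow> real" and C :: real
  assumes visc: "viscosity_solution H c h v"
    and v_lip: "C-lipschitz_on UNIV v"
    and repr: "representation_formula H c h v"
begin

abbreviation ai :: "(real \<Rightarrow> real^'n) \<Rightarrow> real \<Rightarrow> real" where
  "ai \<equiv> action_integrand H c h"

lemma C_nonneg: "C \<ge> 0" by (rule lipschitz_on_nonneg[OF v_lip])

lemma v_lipD: "\<bar>v x - v y\<bar> \<le> C * norm (x - y)"
  using lipschitz_onD[OF v_lip, of x y] by (simp add: dist_norm)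

lemma v_continuous: "continuous_on UNIV v" by (rule lipschitz_on_continuous_on[OF v_lip])

lemma v_per: "k \<in> lattice \<Longrightarrow> v (x + k) = v x"
  using visc unfolding viscosity_solution_def periodic_def by blast

lemma v_per_minus: "k \<in> lattice \<Longrightarrow> v (x - k) = v x"
  using v_per[of "- k" x] lattice_minus[of k] by simp

lemma H_per_minus: "k \<in> lattice \<Longrightarrow> H (x - k) p = H x p"
  using per[of "- k" x] lattice_minus[of k] by simp

lemma v_bounded: obtains B where "\<And>x. \<bar>v x\<bar> \<le> B"
proof -
  obtain B where "B \<ge> 0" "\<And>x p. norm p \<le> 0 \<Longrightarrow> norm (v (fst (x, p))) \<le> B"
    by (rule periodic_bounded[of "\<lambda>z. v (fst z)" 0])
      (auto intro!: continuous_on_compose2[OF v_continuous] continuous_intros simp: v_per)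
  then show thesis using that[of B] by (metis fst_conv norm_zero order_refl real_norm_def)
qed

lemma ai_ge: "(p - c) \<bullet> vector_derivative \<gamma> (at s) - H (\<gamma> s) p + h \<le> ai \<gamma> s"
  using Fenchel[of "vector_derivative \<gamma> (at s)" p "\<gamma> s"]
  by (simp add: action_integrand_def inner_diff_left inner_commute)

text \<open>Fenchel's bound with a fixed \<open>p\<close> is affine in the velocity, so after
  integration it only sees the end points. All inequalities in \<open>acal\<close> arise from this
  one.\<close>

lemma action_lower_bound:
  assumes ac: "abs_cont_on \<gamma> a b" and ab: "a \<le> b" and int: "ai \<gamma> integrable_on {a..b}"
    and B: "\<And>s. s \<in> {a..b} \<Longrightarrow> H (\<gamma> s) p \<le> B"
  shows "(p - c) \<bullet> (\<gamma> b - \<gamma> a) + (h - B) * (b - a) \<le> integral {a..b} (ai \<gamma>)"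
proof (rule has_integral_le)
  have "((\<lambda>s. (p - c) \<bullet> vector_derivative \<gamma> (at s)) has_integral (p - c) \<bullet> (\<gamma> b - \<gamma> a)) {a..b}"
    using has_integral_linear[OF abs_cont_on_has_integral_derivative[OF ac ab] bounded_linear_inner_right[of "p - c"]]
    by (simp add: o_def)
  moreover have "((\<lambda>s. h - B) has_integral (h - B) * (b - a)) {a..b}"
    using has_integral_const_real[of "h - B" a b] ab by (simp add: mult.commute)
  ultimately show "((\<lambda>s. (p - c) \<bullet> vector_derivative \<gamma> (at s) + (h - B)) has_integral
      (p - c) \<bullet> (\<gamma> b - \<gamma> a) + (h - B) * (b - a)) {a..b}" by (rule has_integral_add)
  show "(ai \<gamma> has_integral integral {a..b} (ai \<gamma>)) {a..b}" using int by (rule integrable_integral)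
  show "(p - c) \<bullet> vector_derivative \<gamma> (at s) + (h - B) \<le> ai \<gamma> s" if "s \<in> {a..b}" for s
    using ai_ge[of p \<gamma> s] B[OF that] by simp
qed

text \<open>An \<open>INF\<close> of reals is a lower bound only when the set is bounded below. The
  momentum \<open>p = c\<close> makes the end point term disappear and leaves a bound independent of
  the curve.\<close>

lemma action_values_bdd_below:
  assumes "T > 0"
  shows "bdd_below ((\<lambda>\<gamma>. action H c h T \<gamma> + v (\<gamma> (- T))) ` {\<gamma>. admissible H c h T \<gamma> \<and> \<gamma> 0 = x})"
proof -
  obtain B where B: "\<And>x. \<bar>v x\<bar> \<le> B" using v_bounded by blast
  obtain B' where B': "B' \<ge> 0" "\<And>x p. norm p \<le> norm c \<Longrightarrow> \<bar>H x p\<bar> \<le> B'" using H_bounds[of "norm c"] by metis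
  show ?thesis
  proof (rule bdd_belowI2[of _ "(h - B') * T - B"])
    fix \<gamma> assume "\<gamma> \<in> {\<gamma>. admissible H c h T \<gamma> \<and> \<gamma> 0 = x}"
    then have a: "abs_cont_on \<gamma> (- T) 0" "ai \<gamma> absolutely_integrable_on {- T..0}"
      by (auto simp: admissible_def)
    have "(c - c) \<bullet> (\<gamma> 0 - \<gamma> (- T)) + (h - B') * (0 - - T) \<le> integral {- T..0} (ai \<gamma>)"
      using a assms B'(2)[OF order_refl]
      by (intro action_lower_bound) (auto simp: absolutely_integrable_on_def abs_le_iff)
    then show "(h - B') * T - B \<le> action H c h T \<gamma> + v (\<gamma> (- T))"
      using B[of "\<gamma> (- T)"] by (simp add: action_def)
  qed
qed

text \<open>The representation formula speaks of intervals ending at time 0; shifting time by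
  \<open>b\<close> carries the curve there, and being one competitor in the infimum it yields the
  inequality.\<close>

lemma domination:
  assumes ac: "abs_cont_on \<gamma> a b" and ab: "a \<le> b" and int: "ai \<gamma> absolutely_integrable_on {a..b}"
  shows "v (\<gamma> b) - v (\<gamma> a) \<le> integral {a..b} (ai \<gamma>)"
proof (cases "a = b")
  case True
  then show ?thesis by simp
next
  case False
  define T where "T = b - a"
  define g where "g = (\<lambda>s. \<gamma> (s + b))"
  have T: "T > 0" using False ab by (simp add: T_def)
  have aig: "ai g = (\<lambda>s. ai \<gamma> (s + b))"
    by (auto simp: action_integrand_def g_def vector_derivative_translate)
  have "abs_cont_on g (- T) 0" using abs_cont_on_translate[OF ac, of b] by (simp add: g_def T_def)
  moreover have "ai g absolutely_integrable_on {- T..0}"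
    unfolding aig using absolutely_integrable_translate[OF int, of b] by (simp add: T_def)
  ultimately have adm: "g \<in> {\<gamma>'. admissible H c h T \<gamma>' \<and> \<gamma>' 0 = \<gamma> b}"
    by (simp add: admissible_def g_def)
  have "(ai \<gamma> has_integral integral {a..b} (ai \<gamma>)) {a..b}"
    using int by (auto simp: absolutely_integrable_on_def intro: integrable_integral)
  from has_integral_translate[OF this, of b]
  have act: "action H c h T g = integral {a..b} (ai \<gamma>)"
    unfolding action_def aig by (auto simp: T_def intro!: integral_unique)
  have "v (\<gamma> b) \<le> action H c h T g + v (g (- T))"
    using repr T cINF_lower[OF action_values_bdd_below[OF T] adm]
    unfolding representation_formula_def by simp
  then show ?thesis using act by (simp add: g_def T_def)
qed

text \<open>This constant bounds the speed of calibrated curves.\<close>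
definition C0 :: real where
  "C0 = (SOME B. B \<ge> 0 \<and> (\<forall>x p. norm p \<le> norm c + C + 1 \<longrightarrow> H x p - h \<le> B))"

text \<open>The Lipschitz constant of H in the position depends on the momentum; as a function of
  \<open>p\<close> it can be mentioned inside \<open>acal\<close>, which quantifies over all
  momenta.\<close>

definition MH :: "real^'n \<Rightarrow> real" where
  "MH p = (SOME B. B \<ge> 0 \<and> (\<forall>x y. \<bar>H x p - H y p\<bar> \<le> B * norm (x - y)))"

lemma C0: "C0 \<ge> 0" "norm p \<le> norm c + C + 1 \<Longrightarrow> H x p - h \<le> C0"
proof -
  obtain B where B: "B \<ge> 0" "\<And>x p. norm p \<le> norm c + C + 1 \<Longrightarrow> \<bar>H x p\<bar> \<le> B"
    using H_bounds[of "norm c + C + 1"] by metis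
  have "B + \<bar>h\<bar> \<ge> 0 \<and> (\<forall>x p. norm p \<le> norm c + C + 1 \<longrightarrow> H x p - h \<le> B + \<bar>h\<bar>)"
    using B by (auto simp: abs_le_iff) (smt (verit) B(2))
  from someI[where P = "\<lambda>B. B \<ge> 0 \<and> (\<forall>x p. norm p \<le> norm c + C + 1 \<longrightarrow> H x p - h \<le> B)", OF this]
  show "C0 \<ge> 0" "norm p \<le> norm c + C + 1 \<Longrightarrow> H x p - h \<le> C0"
    unfolding C0_def by auto
qed

lemma MH: "MH p \<ge> 0" "\<bar>H x p - H y p\<bar> \<le> MH p * norm (x - y)"
proof -
  obtain B where B: "B \<ge> 0" "\<And>x y q. norm q \<le> norm p \<Longrightarrow> \<bar>H x q - H y q\<bar> \<le> B * norm (x - y)"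
    using H_bounds[of "norm p"] by metis
  then have "B \<ge> 0 \<and> (\<forall>x y. \<bar>H x p - H y p\<bar> \<le> B * norm (x - y))" by simp
  from someI[where P = "\<lambda>B. B \<ge> 0 \<and> (\<forall>x y. \<bar>H x p - H y p\<bar> \<le> B * norm (x - y))", OF this]
  show "MH p \<ge> 0" "\<bar>H x p - H y p\<bar> \<le> MH p * norm (x - y)" unfolding MH_def by auto
qed

text \<open>Almost calibrated curves, formulated without derivatives or integrals so that the notion is
  closed under pointwise limits: by duality, the lower bounds indexed by \<open>p\<close> recover the
  Lagrangian action in the limit of short intervals.\<close>

definition acal :: "real \<Rightarrow> real set \<Rightarrow> (real \<Rightarrow> real^'n) \<Rightarrow> bool" where
  "acal \<epsilon> S \<gamma> \<longleftrightarrow> (\<forall>a\<in>S. \<forall>b\<in>S. a \<le> b \<longrightarrow> norm (\<gamma> b - \<gamma> a) \<le> C0 * (b - a) + \<epsilon> \<and>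
     (\<forall>p. (p - c) \<bullet> (\<gamma> b - \<gamma> a) - (b - a) * (H (\<gamma> a) p - h + MH p * (C0 * (b - a) + \<epsilon>)) - \<epsilon>
        \<le> v (\<gamma> b) - v (\<gamma> a)))"

lemma acalD:
  assumes "acal \<epsilon> S \<gamma>" "a \<in> S" "b \<in> S" "a \<le> b"
  shows "norm (\<gamma> b - \<gamma> a) \<le> C0 * (b - a) + \<epsilon>"
    "(p - c) \<bullet> (\<gamma> b - \<gamma> a) - (b - a) * (H (\<gamma> a) p - h + MH p * (C0 * (b - a) + \<epsilon>)) - \<epsilon>
        \<le> v (\<gamma> b) - v (\<gamma> a)"
  using assms unfolding acal_def by auto

lemma acal_dist:
  assumes "acal \<epsilon> S \<gamma>" "a \<in> S" "b \<in> S"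
  shows "norm (\<gamma> b - \<gamma> a) \<le> C0 * \<bar>b - a\<bar> + \<epsilon>"
  using acalD(1)[OF assms(1), of a b] acalD(1)[OF assms(1), of b a] assms(2,3)
  by (cases "a \<le> b") (auto simp: norm_minus_commute)

lemma acal_translate:
  assumes "acal \<epsilon> S \<gamma>" "k \<in> lattice"
  shows "acal \<epsilon> {s. s + \<tau> \<in> S} (\<lambda>s. \<gamma> (s + \<tau>) - k)"
  unfolding acal_def
proof (intro ballI impI)
  fix a b assume "a \<in> {s. s + \<tau> \<in> S}" "b \<in> {s. s + \<tau> \<in> S}" "a \<le> b"
  then have "a + \<tau> \<in> S" "b + \<tau> \<in> S" "a + \<tau> \<le> b + \<tau>" by auto
  from acalD[OF assms(1) this] assms(2)
  show "norm (\<gamma> (b + \<tau>) - k - (\<gamma> (a + \<tau>) - k)) \<le> C0 * (b - a) + \<epsilon> \<and>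
     (\<forall>p. (p - c) \<bullet> (\<gamma> (b + \<tau>) - k - (\<gamma> (a + \<tau>) - k)) -
        (b - a) * (H (\<gamma> (a + \<tau>) - k) p - h + MH p * (C0 * (b - a) + \<epsilon>)) - \<epsilon>
        \<le> v (\<gamma> (b + \<tau>) - k) - v (\<gamma> (a + \<tau>) - k))"
    by (simp add: v_per_minus H_per_minus)
qed

text \<open>The lower bound for the action is used twice: with a momentum adapted to the
  displacement it gives the speed bound, and with an arbitrary momentum, once the speed is known,
  the remaining inequalities.\<close>

lemma near_minimizer_acal:
  assumes ac: "abs_cont_on \<gamma> a0 b0" and int: "ai \<gamma> integrable_on {a0..b0}" and "\<epsilon> \<ge> 0"
    and near: "\<And>a b. a0 \<le> a \<Longrightarrow> a \<le> b \<Longrightarrow> b \<le> b0 \<Longrightarrow> integral {a..b} (ai \<gamma>) - \<epsilon> \<le> v (\<gamma> b) - v (\<gamma> a)"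
  shows "acal \<epsilon> {a0..b0} \<gamma>"
proof -
  have sub: "abs_cont_on \<gamma> a b" "ai \<gamma> integrable_on {a..b}" if "a0 \<le> a" "b \<le> b0" for a b
    using abs_cont_on_subset[OF ac that] integrable_subinterval_real[OF int, of a b] that by auto
  have speed: "norm (\<gamma> b - \<gamma> a) \<le> C0 * (b - a) + \<epsilon>" if ab: "a0 \<le> a" "a \<le> b" "b \<le> b0" for a b
  proof -
    \<comment> \<open>The end point term is then (C + 1) times the displacement, while v changes by
      at most C times it. The surplus bounds the displacement itself; the size of this
      \<open>p\<close> explains the radius in the definition of \<open>C0\<close>.\<close>
    define p where "p = c + (C + 1) *\<^sub>R sgn (\<gamma> b - \<gamma> a)"
    have "norm p \<le> norm c + norm ((C + 1) *\<^sub>R sgn (\<gamma> b - \<gamma> a))" unfolding p_def by (rule norm_triangle_ineq)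
    also have "\<dots> \<le> norm c + C + 1" using C_nonneg by (simp add: norm_sgn)
    finally have np: "norm p \<le> norm c + C + 1" .
    have "sgn z \<bullet> z = norm z" for z :: "real^'n"
      by (cases "z = 0") (auto simp: sgn_div_norm dot_square_norm power2_eq_square)
    then have eq: "(p - c) \<bullet> (\<gamma> b - \<gamma> a) = (C + 1) * norm (\<gamma> b - \<gamma> a)" by (simp add: p_def)
    have "(p - c) \<bullet> (\<gamma> b - \<gamma> a) + (h - (C0 + h)) * (b - a) \<le> integral {a..b} (ai \<gamma>)"
    proof (rule action_lower_bound[OF sub(1)[OF ab(1,3)] ab(2) sub(2)[OF ab(1,3)]])
      show "H (\<gamma> s) p \<le> C0 + h" for s using C0(2)[OF np, of "\<gamma> s"] by simp
    qed
    also have "\<dots> \<le> v (\<gamma> b) - v (\<gamma> a) + \<epsilon>" using near[OF ab] by simp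
    also have "\<dots> \<le> C * norm (\<gamma> b - \<gamma> a) + \<epsilon>" using v_lipD[of "\<gamma> b" "\<gamma> a"] by simp
    finally show ?thesis unfolding eq by (simp add: algebra_simps)
  qed
  show ?thesis
    unfolding acal_def
  proof (intro ballI impI conjI allI)
    fix a b p assume "a \<in> {a0..b0}" "b \<in> {a0..b0}" "a \<le> b"
    then have ab: "a0 \<le> a" "a \<le> b" "b \<le> b0" by auto
    show "norm (\<gamma> b - \<gamma> a) \<le> C0 * (b - a) + \<epsilon>" by (rule speed[OF ab])
    \<comment> \<open>By the speed bound the curve stays within
      \<open>C0 * (b - a) + \<epsilon>\<close> of \<open>\<gamma> a\<close>, so \<open>?B\<close>
      dominates H along the whole piece while evaluating it only at
      \<open>\<gamma> a\<close>.\<close>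
    let ?B = "H (\<gamma> a) p + MH p * (C0 * (b - a) + \<epsilon>)"
    have "(p - c) \<bullet> (\<gamma> b - \<gamma> a) + (h - ?B) * (b - a) \<le> integral {a..b} (ai \<gamma>)"
    proof (rule action_lower_bound[OF sub(1)[OF ab(1,3)] ab(2) sub(2)[OF ab(1,3)]])
      fix s assume s: "s \<in> {a..b}"
      have "norm (\<gamma> s - \<gamma> a) \<le> C0 * (s - a) + \<epsilon>" using s ab by (intro speed) auto
      also have "\<dots> \<le> C0 * (b - a) + \<epsilon>" using s C0(1) by (intro add_right_mono mult_left_mono) auto
      finally have "MH p * norm (\<gamma> s - \<gamma> a) \<le> MH p * (C0 * (b - a) + \<epsilon>)" using MH(1) by (rule mult_left_mono)
      then show "H (\<gamma> s) p \<le> ?B" using MH(2)[of "\<gamma> s" p "\<gamma> a"] by linarith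
    qed
    then show "(p - c) \<bullet> (\<gamma> b - \<gamma> a) - (b - a) * (H (\<gamma> a) p - h + MH p * (C0 * (b - a) + \<epsilon>)) - \<epsilon>
        \<le> v (\<gamma> b) - v (\<gamma> a)"
      using near[OF ab] by (simp add: algebra_simps)
  qed
qed

text \<open>Subtracting the identities for two horizons makes every piece of the curve exactly
  calibrated, so the error is 0.\<close>

lemma minimizing_curve_acal:
  assumes "minimizing_curve H c h v \<gamma>"
  shows "acal 0 {..0} \<gamma>"
proof -
  have adm: "abs_cont_on \<gamma> (- T) 0" "ai \<gamma> absolutely_integrable_on {- T..0}"
    "integral {- T..0} (ai \<gamma>) + v (\<gamma> (- T)) = v (\<gamma> 0)" if "T > 0" for T
    using assms that unfolding minimizing_curve_def minimizing_curve_for_def admissible_def action_def by auto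
  have eq: "integral {t..0} (ai \<gamma>) = v (\<gamma> 0) - v (\<gamma> t)" if "t \<le> 0" for t
    using adm(3)[of "- t"] that by (cases "t = 0") auto
  have *: "acal 0 {- T..0} \<gamma>" if T: "T > 0" for T
  proof (rule near_minimizer_acal[OF adm(1)[OF T]])
    show int: "ai \<gamma> integrable_on {- T..0}" using adm(2)[OF T] by (simp add: absolutely_integrable_on_def)
    fix a b assume ab: "- T \<le> a" "a \<le> b" "b \<le> 0"
    have "integral {a..b} (ai \<gamma>) + integral {b..0} (ai \<gamma>) = integral {a..0} (ai \<gamma>)"
      by (rule Henstock_Kurzweil_Integration.integral_combine) (use ab in \<open>auto intro!: integrable_subinterval_real[OF int]\<close>)
    then show "integral {a..b} (ai \<gamma>) - 0 \<le> v (\<gamma> b) - v (\<gamma> a)" using eq[of a] eq[of b] ab by simp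
  qed simp
  show ?thesis
    unfolding acal_def
  proof (intro ballI impI)
    fix a b :: real assume "a \<in> {..0}" "b \<in> {..0}" "a \<le> b"
    \<comment> \<open>The horizon \<open>1 - a\<close> reaches back past \<open>a\<close> and
      remains positive when \<open>a = 0\<close>.\<close>
    then show "norm (\<gamma> b - \<gamma> a) \<le> C0 * (b - a) + 0 \<and>
     (\<forall>p. (p - c) \<bullet> (\<gamma> b - \<gamma> a) - (b - a) * (H (\<gamma> a) p - h + MH p * (C0 * (b - a) + 0)) - 0
        \<le> v (\<gamma> b) - v (\<gamma> a))"
      using *[of "1 - a"] unfolding acal_def by auto
  qed
qed

lemma acal_limit:
  assumes ac: "\<And>j. acal (\<epsilon> j) (S j) (\<gamma> j)" and \<epsilon>: "\<epsilon> \<longlonglongrightarrow> 0"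
    and S: "\<And>t. t \<in> T \<Longrightarrow> \<forall>\<^sub>F j in sequentially. t \<in> S j"
    and lim: "\<And>t. t \<in> T \<Longrightarrow> (\<lambda>j. \<gamma> j t) \<longlonglongrightarrow> \<Gamma> t"
  shows "acal 0 T \<Gamma>"
  unfolding acal_def
proof (intro ballI impI conjI allI)
  fix a b p assume a: "a \<in> T" and b: "b \<in> T" and ab: "a \<le> b"
  have ev: "\<forall>\<^sub>F j in sequentially. a \<in> S j \<and> b \<in> S j"
    using S[OF a] S[OF b] by (rule eventually_conj)
  have l: "(\<lambda>j. \<gamma> j b - \<gamma> j a) \<longlonglongrightarrow> \<Gamma> b - \<Gamma> a" by (intro tendsto_diff lim a b)
  have v: "(\<lambda>j. v (\<gamma> j t)) \<longlonglongrightarrow> v (\<Gamma> t)" if "t \<in> T" for t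
    using continuous_on_tendsto_compose[OF v_continuous lim[OF that]] by simp
  have Hl: "(\<lambda>j. H (\<gamma> j a) p) \<longlonglongrightarrow> H (\<Gamma> a) p"
    using continuous_on_tendsto_compose[OF H_continuous, of "\<lambda>j. (\<gamma> j a, p)" "(\<Gamma> a, p)"]
      tendsto_Pair[OF lim[OF a] tendsto_const[of p]] by simp
  show "norm (\<Gamma> b - \<Gamma> a) \<le> C0 * (b - a) + 0"
  proof (rule tendsto_le[OF _ _ tendsto_norm[OF l]])
    show "(\<lambda>j. C0 * (b - a) + \<epsilon> j) \<longlonglongrightarrow> C0 * (b - a) + 0" by (intro tendsto_intros \<epsilon>)
    show "\<forall>\<^sub>F j in sequentially. norm (\<gamma> j b - \<gamma> j a) \<le> C0 * (b - a) + \<epsilon> j"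
      using ev by eventually_elim (use acalD(1)[OF ac] ab in auto)
  qed simp
  show "(p - c) \<bullet> (\<Gamma> b - \<Gamma> a) - (b - a) * (H (\<Gamma> a) p - h + MH p * (C0 * (b - a) + 0)) - 0 \<le> v (\<Gamma> b) - v (\<Gamma> a)"
  proof (rule tendsto_le)
    show "(\<lambda>j. v (\<gamma> j b) - v (\<gamma> j a)) \<longlonglongrightarrow> v (\<Gamma> b) - v (\<Gamma> a)" by (intro tendsto_diff v a b)
    show "(\<lambda>j. (p - c) \<bullet> (\<gamma> j b - \<gamma> j a) - (b - a) * (H (\<gamma> j a) p - h + MH p * (C0 * (b - a) + \<epsilon> j)) - \<epsilon> j)
      \<longlonglongrightarrow> (p - c) \<bullet> (\<Gamma> b - \<Gamma> a) - (b - a) * (H (\<Gamma> a) p - h + MH p * (C0 * (b - a) + 0)) - 0"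
      by (intro tendsto_intros l Hl \<epsilon>)
    show "\<forall>\<^sub>F j in sequentially. (p - c) \<bullet> (\<gamma> j b - \<gamma> j a) - (b - a) * (H (\<gamma> j a) p - h + MH p * (C0 * (b - a) + \<epsilon> j)) - \<epsilon> j
      \<le> v (\<gamma> j b) - v (\<gamma> j a)"
      using ev by eventually_elim (use acalD(2)[OF ac] ab in auto)
  qed simp
qed

text \<open>The curves are Lipschitz only up to the vanishing errors \<epsilon> and live on varying
  time sets, so a diagonal subsequence is taken at the countably many rational times of
  \<open>T\<close>. Approximate equicontinuity carries convergence over to the other times.\<close>

lemma acal_compactness:
  assumes ac: "\<And>j. acal (\<epsilon> j) (S j) (\<gamma> j)" and \<epsilon>: "\<epsilon> \<longlonglongrightarrow> 0"
    and S: "\<And>t. t \<in> T \<Longrightarrow> \<forall>\<^sub>F j in sequentially. t \<in> S j" and S0: "\<And>j. 0 \<in> S j"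
    and T: "0 \<in> T" "T \<subseteq> closure (T \<inter> \<rat>)"
    and y: "(\<lambda>j. \<gamma> j 0) \<longlonglongrightarrow> y"
  obtains r \<Gamma> where "strict_mono r" "\<And>t. t \<in> T \<Longrightarrow> (\<lambda>j. \<gamma> (r j) t) \<longlonglongrightarrow> \<Gamma> t" "acal 0 T \<Gamma>" "\<Gamma> 0 = y"
proof -
  obtain G where G: "\<And>j. norm (\<gamma> j 0) \<le> G"
    using convergent_imp_Bseq[OF convergentI[OF y]] unfolding Bseq_def by metis
  obtain E where E: "\<And>j. norm (\<epsilon> j) \<le> E"
    using convergent_imp_Bseq[OF convergentI[OF \<epsilon>]] unfolding Bseq_def by metis
  have E0: "E \<ge> 0" "G \<ge> 0" using E[of 0] G[of 0] norm_ge_zero order_trans by blast+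
  \<comment> \<open>The subsequence theorem wants one bound for all times, whereas the curves may
    drift linearly. Dividing by \<open>M t\<close> and putting 0 where a curve is not controlled
    gives the bound 1; the summand 1 keeps \<open>M t\<close> positive.\<close>
  define M where "M t = G + C0 * \<bar>t\<bar> + E + 1" for t
  have M: "M t > 0" for t
    using E0 mult_nonneg_nonneg[OF C0(1) abs_ge_zero[of t]] by (simp add: M_def)
  define f where "f j t = (if t \<in> S j then \<gamma> j t /\<^sub>R M t else 0)" for j t
  have fb: "norm (f j t) \<le> 1" for j t
  proof (cases "t \<in> S j")
    case True
    have "norm (\<gamma> j t) \<le> norm (\<gamma> j 0) + norm (\<gamma> j t - \<gamma> j 0)" by (rule norm_triangle_sub)
    also have "\<dots> \<le> M t"
      using acal_dist[OF ac S0 True] G[of j] E[of j] by (simp add: M_def)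
    finally show ?thesis using True M[of t] by (simp add: f_def field_simps)
  qed (simp add: f_def)
  have "countable (T \<inter> \<rat>)" using countable_rat by (rule countable_Int2)
  from function_convergent_subsequence[OF this, of f 1, OF fb]
  obtain r where r: "strict_mono r" "\<And>t. t \<in> T \<inter> \<rat> \<Longrightarrow> \<exists>l. (\<lambda>j. f (r j) t) \<longlonglongrightarrow> l" by blast
  have evr: "\<forall>\<^sub>F j in sequentially. t \<in> S (r j)" if "t \<in> T" for t
    using eventually_subseq[OF r(1) S[OF that]] .
  have \<epsilon>r: "(\<lambda>j. \<epsilon> (r j)) \<longlonglongrightarrow> 0" using LIMSEQ_subseq_LIMSEQ[OF \<epsilon> r(1)] by (simp add: o_def)
  have convQ: "\<exists>l. (\<lambda>j. \<gamma> (r j) t) \<longlonglongrightarrow> l" if t: "t \<in> T \<inter> \<rat>" for t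
  proof -
    obtain l where l: "(\<lambda>j. f (r j) t) \<longlonglongrightarrow> l" using r(2)[OF t] by blast
    have "(\<lambda>j. M t *\<^sub>R f (r j) t) \<longlonglongrightarrow> M t *\<^sub>R l" by (intro tendsto_intros l)
    moreover have "\<forall>\<^sub>F j in sequentially. M t *\<^sub>R f (r j) t = \<gamma> (r j) t"
      using evr[OF IntD1[OF t]] by eventually_elim (use M[of t] in \<open>simp add: f_def\<close>)
    ultimately have "(\<lambda>j. \<gamma> (r j) t) \<longlonglongrightarrow> M t *\<^sub>R l" by (rule Lim_transform_eventually)
    then show ?thesis ..
  qed
  have conv: "\<exists>l. (\<lambda>j. \<gamma> (r j) t) \<longlonglongrightarrow> l" if t: "t \<in> T" for t
  proof -
    have "Cauchy (\<lambda>j. \<gamma> (r j) t)"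
    proof (rule metric_CauchyI)
      fix e :: real assume e: "e > 0"
      \<comment> \<open>Passing from \<open>t\<close> to a rational time within \<open>d\<close>
        costs at most e / 8 for the speed and eventually less than e / 8 for the error;
        \<open>C0 + 1\<close> covers the case \<open>C0 = 0\<close>.\<close>
      define d where "d = e / 8 / (C0 + 1)"
      have d: "d > 0" using e C0(1) by (simp add: d_def)
      have "C0 * d \<le> (C0 + 1) * d" using d by simp
      also have "\<dots> = e / 8"
      proof -
        have "C0 + 1 \<noteq> 0" using C0(1) by simp
        then show ?thesis unfolding d_def by (metis nonzero_mult_div_cancel_left times_divide_eq_right)
      qed
      finally have Cd: "C0 * d \<le> e / 8" .
      obtain q where q: "q \<in> T \<inter> \<rat>" "dist q t < d"
        using subsetD[OF T(2) t] d unfolding closure_approachable by blast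
      obtain l where l: "(\<lambda>j. \<gamma> (r j) q) \<longlonglongrightarrow> l" using convQ[OF q(1)] by blast
      have "\<forall>\<^sub>F j in sequentially. dist (\<gamma> (r j) q) l < e / 8"
        using tendstoD[OF l, of "e / 8"] e by simp
      moreover have "\<forall>\<^sub>F j in sequentially. dist (\<epsilon> (r j)) 0 < e / 8"
        using tendstoD[OF \<epsilon>r, of "e / 8"] e by simp
      moreover have "\<forall>\<^sub>F j in sequentially. q \<in> S (r j)" using evr q(1) by blast
      ultimately have "\<forall>\<^sub>F j in sequentially. dist (\<gamma> (r j) t) l < e / 2"
        using evr[OF t]
      proof eventually_elim
        case (elim j)
        have "norm (\<gamma> (r j) t - \<gamma> (r j) q) \<le> C0 * \<bar>t - q\<bar> + \<epsilon> (r j)" by (rule acal_dist[OF ac]) (use elim in auto)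
        moreover have "C0 * \<bar>t - q\<bar> \<le> C0 * d" using q(2) C0(1) by (intro mult_left_mono) (auto simp: dist_real_def)
        moreover have "\<epsilon> (r j) < e / 8" using elim(2) by (simp add: dist_real_def)
        ultimately have "dist (\<gamma> (r j) t) (\<gamma> (r j) q) < e / 4" using Cd unfolding dist_norm by linarith
        then show ?case using e elim(1) dist_triangle[of "\<gamma> (r j) t" l "\<gamma> (r j) q"] by linarith
      qed
      then obtain N where N: "\<And>j. j \<ge> N \<Longrightarrow> dist (\<gamma> (r j) t) l < e / 2"
        unfolding eventually_sequentially by blast
      show "\<exists>N. \<forall>i\<ge>N. \<forall>j\<ge>N. dist (\<gamma> (r i) t) (\<gamma> (r j) t) < e"
        using dist_triangle_half_r[of l "\<gamma> (r _) t" e "\<gamma> (r _) t"] N by (metis dist_commute)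
    qed
    then show ?thesis using Cauchy_convergent unfolding convergent_def by auto
  qed
  then obtain \<Gamma> where \<Gamma>: "\<And>t. t \<in> T \<Longrightarrow> (\<lambda>j. \<gamma> (r j) t) \<longlonglongrightarrow> \<Gamma> t" by metis
  show thesis
  proof (rule that[OF r(1) \<Gamma>])
    show "acal 0 T \<Gamma>"
      by (rule acal_limit[of "\<lambda>j. \<epsilon> (r j)" "\<lambda>j. S (r j)" "\<lambda>j. \<gamma> (r j)"]) (use ac \<epsilon>r evr \<Gamma> in auto)
    have "(\<lambda>j. \<gamma> (r j) 0) \<longlonglongrightarrow> y" using LIMSEQ_subseq_LIMSEQ[OF y r(1)] by (simp add: o_def)
    then show "\<Gamma> 0 = y" using \<Gamma>[OF T(1)] LIMSEQ_unique by blast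
  qed
qed

end

section \<open>Auxiliary facts on integrals, quadratic bounds and limit points\<close>

lemma has_integral_le_negligible:
  fixes f g :: "real \<Rightarrow> real"
  assumes N: "negligible N" and "(f has_integral i) S" "(g has_integral j) S"
    and le: "\<And>x. x \<in> S - N \<Longrightarrow> f x \<le> g x"
  shows "i \<le> j"
proof (rule has_integral_le)
  show "((\<lambda>x. if x \<in> N then 0 else f x) has_integral i) S"
    by (rule has_integral_spike[OF N _ assms(2)]) auto
  show "((\<lambda>x. if x \<in> N then 0 else g x) has_integral j) S"
    by (rule has_integral_spike[OF N _ assms(3)]) auto
qed (use le in auto)

text \<open>A linear function with a quadratic upper bound near 0 vanishes, since the linear term
  dominates along its own direction. One-sided variational inequalities become equalities of
  gradients in this way.\<close>

lemma inner_le_quadratic_imp_zero: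
  fixes g :: "'a::real_inner"
  assumes b: "\<And>u. norm u \<le> 1 \<Longrightarrow> g \<bullet> u \<le> K * (norm u)\<^sup>2"
  shows "g = 0"
proof (rule ccontr)
  assume g: "g \<noteq> 0"
  \<comment> \<open>The first bound keeps \<open>t *\<^sub>R g\<close> in the unit ball, the second
    makes K t at most 1 / 2.\<close>
  define t where "t = min (1 / norm g) (1 / (2 * (\<bar>K\<bar> + 1)))"
  have t: "t > 0" using g by (simp add: t_def)
  have tg: "t * norm g \<le> 1"
    using mult_right_mono[of t "1 / norm g" "norm g"] g by (simp add: t_def)
  have "g \<bullet> (t *\<^sub>R g) \<le> K * (norm (t *\<^sub>R g))\<^sup>2" using tg t by (intro b) simp
  then have "t * (norm g)\<^sup>2 \<le> (K * t) * (t * (norm g)\<^sup>2)"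
    by (simp add: dot_square_norm power_mult_distrib power2_eq_square algebra_simps)
  moreover have "t * (norm g)\<^sup>2 > 0" using t g by simp
  ultimately have "1 \<le> K * t" by (metis mult_le_cancel_right_pos mult_1)
  also have "\<dots> \<le> (\<bar>K\<bar> + 1) * t" using t by (intro mult_right_mono) auto
  also have "\<dots> \<le> (\<bar>K\<bar> + 1) * (1 / (2 * (\<bar>K\<bar> + 1)))" by (intro mult_left_mono) (auto simp: t_def)
  also have "\<dots> = 1 / 2" using abs_ge_zero[of K] by (simp add: field_simps)
  finally show False by simp
qed

lemma closure_Rats_le: "t \<le> b \<Longrightarrow> t \<in> closure ({..b} \<inter> \<rat>)" for t b :: real
  unfolding closure_approachable
proof (intro allI impI)
  fix e :: real assume t: "t \<le> b" and "e > 0"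
  then obtain q where "q \<in> \<rat>" "t - e < q" "q < t" using Rats_dense_in_real[of "t - e" t] by auto
  then show "\<exists>y\<in>{..b} \<inter> \<rat>. dist y t < e" using t by (intro bexI[of _ q]) (auto simp: dist_real_def)
qed

lemma closure_Rats_UNIV: "UNIV \<subseteq> closure (UNIV \<inter> \<rat> :: real set)"
proof (rule subsetI)
  fix t :: real
  have "closure ({..t} \<inter> \<rat>) \<subseteq> closure (UNIV \<inter> \<rat>)"
    by (intro closure_mono Int_mono subset_UNIV subset_refl)
  then show "t \<in> closure (UNIV \<inter> \<rat>)" by (rule subsetD) (rule closure_Rats_le[OF order_refl])
qed

text \<open>Compactness of the torus: the points at times -j are translated into the unit cube and a
  convergent subsequence is taken.\<close>

lemma alpha_limit_point_exists:
  fixes \<gamma> :: "real \<Rightarrow> real^'n"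
  shows "\<exists>y. alpha_limit_point \<gamma> y"
proof -
  have "\<exists>k. k \<in> lattice \<and> \<gamma> (- real j) + k \<in> cbox 0 (\<chi> i. 1)" for j
    using lattice_translate_to_cube[of "\<gamma> (- real j)"] by metis
  then have "\<exists>k. \<forall>j. k j \<in> lattice \<and> \<gamma> (- real j) + k j \<in> cbox 0 (\<chi> i. 1)" by (intro choice allI)
  then obtain k where k: "\<And>j. k j \<in> lattice" "\<And>j. \<gamma> (- real j) + k j \<in> cbox 0 (\<chi> i. 1)"
    by auto
  have "seq_compact (cbox 0 (\<chi> i. 1) :: (real^'n) set)" using compact_cbox compact_imp_seq_compact by blast
  then obtain y r where r: "strict_mono (r :: nat \<Rightarrow> nat)" "((\<lambda>j. \<gamma> (- real j) + k j) \<circ> r) \<longlonglongrightarrow> y"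
    using seq_compactE[of _ "\<lambda>j. \<gamma> (- real j) + k j"] k(2) by metis
  have "filterlim (\<lambda>j. real (r j)) at_top sequentially"
    using filterlim_compose[OF filterlim_real_sequentially filterlim_subseq[OF r(1)]] .
  then have "filterlim (\<lambda>j. - real (r j)) at_bot sequentially"
    by (simp add: filterlim_uminus_at_bot)
  moreover have "\<forall>j. - k (r j) \<in> lattice" using k(1) lattice_minus by blast
  moreover have "(\<lambda>j. \<gamma> (- real (r j)) - - k (r j)) \<longlonglongrightarrow> y" using r(2) by (simp add: o_def)
  ultimately show ?thesis unfolding alpha_limit_point_def
    by (intro exI[of _ y] exI[of _ "\<lambda>j. - real (r j)"] exI[of _ "\<lambda>j. - k (r j)"]) simp
qed

section \<open>From the inequalities back to calibration; existence of minimizing curves\<close>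

context weak_kam
begin

lemma acal_lipschitz: "acal 0 S \<Gamma> \<Longrightarrow> {a..b} \<subseteq> S \<Longrightarrow> C0-lipschitz_on {a..b} \<Gamma>"
  using acal_dist[of 0 S \<Gamma>] C0(1) by (intro lipschitz_onI) (auto simp: dist_norm subset_iff)

lemma ai_absolutely_integrable:
  assumes "M-lipschitz_on {a..b} \<gamma>"
  shows "ai \<gamma> absolutely_integrable_on {a..b}"
proof -
  have "continuous_on UNIV (\<lambda>z :: real \<times> (real^'n) \<times> (real^'n). lagrangian H (fst (snd z)) (snd (snd z)) - c \<bullet> snd (snd z) + h)"
    by (intro continuous_intros continuous_on_compose2[OF lagrangian_continuous, of UNIV snd, simplified])
  from lipschitz_curve_absolutely_integrable[OF assms this] show ?thesis
    by (simp add: action_integrand_def[abs_def])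
qed

text \<open>The inequality for the momentum dual to \<xi>, divided by the length of a short interval
  to the right of \<open>t\<close>, tends to a bound by \<open>f\<close>. For this momentum
  Fenchel's inequality is an equality, so the bound is on the Lagrangian itself.\<close>

lemma acal_pointwise:
  assumes ac: "acal 0 S \<Gamma>" and d: "d > 0" "{t..t + d} \<subseteq> S"
    and \<xi>: "(\<Gamma> has_vector_derivative \<xi>) (at t)" and f: "((\<lambda>s. v (\<Gamma> s)) has_real_derivative f) (at t)"
  shows "lagrangian H (\<Gamma> t) \<xi> - c \<bullet> \<xi> + h \<le> f"
proof -
  define p where "p = pm (\<Gamma> t) \<xi>"
  define \<phi> where "\<phi> s = (p - c) \<bullet> \<Gamma> s - v (\<Gamma> s)" for s
  have "((\<lambda>s. (p - c) \<bullet> \<Gamma> s) has_real_derivative (p - c) \<bullet> \<xi>) (at t)"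
    using bounded_linear.has_vector_derivative[OF bounded_linear_inner_right \<xi>]
    by (simp add: has_real_derivative_iff_has_vector_derivative)
  then have "(\<phi> has_real_derivative (p - c) \<bullet> \<xi> - f) (at t)"
    unfolding \<phi>_def using f by (rule DERIV_diff)
  then have lim: "((\<lambda>s. (\<phi> (t + s) - \<phi> t) / s) \<longlongrightarrow> (p - c) \<bullet> \<xi> - f) (at_right 0)"
    unfolding DERIV_def by (rule tendsto_mono[OF at_le, rotated]) simp
  have lim2: "((\<lambda>s. H (\<Gamma> t) p - h + MH p * (C0 * s)) \<longlongrightarrow> H (\<Gamma> t) p - h + MH p * (C0 * 0)) (at_right 0)"
    by (intro tendsto_intros)
  have "(p - c) \<bullet> \<xi> - f \<le> H (\<Gamma> t) p - h + MH p * (C0 * 0)"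
  proof (rule tendsto_le[OF _ lim2 lim])
    have "(\<phi> (t + s) - \<phi> t) / s \<le> H (\<Gamma> t) p - h + MH p * (C0 * s)" if s: "0 < s" "s < d" for s
    proof -
      have "t \<in> S" "t + s \<in> S" using d s by auto
      from acalD(2)[OF ac this, of p] s
      have "\<phi> (t + s) - \<phi> t \<le> s * (H (\<Gamma> t) p - h + MH p * (C0 * s))"
        by (simp add: \<phi>_def inner_diff_right)
      then show ?thesis using s by (simp add: field_simps)
    qed
    then show "\<forall>\<^sub>F s in at_right 0. (\<phi> (t + s) - \<phi> t) / s \<le> H (\<Gamma> t) p - h + MH p * (C0 * s)"
      unfolding eventually_at_right_field using d(1) by blast
  qed simp
  then show ?thesis
    unfolding lagrangian_eq p_def[symmetric] by (simp add: inner_diff_left inner_commute[of \<xi>])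
qed

text \<open>Integrating the pointwise bound with the fundamental theorem for v along the curve gives
  one inequality; domination gives the other.\<close>

lemma acal_calibrated:
  assumes ac: "acal 0 S \<Gamma>" and ab: "{a..b} \<subseteq> S" "a \<le> b"
  shows "integral {a..b} (ai \<Gamma>) = v (\<Gamma> b) - v (\<Gamma> a)"
proof -
  have lip: "C0-lipschitz_on {a..b} \<Gamma>" by (rule acal_lipschitz[OF ac ab(1)])
  have int: "ai \<Gamma> absolutely_integrable_on {a..b}" by (rule ai_absolutely_integrable[OF lip])
  define F where "F s = v (\<Gamma> s)" for s
  have "(C * C0)-lipschitz_on {a..b} F"
    unfolding F_def by (rule lipschitz_on_compose2[OF lip lipschitz_on_subset[OF v_lip]]) auto
  then have acF: "abs_cont_on F a b" by (rule lipschitz_imp_abs_cont_on)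
  have acG: "abs_cont_on \<Gamma> a b" by (rule lipschitz_imp_abs_cont_on[OF lip])
  \<comment> \<open>The time \<open>b\<close> is excluded because the pointwise bound needs room to
    the right inside \<open>S\<close>.\<close>
  define N where "N = {x \<in> {a..b}. \<not> F differentiable (at x)} \<union> {x \<in> {a..b}. \<not> \<Gamma> differentiable (at x)} \<union> {b}"
  have N: "negligible N"
    unfolding N_def by (intro negligible_Un abs_cont_on_differentiable_ae acF acG) simp
  have "integral {a..b} (ai \<Gamma>) \<le> F b - F a"
  proof (rule has_integral_le_negligible[OF N])
    show "(ai \<Gamma> has_integral integral {a..b} (ai \<Gamma>)) {a..b}"
      using int by (auto simp: absolutely_integrable_on_def intro: integrable_integral)
    show "((\<lambda>s. vector_derivative F (at s)) has_integral F b - F a) {a..b}"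
      by (rule abs_cont_on_has_integral_derivative[OF acF ab(2)])
    fix t assume t: "t \<in> {a..b} - N"
    then have "t < b" "a \<le> t" and dG: "\<Gamma> differentiable (at t)" and dF: "F differentiable (at t)"
      by (auto simp: N_def)
    show "ai \<Gamma> t \<le> vector_derivative F (at t)"
      unfolding action_integrand_def
    proof (rule acal_pointwise[OF ac, of "b - t"])
      show "{t..t + (b - t)} \<subseteq> S" using ab \<open>a \<le> t\<close> by auto
      show "((\<lambda>s. v (\<Gamma> s)) has_real_derivative vector_derivative F (at t)) (at t)"
        using dF by (simp add: F_def[abs_def, symmetric] has_real_derivative_iff_has_vector_derivative vector_derivative_works)
    qed (use \<open>t < b\<close> dG in \<open>auto simp: vector_derivative_works\<close>)
  qed
  then show ?thesis using domination[OF acG ab(2) int] by (simp add: F_def)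
qed

text \<open>The excess of action over the increment of v is nonnegative on every piece by domination
  and below \<epsilon> in total, so no subinterval carries more than \<epsilon>.\<close>

lemma near_minimizer_exists:
  assumes "\<epsilon> > 0" "T > 0"
  obtains \<gamma> where "\<gamma> 0 = x" "acal \<epsilon> {- T..0} \<gamma>"
proof -
  let ?A = "{\<gamma>. admissible H c h T \<gamma> \<and> \<gamma> 0 = x}" and ?F = "\<lambda>\<gamma>. action H c h T \<gamma> + v (\<gamma> (- T))"
  \<comment> \<open>The constant curve is a competitor, so the set under the infimum is
    nonempty.\<close>
  have "0-lipschitz_on {- T..0} (\<lambda>s. x)" by (rule lipschitz_onI) auto
  then have "(\<lambda>s. x) \<in> ?A"
    by (auto simp: admissible_def intro: lipschitz_imp_abs_cont_on ai_absolutely_integrable)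
  then have ne: "?F ` ?A \<noteq> {}" by blast
  have "v x = Inf (?F ` ?A)" using repr assms(2) unfolding representation_formula_def by blast
  then have "Inf (?F ` ?A) < v x + \<epsilon>" using assms(1) by simp
  from cInf_lessD[OF ne this] obtain \<gamma> where \<gamma>: "\<gamma> \<in> ?A" "?F \<gamma> < v x + \<epsilon>" by blast
  then have adm: "abs_cont_on \<gamma> (- T) 0" "ai \<gamma> absolutely_integrable_on {- T..0}" "\<gamma> 0 = x"
    "integral {- T..0} (ai \<gamma>) + v (\<gamma> (- T)) < v (\<gamma> 0) + \<epsilon>"
    by (auto simp: admissible_def action_def)
  have int: "ai \<gamma> integrable_on {- T..0}" using adm(2) by (simp add: absolutely_integrable_on_def)
  have "acal \<epsilon> {- T..0} \<gamma>"
  proof (rule near_minimizer_acal[OF adm(1) int])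
    fix a b assume ab: "- T \<le> a" "a \<le> b" "b \<le> 0"
    have "v (\<gamma> a) - v (\<gamma> (- T)) \<le> integral {- T..a} (ai \<gamma>)"
      by (rule domination) (use ab in \<open>auto intro!: abs_cont_on_subset[OF adm(1)] absolutely_integrable_on_subinterval[OF adm(2)]\<close>)
    moreover have "v (\<gamma> 0) - v (\<gamma> b) \<le> integral {b..0} (ai \<gamma>)"
      by (rule domination) (use ab in \<open>auto intro!: abs_cont_on_subset[OF adm(1)] absolutely_integrable_on_subinterval[OF adm(2)]\<close>)
    moreover have "integral {- T..a} (ai \<gamma>) + integral {a..0} (ai \<gamma>) = integral {- T..0} (ai \<gamma>)"
      by (rule Henstock_Kurzweil_Integration.integral_combine) (use ab in \<open>auto intro: int\<close>)
    moreover have "integral {a..b} (ai \<gamma>) + integral {b..0} (ai \<gamma>) = integral {a..0} (ai \<gamma>)"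
      by (rule Henstock_Kurzweil_Integration.integral_combine) (use ab in \<open>auto intro!: integrable_subinterval_real[OF int]\<close>)
    ultimately show "integral {a..b} (ai \<gamma>) - \<epsilon> \<le> v (\<gamma> b) - v (\<gamma> a)" using adm(4) by linarith
  qed (use assms in auto)
  then show thesis using that adm(3) by blast
qed

text \<open>Near minimizers with error 1 / (j + 1) on the horizon j + 1 have a limit on the whole
  past, and the limit satisfies the inequalities without error. Calibration then makes it exactly
  minimizing on every horizon.\<close>

lemma minimizing_curve_exists: "\<exists>\<gamma>. minimizing_curve_for H c h v x \<gamma>"
proof -
  have "\<exists>\<gamma>. \<gamma> 0 = x \<and> acal (1 / real (Suc j)) {- real (Suc j)..0} \<gamma>" for j
    using near_minimizer_exists[of "1 / real (Suc j)" "real (Suc j)" x] by (metis divide_pos_pos of_nat_0_less_iff zero_less_Suc zero_less_one)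
  then obtain \<gamma> where \<gamma>: "\<And>j. \<gamma> j 0 = x" "\<And>j. acal (1 / real (Suc j)) {- real (Suc j)..0} (\<gamma> j)" by metis
  obtain \<Gamma> where \<Gamma>: "acal 0 {..0} \<Gamma>" "\<Gamma> 0 = x"
  proof (rule acal_compactness[of "\<lambda>j. 1 / real (Suc j)" "\<lambda>j. {- real (Suc j)..0}" \<gamma> "{..0}" x, OF \<gamma>(2)])
    show "(\<lambda>j. 1 / real (Suc j)) \<longlonglongrightarrow> 0" using LIMSEQ_inverse_real_of_nat by (simp add: inverse_eq_divide)
    fix t :: real assume "t \<in> {..0}"
    obtain n where n: "- t < real n" using reals_Archimedean2 by blast
    show "\<forall>\<^sub>F j in sequentially. t \<in> {- real (Suc j)..0}"
      unfolding eventually_sequentially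
      by (rule exI[of _ n]) (use n \<open>t \<in> {..0}\<close> in auto)
  next
    show "{..0::real} \<subseteq> closure ({..0} \<inter> \<rat>)"
      by (rule subsetI, rule closure_Rats_le) simp
    show "(\<lambda>j. \<gamma> j 0) \<longlonglongrightarrow> x" using \<gamma>(1) by simp
  qed auto
  have "admissible H c h T \<Gamma> \<and> action H c h T \<Gamma> + v (\<Gamma> (- T)) = v x" if "T > 0" for T
  proof -
    have sub: "{- T..0} \<subseteq> {..0}" by auto
    have lip: "C0-lipschitz_on {- T..0} \<Gamma>" by (rule acal_lipschitz[OF \<Gamma>(1) sub])
    have "integral {- T..0} (ai \<Gamma>) = v (\<Gamma> 0) - v (\<Gamma> (- T))"
      by (rule acal_calibrated[OF \<Gamma>(1) sub]) (use that in simp)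
    then show ?thesis using \<Gamma>(2) lipschitz_imp_abs_cont_on[OF lip] ai_absolutely_integrable[OF lip]
      by (simp add: admissible_def action_def)
  qed
  then have "minimizing_curve_for H c h v x \<Gamma>" unfolding minimizing_curve_for_def using \<Gamma>(2) by blast
  then show ?thesis by blast
qed

section \<open>First variation and second-order contact with the solution\<close>

text \<open>The momentum along the curve, Legendre dual to its velocity; it is meaningful at the
  almost every time where the derivative exists.\<close>

definition mom :: "(real \<Rightarrow> real^'n) \<Rightarrow> real \<Rightarrow> real^'n" where
  "mom \<Gamma> s = pm (\<Gamma> s) (vector_derivative \<Gamma> (at s))"

text \<open>First variation of the action under the perturbation \<open>\<Gamma> s + (\<alpha> + \<beta> s) u\<close>.\<close>
definition var1 :: "(real \<Rightarrow> real^'n) \<Rightarrow> real \<Rightarrow> real \<Rightarrow> real \<Rightarrow> real^'n" where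
  "var1 \<Gamma> \<alpha> \<beta> s = \<beta> *\<^sub>R (mom \<Gamma> s - c) - (\<alpha> + \<beta> * s) *\<^sub>R gHx (\<Gamma> s) (mom \<Gamma> s)"

lemma var1_integrable:
  assumes lip: "M-lipschitz_on {a..b} \<Gamma>"
  shows "var1 \<Gamma> \<alpha> \<beta> integrable_on {a..b}"
proof -
  have pmc: "continuous_on UNIV (\<lambda>z :: real \<times> (real^'n) \<times> (real^'n). pm (fst (snd z)) (snd (snd z)))"
    by (intro continuous_on_compose2[OF pm_continuous, of UNIV snd, simplified] continuous_intros)
  have "continuous_on UNIV (\<lambda>z :: real \<times> (real^'n) \<times> (real^'n).
      gHx (fst (fst (snd z), pm (fst (snd z)) (snd (snd z)))) (snd (fst (snd z), pm (fst (snd z)) (snd (snd z)))))"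
    by (intro continuous_on_compose2[OF gHx_continuous] continuous_intros pmc) auto
  then have "continuous_on UNIV (\<lambda>z :: real \<times> (real^'n) \<times> (real^'n).
      \<beta> *\<^sub>R (pm (fst (snd z)) (snd (snd z)) - c) - (\<alpha> + \<beta> * fst z) *\<^sub>R gHx (fst (snd z)) (pm (fst (snd z)) (snd (snd z))))"
    by (intro continuous_intros pmc) simp
  from lipschitz_curve_absolutely_integrable[OF lip this]
  show ?thesis by (simp add: absolutely_integrable_on_def var1_def[abs_def] mom_def)
qed

text \<open>The perturbed curve has speed at most \<open>C0 + 1\<close>, so one Taylor constant of L
  serves all calibrated curves. Domination bounds v along the perturbed curve by its action, and
  calibration evaluates the original action. The affine factor covers ramps as well as, for \<beta>
  = 0, rigid translations.\<close>

lemma acal_perturb: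
  obtains K where "K \<ge> 0" "\<And>S \<Gamma> a b \<alpha> \<beta> u. acal 0 S \<Gamma> \<Longrightarrow> {a..b} \<subseteq> S \<Longrightarrow> a \<le> b \<Longrightarrow> norm u \<le> 1 \<Longrightarrow> \<bar>\<beta>\<bar> \<le> 1 \<Longrightarrow>
    (\<And>s. s \<in> {a..b} \<Longrightarrow> \<bar>\<alpha> + \<beta> * s\<bar> \<le> 1) \<Longrightarrow>
    v (\<Gamma> b + (\<alpha> + \<beta> * b) *\<^sub>R u) - v (\<Gamma> a + (\<alpha> + \<beta> * a) *\<^sub>R u)
      \<le> v (\<Gamma> b) - v (\<Gamma> a) + integral {a..b} (var1 \<Gamma> \<alpha> \<beta>) \<bullet> u + K * (b - a) * (norm u)\<^sup>2"
proof -
  obtain K where K: "K \<ge> 0" "\<And>x y \<xi> \<eta>. norm \<xi> \<le> C0 + 1 \<Longrightarrow> norm \<eta> \<le> C0 + 1 \<Longrightarrow>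
    \<bar>lagrangian H y \<eta> - lagrangian H x \<xi> - (pm x \<xi> \<bullet> (\<eta> - \<xi>) - gHx x (pm x \<xi>) \<bullet> (y - x))\<bar>
      \<le> K * (norm (y - x) + norm (\<eta> - \<xi>))\<^sup>2" using lagrangian_quadratic[of "C0 + 1"] by blast
  show thesis
  \<comment> \<open>The position and the velocity each change by at most the norm of
    \<open>u\<close>; the square of their sum gives the factor 4.\<close>
  proof (rule that[of "4 * K"])
    show "4 * K \<ge> 0" using K(1) by simp
    fix S \<Gamma> a b \<alpha> \<beta> and u :: "real^'n"
    assume ac: "acal 0 S \<Gamma>" and sub: "{a..b} \<subseteq> S" and ab: "a \<le> b" and u: "norm u \<le> 1" and \<beta>: "\<bar>\<beta>\<bar> \<le> 1"
      and \<alpha>: "\<And>s. s \<in> {a..b} \<Longrightarrow> \<bar>\<alpha> + \<beta> * s\<bar> \<le> 1"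
    define g where "g s = \<Gamma> s + (\<alpha> + \<beta> * s) *\<^sub>R u" for s
    have lip: "C0-lipschitz_on {a..b} \<Gamma>" by (rule acal_lipschitz[OF ac sub])
    have lipg: "(C0 + 1)-lipschitz_on {a..b} g"
    proof (rule lipschitz_onI)
      fix s t assume st: "s \<in> {a..b}" "t \<in> {a..b}"
      have "g s - g t = (\<Gamma> s - \<Gamma> t) + (\<beta> * (s - t)) *\<^sub>R u" by (simp add: g_def algebra_simps)
      then have "norm (g s - g t) \<le> norm (\<Gamma> s - \<Gamma> t) + norm ((\<beta> * (s - t)) *\<^sub>R u)"
        by (metis norm_triangle_ineq)
      also have "norm ((\<beta> * (s - t)) *\<^sub>R u) \<le> 1 * \<bar>s - t\<bar>"
      proof -
        have "\<bar>\<beta>\<bar> * norm u \<le> 1" using \<beta> u by (metis mult_le_one norm_ge_zero)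
        from mult_right_mono[OF this abs_ge_zero[of "s - t"]] show ?thesis by (simp add: abs_mult mult_ac)
      qed
      finally show "dist (g s) (g t) \<le> (C0 + 1) * dist s t"
        using lipschitz_onD[OF lip st] by (simp add: dist_norm algebra_simps)
    qed (use C0(1) in simp)
    have ac: "abs_cont_on \<Gamma> a b" "abs_cont_on g a b" using lip lipg by (auto intro: lipschitz_imp_abs_cont_on)
    have intg: "ai g absolutely_integrable_on {a..b}" by (rule ai_absolutely_integrable[OF lipg])
    have int\<Gamma>: "ai \<Gamma> integrable_on {a..b}"
      using ai_absolutely_integrable[OF lip] by (simp add: absolutely_integrable_on_def)
    define N where "N = {x \<in> {a..b}. \<not> \<Gamma> differentiable (at x)} \<union> {a, b}"
    have N: "negligible N" unfolding N_def by (intro negligible_Un abs_cont_on_differentiable_ae ac) simp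
    have "integral {a..b} (ai g) \<le> integral {a..b} (ai \<Gamma>) + integral {a..b} (var1 \<Gamma> \<alpha> \<beta>) \<bullet> u + (4 * K * (norm u)\<^sup>2) * (b - a)"
    proof (rule has_integral_le_negligible[OF N])
      show "(ai g has_integral integral {a..b} (ai g)) {a..b}"
        using intg by (auto simp: absolutely_integrable_on_def intro: integrable_integral)
      have "((\<lambda>s. var1 \<Gamma> \<alpha> \<beta> s \<bullet> u) has_integral integral {a..b} (var1 \<Gamma> \<alpha> \<beta>) \<bullet> u) {a..b}"
        using has_integral_linear[OF integrable_integral[OF var1_integrable[OF lip]] bounded_linear_inner_left[of u]]
        by (simp add: o_def)
      moreover have "((\<lambda>s. 4 * K * (norm u)\<^sup>2) has_integral (4 * K * (norm u)\<^sup>2) * (b - a)) {a..b}"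
        using has_integral_const_real[of "4 * K * (norm u)\<^sup>2" a b] ab by (simp add: mult.commute)
      ultimately show "((\<lambda>s. ai \<Gamma> s + var1 \<Gamma> \<alpha> \<beta> s \<bullet> u + 4 * K * (norm u)\<^sup>2) has_integral
        integral {a..b} (ai \<Gamma>) + integral {a..b} (var1 \<Gamma> \<alpha> \<beta>) \<bullet> u + (4 * K * (norm u)\<^sup>2) * (b - a)) {a..b}"
        by (intro has_integral_add integrable_integral[OF int\<Gamma>])
      fix s assume "s \<in> {a..b} - N"
      then have s: "a < s" "s < b" "\<Gamma> differentiable (at s)" by (auto simp: N_def)
      define \<xi> where "\<xi> = vector_derivative \<Gamma> (at s)"
      have \<xi>: "(\<Gamma> has_vector_derivative \<xi>) (at s)" using s(3) by (simp add: \<xi>_def vector_derivative_works)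
      then have "(g has_vector_derivative \<xi> + \<beta> *\<^sub>R u) (at s)"
        unfolding g_def by (auto intro!: derivative_eq_intros)
      then have vdg: "vector_derivative g (at s) = \<xi> + \<beta> *\<^sub>R u" by (rule vector_derivative_at)
      have n\<xi>: "norm \<xi> \<le> C0" by (rule lipschitz_vector_derivative_bound[OF lip s(1,2) \<xi>])
      have nb: "norm (\<beta> *\<^sub>R u) \<le> norm u" using \<beta> by (simp add: mult_left_le_one_le)
      have n\<eta>: "norm (\<xi> + \<beta> *\<^sub>R u) \<le> C0 + 1"
        using norm_triangle_ineq[of \<xi> "\<beta> *\<^sub>R u"] n\<xi> nb u by linarith
      have nx: "norm ((\<alpha> + \<beta> * s) *\<^sub>R u) \<le> norm u" using \<alpha>[of s] s by (simp add: mult_left_le_one_le)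
      have "(norm ((\<alpha> + \<beta> * s) *\<^sub>R u) + norm (\<beta> *\<^sub>R u))\<^sup>2 \<le> (norm u + norm u)\<^sup>2"
        using nx nb by (intro power_mono add_mono) auto
      also have "\<dots> = 4 * (norm u)\<^sup>2" by (simp add: power2_eq_square algebra_simps)
      finally have sq: "K * (norm ((\<alpha> + \<beta> * s) *\<^sub>R u) + norm (\<beta> *\<^sub>R u))\<^sup>2 \<le> K * (4 * (norm u)\<^sup>2)"
        using K(1) by (rule mult_left_mono)
      have "\<bar>lagrangian H (g s) (\<xi> + \<beta> *\<^sub>R u) - lagrangian H (\<Gamma> s) \<xi> -
          (mom \<Gamma> s \<bullet> (\<beta> *\<^sub>R u) - gHx (\<Gamma> s) (mom \<Gamma> s) \<bullet> ((\<alpha> + \<beta> * s) *\<^sub>R u))\<bar>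
          \<le> K * (norm ((\<alpha> + \<beta> * s) *\<^sub>R u) + norm (\<beta> *\<^sub>R u))\<^sup>2"
        using K(2)[of \<xi> "\<xi> + \<beta> *\<^sub>R u" "g s" "\<Gamma> s"] n\<xi> n\<eta> by (simp add: g_def mom_def \<xi>_def)
      then have "lagrangian H (g s) (\<xi> + \<beta> *\<^sub>R u) \<le> lagrangian H (\<Gamma> s) \<xi> +
          (mom \<Gamma> s \<bullet> (\<beta> *\<^sub>R u) - gHx (\<Gamma> s) (mom \<Gamma> s) \<bullet> ((\<alpha> + \<beta> * s) *\<^sub>R u)) + K * (4 * (norm u)\<^sup>2)"
        using sq by linarith
      then show "ai g s \<le> ai \<Gamma> s + var1 \<Gamma> \<alpha> \<beta> s \<bullet> u + 4 * K * (norm u)\<^sup>2"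
        unfolding action_integrand_def vdg \<xi>_def[symmetric] var1_def
        by (simp add: inner_add_right inner_diff_left algebra_simps)
    qed
    moreover have "v (g b) - v (g a) \<le> integral {a..b} (ai g)" by (rule domination[OF ac(2) ab intg])
    moreover have "integral {a..b} (ai \<Gamma>) = v (\<Gamma> b) - v (\<Gamma> a)"
      by (rule acal_calibrated[OF \<open>acal 0 S \<Gamma>\<close> sub ab])
    ultimately show "v (\<Gamma> b + (\<alpha> + \<beta> * b) *\<^sub>R u) - v (\<Gamma> a + (\<alpha> + \<beta> * a) *\<^sub>R u)
      \<le> v (\<Gamma> b) - v (\<Gamma> a) + integral {a..b} (var1 \<Gamma> \<alpha> \<beta>) \<bullet> u + 4 * K * (b - a) * (norm u)\<^sup>2"
      by (simp add: g_def algebra_simps)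
  qed
qed

text \<open>The uniform constant makes this pointwise second-order estimate a closed condition on \<open>(q, x)\<close>.\<close>
definition K1 :: real where
  "K1 = (SOME K. K \<ge> 0 \<and> (\<forall>S \<Gamma> t. acal 0 S \<Gamma> \<longrightarrow> {t - 1..t + 1} \<subseteq> S \<longrightarrow>
     (\<exists>q. \<forall>u. norm u \<le> 1 \<longrightarrow> \<bar>v (\<Gamma> t + u) - v (\<Gamma> t) - q \<bullet> u\<bar> \<le> K * (norm u)\<^sup>2)))"

definition regular :: "real^'n \<Rightarrow> real^'n \<Rightarrow> bool" where
  "regular q x \<longleftrightarrow> (\<forall>u. norm u \<le> 1 \<longrightarrow> \<bar>v (x + u) - v x - q \<bullet> u\<bar> \<le> K1 * (norm u)\<^sup>2)"

lemma K1_ex: "\<exists>K. K \<ge> 0 \<and> (\<forall>S \<Gamma> t. acal 0 S \<Gamma> \<longrightarrow> {t - 1..t + 1} \<subseteq> S \<longrightarrow>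
     (\<exists>q. \<forall>u. norm u \<le> 1 \<longrightarrow> \<bar>v (\<Gamma> t + u) - v (\<Gamma> t) - q \<bullet> u\<bar> \<le> K * (norm u)\<^sup>2))"
proof -
  obtain K where K: "K \<ge> 0" "\<And>S \<Gamma> a b \<alpha> \<beta> u. acal 0 S \<Gamma> \<Longrightarrow> {a..b} \<subseteq> S \<Longrightarrow> a \<le> b \<Longrightarrow> norm u \<le> 1 \<Longrightarrow> \<bar>\<beta>\<bar> \<le> 1 \<Longrightarrow>
    (\<And>s. s \<in> {a..b} \<Longrightarrow> \<bar>\<alpha> + \<beta> * s\<bar> \<le> 1) \<Longrightarrow>
    v (\<Gamma> b + (\<alpha> + \<beta> * b) *\<^sub>R u) - v (\<Gamma> a + (\<alpha> + \<beta> * a) *\<^sub>R u)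
      \<le> v (\<Gamma> b) - v (\<Gamma> a) + integral {a..b} (var1 \<Gamma> \<alpha> \<beta>) \<bullet> u + K * (b - a) * (norm u)\<^sup>2"
    using acal_perturb by blast
  show ?thesis
  proof (intro exI[of _ K] conjI K(1) allI impI)
    fix S \<Gamma> t assume ac: "acal 0 S \<Gamma>" and sub: "{t - 1..t + 1} \<subseteq> S"
    \<comment> \<open>On the left the ramp rises from 0 at time t - 1 to \<open>u\<close> at time t,
      on the right it falls from \<open>u\<close> back to 0 at time t + 1. Only the value at
      \<open>\<Gamma> t\<close> is displaced, as the final point in the first case and as the
      initial point in the second, hence the opposite inequalities.\<close>
    define q q' where "q = integral {t - 1..t} (var1 \<Gamma> (1 - t) 1)"
      and "q' = - integral {t..t + 1} (var1 \<Gamma> (1 + t) (- 1))"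
    have up: "v (\<Gamma> t + u) - v (\<Gamma> t) \<le> q \<bullet> u + K * (norm u)\<^sup>2" if "norm u \<le> 1" for u
    proof -
      have "{t - 1..t} \<subseteq> S" using sub by auto
      from K(2)[OF ac this, of u 1 "1 - t"] that show ?thesis by (simp add: q_def)
    qed
    have low: "q' \<bullet> u - K * (norm u)\<^sup>2 \<le> v (\<Gamma> t + u) - v (\<Gamma> t)" if "norm u \<le> 1" for u
    proof -
      have "{t..t + 1} \<subseteq> S" using sub by auto
      from K(2)[OF ac this, of u "- 1" "1 + t"] that show ?thesis by (simp add: q'_def)
    qed
    have "(q' - q) \<bullet> u \<le> (2 * K) * (norm u)\<^sup>2" if "norm u \<le> 1" for u
      using up[OF that] low[OF that] by (simp add: inner_diff_left)
    then have "q' - q = 0" by (rule inner_le_quadratic_imp_zero)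
    then have "\<bar>v (\<Gamma> t + u) - v (\<Gamma> t) - q \<bullet> u\<bar> \<le> K * (norm u)\<^sup>2" if "norm u \<le> 1" for u
      using up[OF that] low[OF that] by auto
    then show "\<exists>q. \<forall>u. norm u \<le> 1 \<longrightarrow> \<bar>v (\<Gamma> t + u) - v (\<Gamma> t) - q \<bullet> u\<bar> \<le> K * (norm u)\<^sup>2" by blast
  qed
qed

lemma K1_nonneg: "K1 \<ge> 0"
  and acal_regular: "acal 0 S \<Gamma> \<Longrightarrow> {t - 1..t + 1} \<subseteq> S \<Longrightarrow> \<exists>q. regular q (\<Gamma> t)"
  using someI_ex[OF K1_ex] unfolding K1_def[symmetric] regular_def by auto

lemma regular_has_derivative: "regular q x \<Longrightarrow> (v has_derivative (\<lambda>u. q \<bullet> u)) (at x)"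
  unfolding regular_def by (rule has_derivative_of_quadratic_bound) blast

lemma regular_grad: "regular q x \<Longrightarrow> grad v x = q"
  by (rule grad_eqI[OF regular_has_derivative])

lemma regular_differentiable: "regular q x \<Longrightarrow> v differentiable (at x)"
  using regular_has_derivative unfolding differentiable_def by blast

text \<open>The quadratic estimate in the unit direction of \<open>q\<close> compares the norm of
  \<open>q\<close> with an increment of v, which is at most \<open>C\<close>. This bound provides
  convergent subsequences of gradients.\<close>

lemma regular_norm: "regular q x \<Longrightarrow> norm q \<le> C + K1"
proof (cases "q = 0")
  case True
  then show ?thesis using C_nonneg K1_nonneg by simp
next
  case False
  assume r: "regular q x"
  have n: "norm (sgn q) = 1" using False by (simp add: norm_sgn)
  then have "\<bar>v (x + sgn q) - v x - q \<bullet> sgn q\<bar> \<le> K1" using r unfolding regular_def by (metis mult_1_right one_power2 order_refl)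
  moreover have "\<bar>v (x + sgn q) - v x\<bar> \<le> C" using v_lipD[of "x + sgn q" x] n by simp
  moreover have "q \<bullet> sgn q = norm q" using False by (simp add: sgn_div_norm dot_square_norm power2_eq_square)
  ultimately show ?thesis by linarith
qed

lemma regular_translate: "regular q x \<Longrightarrow> k \<in> lattice \<Longrightarrow> regular q (x - k)"
  using v_per_minus[of k] unfolding regular_def by (simp add: diff_add_eq)

lemma regular_limit:
  assumes r: "\<And>j. regular (q j) (x j)" and q: "q \<longlonglongrightarrow> q0" and x: "x \<longlonglongrightarrow> x0"
  shows "regular q0 x0"
  unfolding regular_def
proof (intro allI impI)
  fix u :: "real^'n" assume u: "norm u \<le> 1"
  have vl: "(\<lambda>j. v (x j + w)) \<longlonglongrightarrow> v (x0 + w)" for w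
    using continuous_on_tendsto_compose[OF v_continuous tendsto_add[OF x tendsto_const[of w]]] by simp
  show "\<bar>v (x0 + u) - v x0 - q0 \<bullet> u\<bar> \<le> K1 * (norm u)\<^sup>2"
  proof (rule tendsto_upperbound)
    show "(\<lambda>j. \<bar>v (x j + u) - v (x j) - q j \<bullet> u\<bar>) \<longlonglongrightarrow> \<bar>v (x0 + u) - v x0 - q0 \<bullet> u\<bar>"
      using vl[of 0] by (intro tendsto_intros vl q) simp
    show "\<forall>\<^sub>F j in sequentially. \<bar>v (x j + u) - v (x j) - q j \<bullet> u\<bar> \<le> K1 * (norm u)\<^sup>2"
      using r u unfolding regular_def by simp
  qed simp
qed

lemma regular_sequence_limit:
  assumes r: "\<And>j. regular (q j) (x j)" and x: "x \<longlonglongrightarrow> x0"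
  obtains q0 \<sigma> where "strict_mono (\<sigma> :: nat \<Rightarrow> nat)" "(\<lambda>j. q (\<sigma> j)) \<longlonglongrightarrow> q0" "regular q0 x0"
proof -
  have "\<forall>j. q j \<in> cball 0 (C + K1)" using regular_norm[OF r] by simp
  moreover have "seq_compact (cball 0 (C + K1) :: (real^'n) set)" using compact_cball compact_imp_seq_compact by blast
  ultimately obtain q0 \<sigma> where \<sigma>: "strict_mono (\<sigma> :: nat \<Rightarrow> nat)" "(q \<circ> \<sigma>) \<longlonglongrightarrow> q0"
    unfolding seq_compact_def by metis
  have "regular q0 x0"
    by (rule regular_limit[of "q \<circ> \<sigma>" "x \<circ> \<sigma>"]) (use r \<sigma> LIMSEQ_subseq_LIMSEQ[OF x \<sigma>(1)] in auto)
  then show thesis using that \<sigma> by (simp add: o_def)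
qed

text \<open>The paraboloid with gradient \<open>q\<close> and opening \<open>K1\<close> touches v
  from above at \<open>x\<close> and is an admissible test function.\<close>

lemma regular_subsolution:
  assumes r: "regular q x"
  shows "H x (c + q) \<le> h"
proof -
  define \<phi> where "\<phi> y = q \<bullet> (y - x) + K1 * ((y - x) \<bullet> (y - x))" for y
  define Dp where "Dp y = blinfun_inner_right (q + (2 * K1) *\<^sub>R (y - x))" for y
  have d: "(\<phi> has_derivative blinfun_apply (Dp y)) (at y)" for y
  proof -
    have "(\<phi> has_derivative (\<lambda>u. q \<bullet> u + K1 * ((y - x) \<bullet> u + u \<bullet> (y - x)))) (at y)"
      unfolding \<phi>_def by (auto intro!: derivative_eq_intros)
    moreover have "(\<lambda>u. q \<bullet> u + K1 * ((y - x) \<bullet> u + u \<bullet> (y - x))) = blinfun_apply (Dp y)"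
      by (simp add: Dp_def fun_eq_iff inner_add_left inner_commute[of _ "y - x"])
    ultimately show ?thesis by simp
  qed
  have "continuous_on UNIV Dp"
    unfolding Dp_def by (intro bounded_linear.continuous_on[OF bounded_linear_blinfun_inner_right] continuous_intros)
  then have "C1 \<phi>" unfolding C1_def using d by (intro exI[of _ Dp]) simp
  moreover have "(\<phi> has_derivative (\<lambda>u. q \<bullet> u)) (at x)" using d[of x] by (simp add: Dp_def)
  moreover have "\<exists>e>0. \<forall>y. dist y x < e \<longrightarrow> v y - \<phi> y \<le> v x - \<phi> x"
  proof (intro exI[of _ 1] conjI allI impI)
    fix y assume "dist y x < 1"
    then have "norm (y - x) \<le> 1" by (simp add: dist_norm)
    then have "\<bar>v (x + (y - x)) - v x - q \<bullet> (y - x)\<bar> \<le> K1 * (norm (y - x))\<^sup>2"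
      using r unfolding regular_def by blast
    then show "v y - \<phi> y \<le> v x - \<phi> x" by (simp add: \<phi>_def dot_square_norm)
  qed simp
  moreover have "C1 \<psi> \<and> (\<psi> has_derivative (\<lambda>u. p \<bullet> u)) (at x) \<Longrightarrow>
      \<exists>e>0. \<forall>y. dist y x < e \<longrightarrow> v y - \<psi> y \<le> v x - \<psi> x \<Longrightarrow> H x (c + p) \<le> h" for \<psi> p
    using visc unfolding viscosity_solution_def by metis
  ultimately show ?thesis by metis
qed

end

section \<open>Hamiltonian flow on the limit set\<close>

lemma has_vector_derivative_of_integral:
  fixes f g :: "real \<Rightarrow> 'a::banach"
  assumes cont: "continuous_on {a..b} f" and t: "a < t" "t < b"
    and int: "\<And>s. s \<in> {a..b} \<Longrightarrow> (f has_integral g s - g a) {a..s}"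
  shows "(g has_vector_derivative f t) (at t)"
proof -
  have "((\<lambda>s. integral {a..s} f) has_vector_derivative f t) (at t within {a..b})"
    using cont t by (intro integral_has_vector_derivative) auto
  then have d: "((\<lambda>s. g a + integral {a..s} f) has_vector_derivative f t) (at t within {a..b})"
    by (auto intro!: derivative_eq_intros)
  have eq: "g s = g a + integral {a..s} f" if "s \<in> {a..b}" for s
    using integral_unique[OF int[OF that]] by simp
  have "(g has_vector_derivative f t) (at t within {a..b})"
    by (rule has_vector_derivative_transform[OF _ eq d]) (use t in simp)
  then show ?thesis using at_within_Icc_at[OF t] by simp
qed

text \<open>Weighting by a decaying exponential for positive times and a growing one for negative
  times gives a product that never exceeds its value at time 0.\<close>

lemma Gronwall_zero:
  fixes N :: "real \<Rightarrow> real"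
  assumes d: "\<And>s. \<bar>s\<bar> \<le> S \<Longrightarrow> (N has_real_derivative N' s) (at s)"
    and b: "\<And>s. \<bar>s\<bar> \<le> S \<Longrightarrow> \<bar>N' s\<bar> \<le> K * N s"
    and N0: "N 0 = 0" "\<And>s. 0 \<le> N s" and s: "\<bar>s\<bar> \<le> S"
  shows "N s = 0"
proof (cases "0 \<le> s")
  case True
  have "exp (- (K * s)) * N s \<le> exp (- (K * 0)) * N 0"
  proof (rule DERIV_nonpos_imp_nonincreasing[OF True])
    fix t assume t: "0 \<le> t" "t \<le> s"
    have "((\<lambda>t. exp (- (K * t)) * N t) has_real_derivative exp (- (K * t)) * (N' t - K * N t)) (at t)"
      using t s by (auto intro!: derivative_eq_intros d simp: algebra_simps)
    moreover have "exp (- (K * t)) * (N' t - K * N t) \<le> 0"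
      using b[of t] t s by (intro mult_nonneg_nonpos) (auto simp: abs_le_iff)
    ultimately show "\<exists>y. ((\<lambda>t. exp (- (K * t)) * N t) has_real_derivative y) (at t) \<and> y \<le> 0" by blast
  qed
  then have "exp (- (K * s)) * N s \<le> 0" using N0 by simp
  then show ?thesis using N0(2)[of s] by (simp add: mult_le_0_iff)
next
  case False
  then have s0: "s \<le> 0" by simp
  have "exp (K * s) * N s \<le> exp (K * 0) * N 0"
  proof (rule DERIV_nonneg_imp_nondecreasing[OF s0])
    fix t assume t: "s \<le> t" "t \<le> 0"
    have "((\<lambda>t. exp (K * t) * N t) has_real_derivative exp (K * t) * (N' t + K * N t)) (at t)"
      using t s by (auto intro!: derivative_eq_intros d simp: algebra_simps)
    moreover have "0 \<le> exp (K * t) * (N' t + K * N t)"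
      using b[of t] t s by (intro mult_nonneg_nonneg) (auto simp: abs_le_iff)
    ultimately show "\<exists>y. ((\<lambda>t. exp (K * t) * N t) has_real_derivative y) (at t) \<and> 0 \<le> y" by blast
  qed
  then have "exp (K * s) * N s \<le> 0" using N0 by simp
  then show ?thesis using N0(2)[of s] by (simp add: mult_le_0_iff)
qed

context tonelli
begin

lemma gHp_per_minus: "k \<in> lattice \<Longrightarrow> gHp (x - k) p = gHp x p"
  using D_per[of "- k" x p] lattice_minus[of k] by (simp add: gHp_def)

text \<open>The Hamiltonian vector field is Lipschitz where the momentum is bounded, uniformly in
  the position. On a compact time interval both momenta are bounded, and Gronwall applies to the
  squared distance in phase space.\<close>

lemma hamilton_unique:
  assumes x1: "\<And>s. (x1 has_vector_derivative gHp (x1 s) (p1 s)) (at s)"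
    and p1: "\<And>s. (p1 has_vector_derivative - gHx (x1 s) (p1 s)) (at s)"
    and x2: "\<And>s. (x2 has_vector_derivative gHp (x2 s) (p2 s)) (at s)"
    and p2: "\<And>s. (p2 has_vector_derivative - gHx (x2 s) (p2 s)) (at s)"
    and init: "x1 0 = x2 0" "p1 0 = p2 0"
  shows "x1 t = x2 t \<and> p1 t = p2 t"
proof -
  define S where "S = \<bar>t\<bar>"
  have "continuous_on {- S..S} p1" "continuous_on {- S..S} p2"
    using p1 p2 by (meson continuous_at_imp_continuous_on has_vector_derivative_continuous)+
  then have "compact (p1 ` {- S..S} \<union> p2 ` {- S..S})"
    by (intro compact_Un compact_continuous_image) auto
  then obtain R where R: "\<And>z. z \<in> p1 ` {- S..S} \<union> p2 ` {- S..S} \<Longrightarrow> norm z \<le> R"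
    using compact_imp_bounded bounded_iff by metis
  have pR: "norm (p1 s) \<le> R" "norm (p2 s) \<le> R" if "\<bar>s\<bar> \<le> S" for s
    using R[OF UnI1[OF imageI, of s]] R[OF UnI2[OF imageI, of s]] that by (auto simp: abs_le_iff)
  obtain B where B: "B \<ge> 0"
    "\<And>x y p q. norm p \<le> R \<Longrightarrow> norm q \<le> R \<Longrightarrow> norm (gHx x p - gHx y q) \<le> B * (norm (x - y) + norm (p - q))"
    "\<And>x y p q. norm p \<le> R \<Longrightarrow> norm q \<le> R \<Longrightarrow> norm (gHp x p - gHp y q) \<le> B * (norm (x - y) + norm (p - q))"
    using H_bounds[of R] by metis
  define X P where "X s = x1 s - x2 s" and "P s = p1 s - p2 s" for s
  define dX dP where "dX s = gHp (x1 s) (p1 s) - gHp (x2 s) (p2 s)"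
    and "dP s = - (gHx (x1 s) (p1 s) - gHx (x2 s) (p2 s))" for s
  define N where "N s = X s \<bullet> X s + P s \<bullet> P s" for s
  have X: "(X has_vector_derivative dX s) (at s)" for s
    unfolding X_def dX_def by (intro has_vector_derivative_diff x1 x2)
  have P: "(P has_vector_derivative dP s) (at s)" for s
    unfolding P_def dP_def using has_vector_derivative_diff[OF p1 p2] by simp
  have "N t = 0"
  \<comment> \<open>The constant \<open>4 * B\<close> arises since both components of the vector
    field differ by at most \<open>B * m\<close> with \<open>m = norm (X s) + norm (P s)\<close>,
    and the square of \<open>m\<close> is at most \<open>2 * N s\<close>.\<close>
  proof (rule Gronwall_zero[of S N "\<lambda>s. 2 * (X s \<bullet> dX s) + 2 * (P s \<bullet> dP s)" "4 * B"])
    show "(N has_real_derivative 2 * (X s \<bullet> dX s) + 2 * (P s \<bullet> dP s)) (at s)" for s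
    proof -
      have "((\<lambda>s. X s \<bullet> X s) has_derivative (\<lambda>r. X s \<bullet> (r *\<^sub>R dX s) + (r *\<^sub>R dX s) \<bullet> X s)) (at s)"
        "((\<lambda>s. P s \<bullet> P s) has_derivative (\<lambda>r. P s \<bullet> (r *\<^sub>R dP s) + (r *\<^sub>R dP s) \<bullet> P s)) (at s)"
        by (intro has_derivative_inner X[unfolded has_vector_derivative_def] P[unfolded has_vector_derivative_def])+
      from has_derivative_add[OF this] show ?thesis
        unfolding N_def has_field_derivative_def
        by (rule has_derivative_eq_rhs) (auto simp: fun_eq_iff inner_commute algebra_simps)
    qed
    show "\<bar>2 * (X s \<bullet> dX s) + 2 * (P s \<bullet> dP s)\<bar> \<le> 4 * B * N s" if s: "\<bar>s\<bar> \<le> S" for s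
    proof -
      define m where "m = norm (X s) + norm (P s)"
      have d: "norm (dX s) \<le> B * m" "norm (dP s) \<le> B * m"
        using B(2,3)[OF pR[OF s]] unfolding m_def X_def P_def dX_def dP_def by (auto simp del: norm_minus_cancel simp: norm_minus_commute) 
      have "\<bar>X s \<bullet> dX s\<bar> \<le> norm (X s) * (B * m)"
        using Cauchy_Schwarz_ineq2[of "X s" "dX s"] mult_left_mono[OF d(1) norm_ge_zero[of "X s"]] by linarith
      moreover have "\<bar>P s \<bullet> dP s\<bar> \<le> norm (P s) * (B * m)"
        using Cauchy_Schwarz_ineq2[of "P s" "dP s"] mult_left_mono[OF d(2) norm_ge_zero[of "P s"]] by linarith
      ultimately have "\<bar>2 * (X s \<bullet> dX s) + 2 * (P s \<bullet> dP s)\<bar> \<le> 2 * (norm (X s) * (B * m)) + 2 * (norm (P s) * (B * m))"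
        by linarith
      also have "\<dots> = 2 * B * m\<^sup>2" by (simp add: m_def power2_eq_square algebra_simps)
      also have "\<dots> \<le> 2 * B * (2 * N s)"
      proof (rule mult_left_mono)
        have "0 \<le> (norm (X s) - norm (P s))\<^sup>2" by simp
        then show "m\<^sup>2 \<le> 2 * N s"
          unfolding m_def N_def dot_square_norm by (simp add: power2_eq_square algebra_simps)
      qed (use B(1) in simp)
      finally show ?thesis by simp
    qed
    show "N 0 = 0" using init by (simp add: N_def X_def P_def)
    show "0 \<le> N s" for s by (simp add: N_def)
    show "\<bar>t\<bar> \<le> S" by (simp add: S_def)
  qed
  then have "X t = 0" "P t = 0"
    unfolding N_def by (smt (verit) inner_ge_zero inner_eq_zero_iff)+
  then show ?thesis by (simp add: X_def P_def)
qed

end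

section \<open>Hamilton's equations along calibrated curves\<close>

context weak_kam
begin

text \<open>Along the curve v has derivative \<open>q \<bullet> \<xi>\<close> by the chain rule.
  Together with the subsolution inequality at \<open>c + q\<close>, the pointwise bound becomes
  equality in Fenchel's inequality.\<close>

lemma acal_velocity:
  assumes ac: "acal 0 S \<Gamma>" and d: "d > 0" "{t..t + d} \<subseteq> S"
    and \<xi>: "(\<Gamma> has_vector_derivative \<xi>) (at t)" and r: "regular q (\<Gamma> t)"
  shows "\<xi> = gHp (\<Gamma> t) (c + q)"
proof -
  have "((\<lambda>s. v (\<Gamma> s)) has_derivative (\<lambda>s. q \<bullet> (s *\<^sub>R \<xi>))) (at t)"
    using has_derivative_compose[OF \<xi>[unfolded has_vector_derivative_def] regular_has_derivative[OF r]] .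
  then have "((\<lambda>s. v (\<Gamma> s)) has_real_derivative q \<bullet> \<xi>) (at t)"
    unfolding has_field_derivative_def by (rule has_derivative_eq_rhs) (auto simp: fun_eq_iff)
  from acal_pointwise[OF ac d \<xi> this]
  have "lagrangian H (\<Gamma> t) \<xi> \<le> \<xi> \<bullet> (c + q) - H (\<Gamma> t) (c + q)"
    using regular_subsolution[OF r] by (simp add: inner_add_right inner_commute[of \<xi>])
  then show ?thesis using Fenchel_eq_imp by metis
qed

text \<open>A bootstrap: the gradient along the curve is an integral, hence continuous; then the
  velocity agrees almost everywhere with a continuous function, so the curve is continuously
  differentiable; and then so is the gradient.\<close>

lemma acal_hamilton:
  assumes ac: "acal 0 UNIV \<Gamma>"
  shows "regular (grad v (\<Gamma> t)) (\<Gamma> t)"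
    and "(\<Gamma> has_vector_derivative gHp (\<Gamma> t) (c + grad v (\<Gamma> t))) (at t)"
    and "((\<lambda>s. c + grad v (\<Gamma> s)) has_vector_derivative - gHx (\<Gamma> t) (c + grad v (\<Gamma> t))) (at t)"
proof -
  define q where "q s = grad v (\<Gamma> s)" for s
  have reg: "regular (q s) (\<Gamma> s)" for s
    using acal_regular[OF ac, of s] regular_grad by (auto simp: q_def)
  then show "regular (grad v (\<Gamma> t)) (\<Gamma> t)" by (simp add: q_def)
  obtain K where K: "K \<ge> 0" "\<And>S \<Gamma> a b \<alpha> \<beta> u. acal 0 S \<Gamma> \<Longrightarrow> {a..b} \<subseteq> S \<Longrightarrow> a \<le> b \<Longrightarrow> norm u \<le> 1 \<Longrightarrow> \<bar>\<beta>\<bar> \<le> 1 \<Longrightarrow>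
    (\<And>s. s \<in> {a..b} \<Longrightarrow> \<bar>\<alpha> + \<beta> * s\<bar> \<le> 1) \<Longrightarrow>
    v (\<Gamma> b + (\<alpha> + \<beta> * b) *\<^sub>R u) - v (\<Gamma> a + (\<alpha> + \<beta> * a) *\<^sub>R u)
      \<le> v (\<Gamma> b) - v (\<Gamma> a) + integral {a..b} (var1 \<Gamma> \<alpha> \<beta>) \<bullet> u + K * (b - a) * (norm u)\<^sup>2"
    using acal_perturb by blast
  have lip: "C0-lipschitz_on {a..b} \<Gamma>" for a b by (rule acal_lipschitz[OF ac]) simp
  \<comment> \<open>The piece is translated rigidly by \<open>u\<close>, and second-order contact at
    both ends replaces increments of v by \<open>q b\<close> and \<open>q a\<close>. The contact
    error \<open>2 * K1\<close> does not shrink with the interval, but it multiplies a square of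
    \<open>u\<close> and so does not affect the linear part.\<close>
  have qint: "(var1 \<Gamma> 1 0 has_integral q b - q a) {a..b}" if ab: "a \<le> b" for a b
  proof -
    let ?I = "integral {a..b} (var1 \<Gamma> 1 0)"
    have "(q b - q a - ?I) \<bullet> u \<le> (2 * K1 + K * (b - a)) * (norm u)\<^sup>2" if u: "norm u \<le> 1" for u
    proof -
      have "v (\<Gamma> b + u) - v (\<Gamma> a + u) \<le> v (\<Gamma> b) - v (\<Gamma> a) + ?I \<bullet> u + K * (b - a) * (norm u)\<^sup>2"
        using K(2)[OF ac, of a b u 0 1] ab u by simp
      moreover have "\<bar>v (\<Gamma> s + u) - v (\<Gamma> s) - q s \<bullet> u\<bar> \<le> K1 * (norm u)\<^sup>2" for s
        using reg u unfolding regular_def by blast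
      from this[of a] this[of b]
      have "q b \<bullet> u - K1 * (norm u)\<^sup>2 \<le> v (\<Gamma> b + u) - v (\<Gamma> b)" "v (\<Gamma> a + u) - v (\<Gamma> a) \<le> q a \<bullet> u + K1 * (norm u)\<^sup>2"
        by linarith+
      ultimately show ?thesis by (simp add: inner_diff_left algebra_simps)
    qed
    then have "q b - q a - ?I = 0" by (rule inner_le_quadratic_imp_zero)
    then have "q b - q a = ?I" by simp
    then show ?thesis
      using integrable_integral[OF var1_integrable[OF lip[of a b], where \<alpha> = 1 and \<beta> = 0]] by simp
  qed
  have qcont: "continuous_on {a..b} q" for a b
  proof -
    have "continuous_on {a..b} (\<lambda>s. q a + integral {a..s} (var1 \<Gamma> 1 0))"
      by (intro continuous_intros indefinite_integral_continuous_1 var1_integrable[OF lip])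
    moreover have "q a + integral {a..s} (var1 \<Gamma> 1 0) = q s" if "s \<in> {a..b}" for s
      using integral_unique[OF qint, of a s] that by simp
    ultimately show ?thesis by (rule continuous_on_eq)
  qed
  have \<Gamma>cont: "continuous_on {a..b} \<Gamma>" for a b by (rule lipschitz_on_continuous_on[OF lip])
  define N where "N a b = {x \<in> {a..b}. \<not> \<Gamma> differentiable (at x)}" for a b
  have N: "negligible (N a b)" for a b
    unfolding N_def by (intro abs_cont_on_differentiable_ae lipschitz_imp_abs_cont_on[OF lip])
  \<comment> \<open>Off the null set the velocity is \<open>gHp\<close> at the momentum
    \<open>c + q s\<close>. Since \<open>pm\<close> inverts \<open>gHp\<close>, this also turns
    \<open>mom\<close> in the first variation into \<open>c + q s\<close>.\<close>
  have vel: "vector_derivative \<Gamma> (at s) = gHp (\<Gamma> s) (c + q s)" if "s \<in> {a..b} - N a b" for s a b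
  proof -
    have "(\<Gamma> has_vector_derivative vector_derivative \<Gamma> (at s)) (at s)"
      using that by (simp add: N_def vector_derivative_works)
    from acal_velocity[OF ac zero_less_one _ this reg] show ?thesis by simp
  qed
  have pair: "continuous_on {a..b} (\<lambda>s. (\<Gamma> s, c + q s))" for a b by (intro continuous_intros \<Gamma>cont qcont)
  show "(\<Gamma> has_vector_derivative gHp (\<Gamma> t) (c + grad v (\<Gamma> t))) (at t)"
    unfolding q_def[symmetric]
  proof (rule has_vector_derivative_of_integral[of "t - 1" "t + 1" "\<lambda>s. gHp (\<Gamma> s) (c + q s)"])
    show "continuous_on {t - 1..t + 1} (\<lambda>s. gHp (\<Gamma> s) (c + q s))"
      using continuous_on_compose2[OF gHp_continuous pair[of "t - 1" "t + 1"]] by simp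
    fix s assume s: "s \<in> {t - 1..t + 1}"
    have "((\<lambda>x. vector_derivative \<Gamma> (at x)) has_integral \<Gamma> s - \<Gamma> (t - 1)) {t - 1..s}"
      using s by (intro abs_cont_on_has_integral_derivative lipschitz_imp_abs_cont_on[OF lip]) auto
    then show "((\<lambda>s. gHp (\<Gamma> s) (c + q s)) has_integral \<Gamma> s - \<Gamma> (t - 1)) {t - 1..s}"
      by (rule has_integral_spike[OF N[of "t - 1" s], rotated]) (simp add: vel)
  qed auto
  have "(q has_vector_derivative - gHx (\<Gamma> t) (c + q t)) (at t)"
  proof (rule has_vector_derivative_of_integral[of "t - 1" "t + 1" "\<lambda>s. - gHx (\<Gamma> s) (c + q s)"])
    show "continuous_on {t - 1..t + 1} (\<lambda>s. - gHx (\<Gamma> s) (c + q s))"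
      using continuous_on_minus[OF continuous_on_compose2[OF gHx_continuous pair[of "t - 1" "t + 1"]]] by simp
    fix s assume s: "s \<in> {t - 1..t + 1}"
    have "(var1 \<Gamma> 1 0 has_integral q s - q (t - 1)) {t - 1..s}" using s by (intro qint) auto
    then show "((\<lambda>s. - gHx (\<Gamma> s) (c + q s)) has_integral q s - q (t - 1)) {t - 1..s}"
      by (rule has_integral_spike[OF N[of "t - 1" s], rotated]) (simp add: var1_def mom_def vel)
  qed auto
  then show "((\<lambda>s. c + grad v (\<Gamma> s)) has_vector_derivative - gHx (\<Gamma> t) (c + grad v (\<Gamma> t))) (at t)"
    unfolding q_def by (auto intro!: derivative_eq_intros)
qed

section \<open>Orbits in the limit set and their velocities\<close>

text \<open>Two limits are taken. For a genuine limit point, time and lattice translates of the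
  minimizing curve live on half-lines that exhaust the real line. A point of the closure is then
  reached by a limit of such entire curves.\<close>

lemma M_alpha_v_orbit:
  assumes "y \<in> M_alpha_v H c h v"
  obtains \<Gamma> where "acal 0 UNIV \<Gamma>" "\<Gamma> 0 = y" "\<And>s. \<Gamma> s \<in> M_alpha_v H c h v"
proof -
  define A where "A = {y. \<exists>\<gamma>. minimizing_curve H c h v \<gamma> \<and> alpha_limit_point \<gamma> y}"
  have 1: "\<exists>\<Gamma>. acal 0 UNIV \<Gamma> \<and> \<Gamma> 0 = y \<and> (\<forall>s. \<Gamma> s \<in> A)" if yA: "y \<in> A" for y
  proof -
    obtain \<gamma> where \<gamma>: "minimizing_curve H c h v \<gamma>" and al: "alpha_limit_point \<gamma> y"
      using yA unfolding A_def by auto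
    obtain \<tau> k where \<tau>: "filterlim \<tau> at_bot sequentially"
      and k: "\<forall>j. k j \<in> lattice" and lim: "(\<lambda>j. \<gamma> (\<tau> j) - k j) \<longlonglongrightarrow> y"
      using al unfolding alpha_limit_point_def by auto
    have ac: "acal 0 {..0} \<gamma>" by (rule minimizing_curve_acal[OF \<gamma>])
    have "\<forall>\<^sub>F j in sequentially. \<tau> j \<le> 0" using \<tau> unfolding filterlim_at_bot by blast
    \<comment> \<open>Dropping the first \<open>n\<close> terms puts time 0 into the domain of every
      translate, as the compactness lemma demands.\<close>
    then obtain n where n: "\<And>j. j \<ge> n \<Longrightarrow> \<tau> j \<le> 0" unfolding eventually_sequentially by blast
    define g where "g j s = \<gamma> (s + \<tau> (j + n)) - k (j + n)" for j s
    define S where "S j = {s. s + \<tau> (j + n) \<in> {..0}}" for j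
    have \<tau>n: "filterlim (\<lambda>j. \<tau> (j + n)) at_bot sequentially"
      using filterlim_compose[OF \<tau> filterlim_subseq[of "\<lambda>j. j + n"]] by (simp add: strict_mono_def)
    obtain r \<Gamma> where r: "strict_mono r" "\<And>t. t \<in> UNIV \<Longrightarrow> (\<lambda>j. g (r j) t) \<longlonglongrightarrow> \<Gamma> t" "acal 0 UNIV \<Gamma>" "\<Gamma> 0 = y"
    proof (rule acal_compactness[of "\<lambda>j. 0" S g UNIV y])
      show "acal 0 (S j) (g j)" for j
        unfolding S_def g_def using k by (intro acal_translate[OF ac]) auto
      show "\<forall>\<^sub>F j in sequentially. t \<in> S j" for t
        using \<tau>n[unfolded filterlim_at_bot, rule_format, of "- t"]
        by (rule eventually_mono) (simp add: S_def)
      show "0 \<in> S j" for j using n[of "j + n"] by (simp add: S_def)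
      show "(\<lambda>j. g j 0) \<longlonglongrightarrow> y" unfolding g_def using LIMSEQ_ignore_initial_segment[OF lim, of n] by simp
    qed (use closure_Rats_UNIV in auto)
    \<comment> \<open>The point \<open>\<Gamma> s\<close> is a limit of the same minimizing curve
      along the times \<open>s + \<tau> (r j + n)\<close>, which still tend to minus
      infinity.\<close>
    have "\<Gamma> s \<in> A" for s
    proof -
      have "filterlim (\<lambda>j. \<tau> (r j + n)) at_bot sequentially"
        using filterlim_compose[OF \<tau>n filterlim_subseq[OF r(1)]] .
      then have *: "\<forall>\<^sub>F j in sequentially. \<tau> (r j + n) \<le> Z - s" for Z
        unfolding filterlim_at_bot by blast
      have "\<forall>\<^sub>F j in sequentially. s + \<tau> (r j + n) \<le> Z" for Z
        by (rule eventually_mono[OF *[of Z]]) simp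
      then have "filterlim (\<lambda>j. s + \<tau> (r j + n)) at_bot sequentially"
        unfolding filterlim_at_bot by blast
      then have "alpha_limit_point \<gamma> (\<Gamma> s)"
        using k r(2)[of s] unfolding alpha_limit_point_def g_def
        by (intro exI[of _ "\<lambda>j. s + \<tau> (r j + n)"] exI[of _ "\<lambda>j. k (r j + n)"]) auto
      then show ?thesis using \<gamma> unfolding A_def by blast
    qed
    then show ?thesis using r(3,4) by (intro exI[of _ \<Gamma>]) simp
  qed
  have M: "M_alpha_v H c h v = closure A" by (simp add: M_alpha_v_def A_def)
  \<comment> \<open>The curves through the approximating points lie in \<open>A\<close>, so their
    limit stays in the closure of \<open>A\<close> at every time.\<close>
  obtain Y where Y: "\<And>j. Y j \<in> A" "Y \<longlonglongrightarrow> y" using assms unfolding M closure_sequential by auto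
  have "\<exists>\<Gamma>. \<forall>j. acal 0 UNIV (\<Gamma> j) \<and> \<Gamma> j 0 = Y j \<and> (\<forall>s. \<Gamma> j s \<in> A)"
    using 1[OF Y(1)] by (intro choice allI)
  then obtain \<Gamma>s where \<Gamma>s: "\<And>j. acal 0 UNIV (\<Gamma>s j)" "\<And>j. \<Gamma>s j 0 = Y j" "\<And>j s. \<Gamma>s j s \<in> A" by auto
  obtain r \<Gamma> where r: "strict_mono r" "\<And>t. t \<in> UNIV \<Longrightarrow> (\<lambda>j. \<Gamma>s (r j) t) \<longlonglongrightarrow> \<Gamma> t" "acal 0 UNIV \<Gamma>" "\<Gamma> 0 = y"
    by (rule acal_compactness[of "\<lambda>j. 0" "\<lambda>j. UNIV" \<Gamma>s UNIV y]) (use \<Gamma>s Y closure_Rats_UNIV in auto)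
  have "\<Gamma> s \<in> closure A" for s
    unfolding closure_sequential using \<Gamma>s(3) r(2)[of s] by (intro exI[of _ "\<lambda>j. \<Gamma>s (r j) s"]) auto
  then show thesis using that[OF r(3,4)] M by simp
qed

lemma M_alpha_v_differentiable:
  assumes "y \<in> M_alpha_v H c h v"
  shows "v differentiable (at y)"
proof -
  obtain \<Gamma> where \<Gamma>: "acal 0 UNIV \<Gamma>" "\<Gamma> 0 = y" by (rule M_alpha_v_orbit[OF assms])
  show ?thesis using regular_differentiable[OF acal_hamilton(1)[OF \<Gamma>(1), of 0]] \<Gamma>(2) by simp
qed

text \<open>At each time \<tau> the velocity is \<open>gHp\<close> at a regular gradient. These
  gradients are bounded, and any limit of them is regular at \<open>y\<close>, hence equal to the
  gradient of v there.\<close>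

lemma alpha_limit_velocity:
  assumes \<gamma>: "minimizing_curve H c h v \<gamma>" and \<tau>: "filterlim \<tau> at_bot sequentially"
    and k: "\<And>j. k j \<in> lattice" and \<xi>: "\<And>j. (\<gamma> has_vector_derivative \<xi> j) (at (\<tau> j))"
    and y: "(\<lambda>j. \<gamma> (\<tau> j) - k j) \<longlonglongrightarrow> y" and \<xi>s: "\<xi> \<longlonglongrightarrow> \<xi>s"
  shows "\<xi>s = gHp y (c + grad v y)"
proof -
  have ac: "acal 0 {..0} \<gamma>" by (rule minimizing_curve_acal[OF \<gamma>])
  have "\<forall>\<^sub>F j in sequentially. \<tau> j \<le> - 1" using \<tau> unfolding filterlim_at_bot by blast
  then obtain n where n: "\<And>j. j \<ge> n \<Longrightarrow> \<tau> j \<le> - 1" unfolding eventually_sequentially by blast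
  define x where "x j = \<gamma> (\<tau> (j + n)) - k (j + n)" for j
  \<comment> \<open>Times at most -1 leave the unit of future, up to time 0, that regularity
    requires.\<close>
  have "\<exists>q. regular q (\<gamma> (\<tau> (j + n)))" for j
    by (rule acal_regular[OF ac]) (use n[of "j + n"] in auto)
  then have "\<exists>q. \<forall>j. regular (q j) (\<gamma> (\<tau> (j + n)))" by (intro choice allI)
  then obtain q where q: "\<And>j. regular (q j) (\<gamma> (\<tau> (j + n)))" by blast
  have "\<xi> (j + n) = gHp (\<gamma> (\<tau> (j + n))) (c + q j)" for j
    by (rule acal_velocity[OF ac zero_less_one _ \<xi> q]) (use n[of "j + n"] in auto)
  then have vel: "\<xi> (j + n) = gHp (x j) (c + q j)" for j by (simp add: x_def gHp_per_minus[OF k])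
  have regx: "regular (q j) (x j)" for j unfolding x_def by (rule regular_translate[OF q k])
  have xlim: "x \<longlonglongrightarrow> y" unfolding x_def by (rule LIMSEQ_ignore_initial_segment[OF y])
  obtain q0 \<sigma> where \<sigma>: "strict_mono (\<sigma> :: nat \<Rightarrow> nat)" "(\<lambda>j. q (\<sigma> j)) \<longlonglongrightarrow> q0" "regular q0 y"
    using regular_sequence_limit[OF regx xlim] by blast
  have "(\<lambda>j. (x (\<sigma> j), c + q (\<sigma> j))) \<longlonglongrightarrow> (y, c + q0)"
    using LIMSEQ_subseq_LIMSEQ[OF xlim \<sigma>(1)] by (intro tendsto_intros \<sigma>(2)) (simp add: o_def)
  from continuous_on_tendsto_compose[OF gHp_continuous this]
  have "(\<lambda>j. \<xi> (\<sigma> j + n)) \<longlonglongrightarrow> gHp y (c + q0)" by (simp add: vel)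
  moreover have "(\<lambda>j. \<xi> (\<sigma> j + n)) \<longlonglongrightarrow> \<xi>s"
    using LIMSEQ_subseq_LIMSEQ[OF LIMSEQ_ignore_initial_segment[OF \<xi>s, of n] \<sigma>(1)] by (simp add: o_def)
  ultimately show ?thesis using LIMSEQ_unique regular_grad[OF \<sigma>(3)] by blast
qed

text \<open>\<open>Lxi\<close> is the momentum \<open>pm\<close>, so the Euler-Lagrange equation is
  Hamilton's system for \<open>X\<close> and its momentum. The calibrated orbit through
  \<open>y\<close> solves the same system, and the prescribed initial velocity is the one whose
  momentum is \<open>c + grad v y\<close>.\<close>

lemma euler_lagrange_orbit:
  assumes y: "y \<in> M_alpha_v H c h v" and X0: "X 0 = y" "X' 0 = Hp H y (c + grad v y)"
    and dX: "\<And>s. (X has_vector_derivative X' s) (at s)"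
    and EL: "\<And>s. ((\<lambda>s. Lxi H (X s) (X' s)) has_vector_derivative Lx H (X s) (X' s)) (at s)"
  shows "X s \<in> M_alpha_v H c h v \<and> v differentiable (at (X s)) \<and> grad v (X s) = Lxi H (X s) (X' s) - c"
proof -
  obtain \<Gamma> where \<Gamma>: "acal 0 UNIV \<Gamma>" "\<Gamma> 0 = y" "\<And>s. \<Gamma> s \<in> M_alpha_v H c h v"
    using M_alpha_v_orbit[OF y] by blast
  have eq: "X s = \<Gamma> s \<and> pm (X s) (X' s) = c + grad v (\<Gamma> s)"
  proof (rule hamilton_unique)
    show "(X has_vector_derivative gHp (X s) (pm (X s) (X' s))) (at s)" for s using dX by simp
    show "((\<lambda>s. pm (X s) (X' s)) has_vector_derivative - gHx (X s) (pm (X s) (X' s))) (at s)" for s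
      using EL[of s] by (simp add: Lxi_eq Lx_eq)
    show "X 0 = \<Gamma> 0" "pm (X 0) (X' 0) = c + grad v (\<Gamma> 0)" using X0 \<Gamma>(2) by (auto simp: Hp_eq)
  qed (rule acal_hamilton(2,3)[OF \<Gamma>(1)])+
  moreover have "v differentiable (at (\<Gamma> s))" by (rule M_alpha_v_differentiable[OF \<Gamma>(3)])
  moreover have "grad v (X s) = Lxi H (X s) (X' s) - c"
    unfolding Lxi_eq eq[THEN conjunct2] by (simp add: eq)
  ultimately show ?thesis using \<Gamma>(3)[of s] by simp
qed

end

section \<open>Comparison of two solutions and conclusion\<close>

text \<open>Along a minimizing curve of v the increments of v equal the action, while those of w are
  at most the action. Hence w - v at \<open>x\<close> is at most its value far back on the curve,
  and by periodicity these values converge along a sequence to the value at a limit point, where v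
  and w agree.\<close>

lemma weak_kam_comparison:
  assumes "weak_kam H D D2 c h v C" "weak_kam H D D2 c h w C'"
    and eq: "\<And>y. y \<in> M_alpha H c h \<Longrightarrow> v y = w y"
  shows "w x \<le> v x"
proof -
  interpret v: weak_kam H D D2 c h v C by fact
  interpret w: weak_kam H D D2 c h w C' by fact
  obtain \<gamma> where \<gamma>: "minimizing_curve_for H c h v x \<gamma>" using v.minimizing_curve_exists[of x] by auto
  then have \<gamma>x: "\<gamma> 0 = x" and adm: "\<And>T. T > 0 \<Longrightarrow> admissible H c h T \<gamma> \<and> action H c h T \<gamma> + v (\<gamma> (- T)) = v x"
    unfolding minimizing_curve_for_def by auto
  obtain y where y: "alpha_limit_point \<gamma> y" using alpha_limit_point_exists[of \<gamma>] by auto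
  then obtain \<tau> k where \<tau>: "filterlim \<tau> at_bot sequentially" and k: "\<forall>j. k j \<in> lattice"
    and lim: "(\<lambda>j. \<gamma> (\<tau> j) - k j) \<longlonglongrightarrow> y" unfolding alpha_limit_point_def by auto
  have "y \<in> M_alpha_v H c h v"
    unfolding M_alpha_v_def by (rule closure_subset[THEN subsetD]) (use \<gamma> y in \<open>auto simp: minimizing_curve_def\<close>)
  then have "y \<in> M_alpha H c h"
    unfolding M_alpha_def by (intro closure_subset[THEN subsetD]) (use v.visc in auto)
  then have vw: "v y = w y" by (rule eq)
  have le: "w x - v x \<le> w (\<gamma> (\<tau> j) - k j) - v (\<gamma> (\<tau> j) - k j)" if "\<tau> j < 0" for j
  proof -
    have a: "abs_cont_on \<gamma> (\<tau> j) 0" "action_integrand H c h \<gamma> absolutely_integrable_on {\<tau> j..0}"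
      "integral {\<tau> j..0} (action_integrand H c h \<gamma>) + v (\<gamma> (\<tau> j)) = v x"
      using adm[of "- \<tau> j"] that by (auto simp: admissible_def action_def)
    have "w (\<gamma> 0) - w (\<gamma> (\<tau> j)) \<le> integral {\<tau> j..0} (action_integrand H c h \<gamma>)"
      by (rule w.domination) (use a that in auto)
    then show ?thesis using a(3) \<gamma>x k by (simp add: v.v_per_minus w.v_per_minus)
  qed
  have "(\<lambda>j. w (\<gamma> (\<tau> j) - k j) - v (\<gamma> (\<tau> j) - k j)) \<longlonglongrightarrow> w y - v y"
    using continuous_on_tendsto_compose[OF w.v_continuous lim] continuous_on_tendsto_compose[OF v.v_continuous lim]
    by (intro tendsto_diff) auto
  moreover have "\<forall>\<^sub>F j in sequentially. \<tau> j < 0"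
    using \<tau> unfolding filterlim_at_bot_dense by blast
  then have "\<forall>\<^sub>F j in sequentially. w x - v x \<le> w (\<gamma> (\<tau> j) - k j) - v (\<gamma> (\<tau> j) - k j)"
    by (rule eventually_mono) (rule le)
  ultimately have "w x - v x \<le> w y - v y"
    by (intro tendsto_lowerbound[of _ "w y - v y" sequentially]) auto
  then show ?thesis using vw by simp
qed

theorem theorem2p2:
  fixes H :: "real^'n \<Rightarrow> real^'n \<Rightarrow> real" and c :: "real^'n" and h :: real
    and v :: "real^'n \<Rightarrow> real"
  assumes tonelli: "tonelli_hamiltonian H"
    and standing_facts: "\<forall>w. viscosity_solution H c h w \<longrightarrow>
         (\<exists>C. C-lipschitz_on UNIV w) \<and> representation_formula H c h w"
    and visc: "viscosity_solution H c h v"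
  shows
    "(\<forall>y \<in> M_alpha_v H c h v. v differentiable (at y))
   \<and> (\<forall>\<gamma> \<tau> k \<xi> y \<xi>s. minimizing_curve H c h v \<gamma> \<and> filterlim \<tau> at_bot sequentially \<and>
        (\<forall>j. k j \<in> lattice) \<and> (\<forall>j. (\<gamma> has_vector_derivative \<xi> j) (at (\<tau> j))) \<and>
        ((\<lambda>j. \<gamma> (\<tau> j) - k j) \<longlongrightarrow> y) sequentially \<and> (\<xi> \<longlongrightarrow> \<xi>s) sequentially
        \<longrightarrow> \<xi>s = Hp H y (c + grad v y))
   \<and> (\<forall>y X X'. y \<in> M_alpha_v H c h v \<and> X 0 = y \<and> X' 0 = Hp H y (c + grad v y) \<and>
        (\<forall>s. (X has_vector_derivative X' s) (at s)) \<and>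
        (\<forall>s. ((\<lambda>s. Lxi H (X s) (X' s)) has_vector_derivative Lx H (X s) (X' s)) (at s))
        \<longrightarrow> (\<forall>s. X s \<in> M_alpha_v H c h v \<and> v differentiable (at (X s)) \<and>
                  grad v (X s) = Lxi H (X s) (X' s) - c))
   \<and> (\<forall>w. viscosity_solution H c h w \<and> (\<forall>y \<in> M_alpha H c h. v y = w y) \<longrightarrow> w = v)"
proof -
  have per: "\<forall>p. periodic (\<lambda>x. H x p)"
    and ex: "\<exists>D D2. C2_with (\<lambda>(x, p). H x p) D D2 \<and>
        (\<forall>x p u. u \<noteq> 0 \<longrightarrow> blinfun_apply (blinfun_apply (D2 (x, p)) (0, u)) (0, u) > 0)"
    and sup: "\<forall>M. \<exists>R. \<forall>x p. norm p \<ge> R \<longrightarrow> H x p \<ge> M * norm p"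
    using tonelli unfolding tonelli_hamiltonian_def by simp_all
  obtain D D2 where C2: "C2_with (\<lambda>(x, p). H x p) D D2"
    and pos: "\<forall>x p u. u \<noteq> 0 \<longrightarrow> blinfun_apply (blinfun_apply (D2 (x, p)) (0, u)) (0, u) > 0"
    using ex by (elim exE conjE)
  interpret tonelli H D D2
  proof
    show "k \<in> lattice \<Longrightarrow> H (x + k) p = H x p" for k x p
      using per unfolding periodic_def by simp
    show "((\<lambda>z. H (fst z) (snd z)) has_derivative blinfun_apply (D z)) (at z)" for z
      using C2 unfolding C2_with_def case_prod_unfold by (cases z) simp
    show "(D has_derivative blinfun_apply (D2 z)) (at z)" for z
      using C2 unfolding C2_with_def by (cases z) simp
    show "continuous_on UNIV D2" using C2 unfolding C2_with_def by simp
    show "u \<noteq> 0 \<Longrightarrow> blinfun_apply (blinfun_apply (D2 (x, p)) (0, u)) (0, u) > 0" for u x p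
      using pos by simp
    show "\<exists>R. \<forall>x p. norm p \<ge> R \<longrightarrow> H x p \<ge> M * norm p" for M using sup by (rule spec)
  qed
  \<comment> \<open>All solutions share H and its derivatives; only the Lipschitz constant varies
    with the solution. Having this for every \<open>w\<close> lets the comparison run in both
    directions.\<close>
  have wk: "\<exists>C. weak_kam H D D2 c h w C" if w: "viscosity_solution H c h w" for w
  proof -
    obtain C where "C-lipschitz_on UNIV w" "representation_formula H c h w"
      using standing_facts[rule_format, OF w] by auto
    then have "weak_kam H D D2 c h w C" using w by unfold_locales
    then show ?thesis by blast
  qed
  then obtain C where C: "weak_kam H D D2 c h v C" using visc by blast
  then interpret weak_kam H D D2 c h v C .
  show ?thesis
  proof (intro conjI, goal_cases)
    case 1
    show ?case using M_alpha_v_differentiable by blast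
  next
    case 2
    show ?case unfolding Hp_eq by (intro allI impI, elim conjE, rule alpha_limit_velocity) auto
  next
    case 3
    show ?case by (intro allI impI, elim conjE, rule euler_lagrange_orbit) auto
  next
    case 4
    show ?case
    proof (intro allI impI, elim conjE)
      fix w assume w: "viscosity_solution H c h w" and eq: "\<forall>y \<in> M_alpha H c h. v y = w y"
      obtain C' where C': "weak_kam H D D2 c h w C'" using wk[OF w] by blast
      have "w x \<le> v x" "v x \<le> w x" for x
        using weak_kam_comparison[OF C C'] weak_kam_comparison[OF C' C] eq by auto
      then show "w = v" by (intro ext antisym)
    qed
  qed
qed

end
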